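(* Let $\boldsymbol{\alpha}$ be a magnetic potential (a smooth real $1$-form) on a closed connected Riemannian manifold $M$. Then $$h_1^{\boldsymbol{\alpha}}\;\le\; 2\sqrt{2\,\lambda_1(\Delta^{\boldsymbol{\alpha}})} .$$
   Context: The magnetic Laplacian is $\Delta^{\boldsymbol{\alpha}}=D^*D$ with $D=d+i\boldsymbol{\alpha}$ mapping smooth complex functions to smooth complex $1$-forms and $D^*$ its formal $L^2$-adjoint (all with respect to the Riemannian metric and Riemannian measure $dx$). It is essentially self-adjoint on $C^\infty(M,\mathbb{C})\subset L^2(M,\mathbb{C})$ with discrete spectrum $0\le\lambda_1(\Delta^{\boldsymbol{\alpha}})\le\lambda_2(\Delta^{\boldsymbol{\alpha}})\le\cdots\nearrow\infty$ (with multiplicity). In particular $\lambda_1(\Delta^{\boldsymbol{\alpha}})=\inf_{0\not\equiv f\in C^\infty(M,\mathbb{C})}\int_M|(d+i\boldsymbol{\alpha})f|^2dx\big/\int_M|f|^2dx$. For a nonempty Borel set $\Omega\subseteq M$, the frustration index is $$\iota^{\boldsymbol{\alpha}}(\Omega)=\inf_{\tau\in C^\infty(\Omega,U(1))}\int_\Omega|(d+i\boldsymbol{\alpha})\tau|\,dx,$$ where $U(1)=\{z\in\mathbb{C}\mid|z|=1\}$ and $C^\infty(\Omega,U(1))$ is the set of smooth maps $\Omega\to U(1)$ (smooth on a non-open set in the usual sense of extending smoothly near each point). The boundary measure is $\mathrm{area}(\partial\Omega)=\liminf_{r\to0^+}\frac{\mathrm{vol}(\Omega_r)-\mathrm{vol}(\Omega)}{r}$,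 with $\Omega_r$ the open $r$-neighborhood of $\Omega$ and $\mathrm{vol}$ the Riemannian volume. For $\mathrm{vol}(\Omega)>0$ put $\phi^{\boldsymbol{\alpha}}(\Omega)=\frac{\iota^{\boldsymbol{\alpha}}(\Omega)+\mathrm{area}(\partial\Omega)}{\mathrm{vol}(\Omega)}$. Then $h_1^{\boldsymbol{\alpha}}=\inf_{\Omega}\phi^{\boldsymbol{\alpha}}(\Omega)$, the infimum over Borel sets $\Omega\subseteq M$ with $\mathrm{vol}(\Omega)>0$. *)

theory Defs
  imports "HOL-Analysis.Analysis"
begin

section \<open>Smooth maps between open subsets of normed spaces\<close>

text \<open>
  \<open>C_on k f S\<close> is the usual notion of a \<open>C\<^sup>k\<close> map for open \<open>S\<close>.  It speaks about
  \<open>frechet_derivative f (at x)\<close> and is only ever applied to open sets.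
\<close>

primrec C_on :: "nat \<Rightarrow> ('a::euclidean_space \<Rightarrow> 'b::real_normed_vector) \<Rightarrow> 'a set \<Rightarrow> bool" where
  "C_on 0 f S \<longleftrightarrow> continuous_on S f"
| "C_on (Suc k) f S \<longleftrightarrow>
     f differentiable_on S \<and> (\<forall>v. C_on k (\<lambda>x. frechet_derivative f (at x) v) S)"

definition smooth_map_on :: "'a::euclidean_space set \<Rightarrow> ('a \<Rightarrow> 'b::real_normed_vector) \<Rightarrow> bool" where
  "smooth_map_on S f \<longleftrightarrow> (\<forall>k. C_on k f S)"

section \<open>Smooth manifolds\<close>

text \<open>
  The points of the manifold are the elements of a Hausdorff, second countable type \<open>'m\<close>.
  A chart is a pair of its domain and its coordinate map; the dimension is \<open>CARD('n) \<ge> 1\<close>.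
\<close>

type_synonym ('m, 'n) chart = "'m set \<times> ('m \<Rightarrow> real ^ 'n)"

definition chart_inv :: "('m, 'n::finite) chart \<Rightarrow> real ^ 'n \<Rightarrow> 'm" where
  "chart_inv c = inv_into (fst c) (snd c)"

definition smooth_atlas ::
    "('m::{t2_space, second_countable_topology}, 'n::finite) chart set \<Rightarrow> bool" where
  "smooth_atlas A \<longleftrightarrow>
     (\<Union>c\<in>A. fst c) = UNIV \<and>
     (\<forall>c\<in>A. open (fst c) \<and> open (snd c ` fst c) \<and>
            homeomorphism (fst c) (snd c ` fst c) (snd c) (chart_inv c)) \<and>
     (\<forall>c\<in>A. \<forall>d\<in>A. smooth_map_on (snd c ` (fst c \<inter> fst d)) (snd d \<circ> chart_inv c))"

text \<open>The Jacobian at \<open>p\<close> of the change of coordinates from \<open>c\<close> to \<open>d\<close>.\<close>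

definition jacobian :: "('m, 'n::finite) chart \<Rightarrow> ('m, 'n) chart \<Rightarrow> 'm \<Rightarrow> real ^ 'n ^ 'n" where
  "jacobian c d p = matrix (frechet_derivative (snd d \<circ> chart_inv c) (at (snd c p)))"

definition smooth_on_open ::
    "('m::topological_space, 'n::finite) chart set \<Rightarrow> 'm set \<Rightarrow> ('m \<Rightarrow> 'b::real_normed_vector) \<Rightarrow> bool"
  where
  "smooth_on_open A V f \<longleftrightarrow>
     open V \<and> (\<forall>c\<in>A. smooth_map_on (snd c ` (fst c \<inter> V)) (f \<circ> chart_inv c))"

definition smooth_fun ::
    "('m::topological_space, 'n::finite) chart set \<Rightarrow> ('m \<Rightarrow> complex) \<Rightarrow> bool" where
  "smooth_fun A f \<longleftrightarrow> smooth_on_open A UNIV f"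

text \<open>
  Tensor fields are given by their components: \<open>T c p\<close> are the components at the point \<open>p\<close> in
  the chart \<open>c\<close>, subject to the transformation law of the respective type of tensor.
  The values \<open>T c p\<close> for \<open>p \<notin> fst c\<close> or \<open>c \<notin> A\<close> are irrelevant.
  For \<open>'b = real\<close> and \<open>'b = complex\<close> the following are the real and the complex one-forms.
\<close>

definition smooth_one_form ::
    "('m::topological_space, 'n::finite) chart set \<Rightarrow>
     (('m, 'n) chart \<Rightarrow> 'm \<Rightarrow> 'b::real_normed_vector ^ 'n) \<Rightarrow> bool" where
  "smooth_one_form A w \<longleftrightarrow>
     (\<forall>c\<in>A. smooth_map_on (snd c ` fst c) (w c \<circ> chart_inv c)) \<and>
     (\<forall>c\<in>A. \<forall>d\<in>A. \<forall>p\<in>fst c \<inter> fst d.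
        w c p = (\<chi> i. \<Sum>j\<in>UNIV. (jacobian c d p $ j $ i) *\<^sub>R (w d p $ j)))"

definition riemannian_metric ::
    "('m::topological_space, 'n::finite) chart set \<Rightarrow>
     (('m, 'n) chart \<Rightarrow> 'm \<Rightarrow> real ^ 'n ^ 'n) \<Rightarrow> bool" where
  "riemannian_metric A g \<longleftrightarrow>
     (\<forall>c\<in>A. smooth_map_on (snd c ` fst c) (g c \<circ> chart_inv c)) \<and>
     (\<forall>c\<in>A. \<forall>p\<in>fst c. transpose (g c p) = g c p \<and> (\<forall>v. v \<noteq> 0 \<longrightarrow> v \<bullet> (g c p *v v) > 0)) \<and>
     (\<forall>c\<in>A. \<forall>d\<in>A. \<forall>p\<in>fst c \<inter> fst d.
        g c p = transpose (jacobian c d p) ** g d p ** jacobian c d p)"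

definition closed_connected_riemannian_manifold ::
    "('m::{t2_space, second_countable_topology}, 'n::finite) chart set \<Rightarrow>
     (('m, 'n) chart \<Rightarrow> 'm \<Rightarrow> real ^ 'n ^ 'n) \<Rightarrow> bool" where
  "closed_connected_riemannian_manifold A g \<longleftrightarrow>
     smooth_atlas A \<and> riemannian_metric A g \<and>
     compact (UNIV :: 'm set) \<and> connected (UNIV :: 'm set)"

text \<open>
  Pointwise scalars built from tensor components are evaluated in an arbitrary chart around the
  point; by the transformation laws they do not depend on it.
\<close>

definition chart_at :: "('m, 'n::finite) chart set \<Rightarrow> 'm \<Rightarrow> ('m, 'n) chart" where
  "chart_at A p = (SOME c. c \<in> A \<and> p \<in> fst c)"

section \<open>Riemannian volume and distance\<close>

definition vol ::
    "('m::topological_space, 'n::finite) chart set \<Rightarrow>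
     (('m, 'n) chart \<Rightarrow> 'm \<Rightarrow> real ^ 'n ^ 'n) \<Rightarrow> 'm measure" where
  "vol A g = (THE \<mu>. sets \<mu> = sets borel \<and>
     (\<forall>c\<in>A. \<forall>B\<in>sets borel. B \<subseteq> fst c \<longrightarrow>
        emeasure \<mu> B =
          (\<integral>\<^sup>+x\<in>snd c ` B. ennreal (sqrt (det (g c (chart_inv c x)))) \<partial>lborel)))"

definition C1_curve_on ::
    "('m::topological_space, 'n::finite) chart set \<Rightarrow> (real \<Rightarrow> 'm) \<Rightarrow> real \<Rightarrow> real \<Rightarrow> bool" where
  "C1_curve_on A \<gamma> a b \<longleftrightarrow>
     continuous_on {a..b} \<gamma> \<and>
     (\<forall>c\<in>A. \<exists>v. continuous_on {t\<in>{a..b}. \<gamma> t \<in> fst c} v \<and>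
        (\<forall>t\<in>{a..b}. \<gamma> t \<in> fst c \<longrightarrow>
           ((snd c \<circ> \<gamma>) has_vector_derivative v t) (at t within {a..b})))"

definition piecewise_C1_curve ::
    "('m::topological_space, 'n::finite) chart set \<Rightarrow> (real \<Rightarrow> 'm) \<Rightarrow> bool" where
  "piecewise_C1_curve A \<gamma> \<longleftrightarrow>
     (\<exists>(N::nat) t. t 0 = 0 \<and> t N = 1 \<and>
        (\<forall>k<N. t k < t (Suc k) \<and> C1_curve_on A \<gamma> (t k) (t (Suc k))))"

text \<open>The two-sided derivative may fail to exist at finitely many breakpoints and end points.\<close>

definition curve_speed ::
    "('m, 'n::finite) chart set \<Rightarrow> (('m, 'n) chart \<Rightarrow> 'm \<Rightarrow> real ^ 'n ^ 'n) \<Rightarrow>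
     (real \<Rightarrow> 'm) \<Rightarrow> real \<Rightarrow> real" where
  "curve_speed A g \<gamma> t =
     (let c = chart_at A (\<gamma> t); v = vector_derivative (snd c \<circ> \<gamma>) (at t)
      in sqrt (v \<bullet> (g c (\<gamma> t) *v v)))"

definition riemannian_dist ::
    "('m::topological_space, 'n::finite) chart set \<Rightarrow> (('m, 'n) chart \<Rightarrow> 'm \<Rightarrow> real ^ 'n ^ 'n) \<Rightarrow>
     'm \<Rightarrow> 'm \<Rightarrow> ennreal" where
  "riemannian_dist A g p q =
     (INF \<gamma>\<in>{\<gamma>. piecewise_C1_curve A \<gamma> \<and> \<gamma> 0 = p \<and> \<gamma> 1 = q}.
        \<integral>\<^sup>+t\<in>{0..1}. ennreal (curve_speed A g \<gamma> t) \<partial>lborel)"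

definition open_nbhd ::
    "('m::topological_space, 'n::finite) chart set \<Rightarrow> (('m, 'n) chart \<Rightarrow> 'm \<Rightarrow> real ^ 'n ^ 'n) \<Rightarrow>
     'm set \<Rightarrow> real \<Rightarrow> 'm set" where
  "open_nbhd A g \<Omega> r = {p. \<exists>q\<in>\<Omega>. riemannian_dist A g p q < ennreal r}"

definition boundary_area ::
    "('m::topological_space, 'n::finite) chart set \<Rightarrow> (('m, 'n) chart \<Rightarrow> 'm \<Rightarrow> real ^ 'n ^ 'n) \<Rightarrow>
     'm set \<Rightarrow> ennreal" where
  "boundary_area A g \<Omega> =
     Liminf (at_right 0)
       (\<lambda>r::real. (emeasure (vol A g) (open_nbhd A g \<Omega> r) - emeasure (vol A g) \<Omega>) / ennreal r)"

section \<open>The magnetic Laplacian and its first eigenvalue\<close>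

text \<open>The components of the complex one-form \<open>(d + i \<alpha>) f\<close>.\<close>

definition magnetic_D ::
    "(('m, 'n::finite) chart \<Rightarrow> 'm \<Rightarrow> real ^ 'n) \<Rightarrow> ('m \<Rightarrow> complex) \<Rightarrow>
     ('m, 'n) chart \<Rightarrow> 'm \<Rightarrow> complex ^ 'n" where
  "magnetic_D \<alpha> f c p =
     (\<chi> i. frechet_derivative (f \<circ> chart_inv c) (at (snd c p)) (axis i 1)
          + \<i> * complex_of_real (\<alpha> c p $ i) * f p)"

definition form_inner ::
    "('m, 'n::finite) chart set \<Rightarrow> (('m, 'n) chart \<Rightarrow> 'm \<Rightarrow> real ^ 'n ^ 'n) \<Rightarrow>
     (('m, 'n) chart \<Rightarrow> 'm \<Rightarrow> complex ^ 'n) \<Rightarrow> (('m, 'n) chart \<Rightarrow> 'm \<Rightarrow> complex ^ 'n) \<Rightarrow>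
     'm \<Rightarrow> complex" where
  "form_inner A g w z p =
     (let c = chart_at A p
      in \<Sum>i\<in>UNIV. \<Sum>j\<in>UNIV.
           complex_of_real (matrix_inv (g c p) $ i $ j) * (w c p $ i) * cnj (z c p $ j))"

definition form_norm ::
    "('m, 'n::finite) chart set \<Rightarrow> (('m, 'n) chart \<Rightarrow> 'm \<Rightarrow> real ^ 'n ^ 'n) \<Rightarrow>
     (('m, 'n) chart \<Rightarrow> 'm \<Rightarrow> complex ^ 'n) \<Rightarrow> 'm \<Rightarrow> real" where
  "form_norm A g w p = sqrt (Re (form_inner A g w w p))"

text \<open>
  Unbounded operators are represented by their graphs.  The formal adjoint is single-valued,
  since a smooth function that is \<open>L\<^sup>2\<close>-orthogonal to all smooth functions vanishes.
\<close>

definition magnetic_D_adjoint ::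
    "('m::topological_space, 'n::finite) chart set \<Rightarrow> (('m, 'n) chart \<Rightarrow> 'm \<Rightarrow> real ^ 'n ^ 'n) \<Rightarrow>
     (('m, 'n) chart \<Rightarrow> 'm \<Rightarrow> real ^ 'n) \<Rightarrow>
     ((('m, 'n) chart \<Rightarrow> 'm \<Rightarrow> complex ^ 'n) \<times> ('m \<Rightarrow> complex)) set" where
  "magnetic_D_adjoint A g \<alpha> =
     {(w, h). smooth_one_form A w \<and> smooth_fun A h \<and>
        (\<forall>f. smooth_fun A f \<longrightarrow>
           (LINT p|vol A g. form_inner A g (magnetic_D \<alpha> f) w p)
             = (LINT p|vol A g. f p * cnj (h p)))}"

definition magnetic_laplacian ::
    "('m::topological_space, 'n::finite) chart set \<Rightarrow> (('m, 'n) chart \<Rightarrow> 'm \<Rightarrow> real ^ 'n ^ 'n) \<Rightarrow>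
     (('m, 'n) chart \<Rightarrow> 'm \<Rightarrow> real ^ 'n) \<Rightarrow> (('m \<Rightarrow> complex) \<times> ('m \<Rightarrow> complex)) set" where
  "magnetic_laplacian A g \<alpha> =
     {(f, h). smooth_fun A f \<and> (magnetic_D \<alpha> f, h) \<in> magnetic_D_adjoint A g \<alpha>}"

definition square_integrable :: "'m measure \<Rightarrow> ('m \<Rightarrow> complex) \<Rightarrow> bool" where
  "square_integrable M u \<longleftrightarrow> u \<in> borel_measurable M \<and> integrable M (\<lambda>p. (cmod (u p))\<^sup>2)"

definition L2_tendsto :: "'m measure \<Rightarrow> (nat \<Rightarrow> 'm \<Rightarrow> complex) \<Rightarrow> ('m \<Rightarrow> complex) \<Rightarrow> bool" where
  "L2_tendsto M f u \<longleftrightarrow> (\<lambda>k. LINT p|M. (cmod (f k p - u p))\<^sup>2) \<longlonglongrightarrow> 0"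

text \<open>
  The closure in \<open>L\<^sup>2 \<times> L\<^sup>2\<close> of the graph of the magnetic Laplacian on smooth functions.  As
  the latter is essentially self-adjoint, this is the graph of its self-adjoint extension.
\<close>

definition magnetic_laplacian_closure ::
    "('m::topological_space, 'n::finite) chart set \<Rightarrow> (('m, 'n) chart \<Rightarrow> 'm \<Rightarrow> real ^ 'n ^ 'n) \<Rightarrow>
     (('m, 'n) chart \<Rightarrow> 'm \<Rightarrow> real ^ 'n) \<Rightarrow> (('m \<Rightarrow> complex) \<times> ('m \<Rightarrow> complex)) set" where
  "magnetic_laplacian_closure A g \<alpha> =
     {(u, v). square_integrable (vol A g) u \<and> square_integrable (vol A g) v \<and>
        (\<exists>f h. (\<forall>k. (f k, h k) \<in> magnetic_laplacian A g \<alpha>) \<and>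
               L2_tendsto (vol A g) f u \<and> L2_tendsto (vol A g) h v)}"

definition magnetic_eigenvalue ::
    "('m::topological_space, 'n::finite) chart set \<Rightarrow> (('m, 'n) chart \<Rightarrow> 'm \<Rightarrow> real ^ 'n ^ 'n) \<Rightarrow>
     (('m, 'n) chart \<Rightarrow> 'm \<Rightarrow> real ^ 'n) \<Rightarrow> real \<Rightarrow> bool" where
  "magnetic_eigenvalue A g \<alpha> \<mu> \<longleftrightarrow>
     (\<exists>u. (u, \<lambda>p. complex_of_real \<mu> * u p) \<in> magnetic_laplacian_closure A g \<alpha> \<and>
          \<not> (AE p in vol A g. u p = 0))"

text \<open>The spectrum is discrete, so its bottom is the least eigenvalue.\<close>

definition is_first_eigenvalue ::
    "('m::topological_space, 'n::finite) chart set \<Rightarrow> (('m, 'n) chart \<Rightarrow> 'm \<Rightarrow> real ^ 'n ^ 'n) \<Rightarrow>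
     (('m, 'n) chart \<Rightarrow> 'm \<Rightarrow> real ^ 'n) \<Rightarrow> real \<Rightarrow> bool" where
  "is_first_eigenvalue A g \<alpha> \<mu> \<longleftrightarrow>
     magnetic_eigenvalue A g \<alpha> \<mu> \<and> (\<forall>\<mu>'. magnetic_eigenvalue A g \<alpha> \<mu>' \<longrightarrow> \<mu> \<le> \<mu>')"

section \<open>Frustration index and the first magnetic Cheeger constant\<close>

definition local_U1_extension ::
    "('m::topological_space, 'n::finite) chart set \<Rightarrow> 'm set \<Rightarrow> ('m \<Rightarrow> complex) \<Rightarrow> 'm \<Rightarrow>
     ('m \<Rightarrow> complex) \<Rightarrow> bool" where
  "local_U1_extension A \<Omega> \<tau> p \<sigma> \<longleftrightarrow>
     (\<exists>V. p \<in> V \<and> smooth_on_open A V \<sigma> \<and> (\<forall>q\<in>V. cmod (\<sigma> q) = 1) \<and> (\<forall>q\<in>V \<inter> \<Omega>. \<sigma> q = \<tau> q))"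

definition smooth_U1_maps ::
    "('m::topological_space, 'n::finite) chart set \<Rightarrow> 'm set \<Rightarrow> ('m \<Rightarrow> complex) set" where
  "smooth_U1_maps A \<Omega> = {\<tau>. \<forall>p\<in>\<Omega>. \<exists>\<sigma>. local_U1_extension A \<Omega> \<tau> p \<sigma>}"

text \<open>
  The derivative of \<open>\<tau>\<close> at \<open>p \<in> \<Omega>\<close> is that of a smooth local extension of \<open>\<tau>\<close>.  At Lebesgue
  density points of \<open>\<Omega>\<close>, hence at almost every point of \<open>\<Omega>\<close>, it does not depend on the
  extension.
\<close>

definition magnetic_D_norm_on ::
    "('m::topological_space, 'n::finite) chart set \<Rightarrow> (('m, 'n) chart \<Rightarrow> 'm \<Rightarrow> real ^ 'n ^ 'n) \<Rightarrow>
     (('m, 'n) chart \<Rightarrow> 'm \<Rightarrow> real ^ 'n) \<Rightarrow> 'm set \<Rightarrow> ('m \<Rightarrow> complex) \<Rightarrow> 'm \<Rightarrow> real" where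
  "magnetic_D_norm_on A g \<alpha> \<Omega> \<tau> p =
     form_norm A g (magnetic_D \<alpha> (SOME \<sigma>. local_U1_extension A \<Omega> \<tau> p \<sigma>)) p"

definition frustration_index ::
    "('m::topological_space, 'n::finite) chart set \<Rightarrow> (('m, 'n) chart \<Rightarrow> 'm \<Rightarrow> real ^ 'n ^ 'n) \<Rightarrow>
     (('m, 'n) chart \<Rightarrow> 'm \<Rightarrow> real ^ 'n) \<Rightarrow> 'm set \<Rightarrow> ennreal" where
  "frustration_index A g \<alpha> \<Omega> =
     (INF \<tau>\<in>smooth_U1_maps A \<Omega>.
        \<integral>\<^sup>+p\<in>\<Omega>. ennreal (magnetic_D_norm_on A g \<alpha> \<Omega> \<tau> p) \<partial>vol A g)"

definition cheeger_quotient ::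
    "('m::topological_space, 'n::finite) chart set \<Rightarrow> (('m, 'n) chart \<Rightarrow> 'm \<Rightarrow> real ^ 'n ^ 'n) \<Rightarrow>
     (('m, 'n) chart \<Rightarrow> 'm \<Rightarrow> real ^ 'n) \<Rightarrow> 'm set \<Rightarrow> ennreal" where
  "cheeger_quotient A g \<alpha> \<Omega> =
     (frustration_index A g \<alpha> \<Omega> + boundary_area A g \<Omega>) / emeasure (vol A g) \<Omega>"

definition cheeger_constant ::
    "('m::topological_space, 'n::finite) chart set \<Rightarrow> (('m, 'n) chart \<Rightarrow> 'm \<Rightarrow> real ^ 'n ^ 'n) \<Rightarrow>
     (('m, 'n) chart \<Rightarrow> 'm \<Rightarrow> real ^ 'n) \<Rightarrow> ennreal" where
  "cheeger_constant A g \<alpha> =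
     (INF \<Omega>\<in>{\<Omega> \<in> sets borel. emeasure (vol A g) \<Omega> > 0}. cheeger_quotient A g \<alpha> \<Omega>)"

end

theory Submission
  imports Defs
begin

text \<open>
  An eigenfunction of the closure of the magnetic Laplacian is an \<open>L\<^sup>2\<close>-limit of smooth functions whose
  Rayleigh quotients tend to the eigenvalue, so it suffices to bound the Cheeger constant by the Rayleigh
  quotient of a smooth \<open>f\<close>.  Write \<open>f = \<rho> \<tau>\<close> with \<open>\<rho> = \<bar>f\<bar>\<close> and use the open sets \<open>{\<rho>\<^sup>2 > t}\<close> with the
  phase \<open>\<tau>\<close> as test map for the frustration index.  Integrated over \<open>t \<ge> 0\<close>, volumes give \<open>\<integral> \<rho>\<^sup>2\<close>,
  frustration indices at most \<open>\<integral> \<rho>\<^sup>2 \<bar>(d + i \<alpha>) \<tau>\<bar>\<close>, and boundary areas at most \<open>\<integral> \<bar>d\<rho>\<^sup>2\<bar>\<close>: the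
  \<open>r\<close>-neighbourhood of \<open>{\<rho>\<^sup>2 > t}\<close> lies in \<open>{\<rho>\<^sup>2 + r (\<bar>d\<rho>\<^sup>2\<bar> + \<epsilon>) > t}\<close> for small \<open>r\<close>, and Fatou's lemma
  replaces the coarea formula.  As \<open>\<bar>d\<rho>\<bar>\<^sup>2 + \<rho>\<^sup>2 \<bar>(d + i \<alpha>) \<tau>\<bar>\<^sup>2 = \<bar>(d + i \<alpha>) f\<bar>\<^sup>2\<close>, the Cauchy-Schwarz inequality
  yields the bound with the constant \<open>\<surd>5 \<le> 2 \<surd>2\<close>.
\<close>

text \<open>Levels of \<open>\<rho>\<^sup>2\<close> are used rather than levels of \<rho> so that
  volumes integrate to the squared norm. The price is
  \<open>d\<rho>\<^sup>2 = 2 \<rho> d\<rho>\<close>, hence a factor 2 on the radial term; with a =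
  \<rho>|d\<rho>| and b = \<open>\<rho>\<^sup>2 |(d + i \<alpha>) \<tau>|\<close>, the inequality b
  + 2a \<le> \<open>\<surd>(1 + 4) \<surd>(a\<^sup>2 + b\<^sup>2)\<close> is where 5 comes from. The
  polar form breaks down at zeros of f. Therefore only the real and imaginary parts of
  \<open>cnj f * (d + i \<alpha>) f\<close> are integrated; these are continuous everywhere, and
  dividing by \<open>\<rho>\<^sup>2\<close> happens only on superlevel sets. Neither the frustration
  index nor the boundary area is shown to be measurable in t, so each is replaced by a measurable
  majorant before integrating. For the boundary area only an upper bound is required, which is why
  Fatou suffices. The eigenfunction is never shown to be smooth. The energies of the approximants
  are expressed by polarization through L2 norms, whose limits are known. Finally,
  \<open>vol\<close> is a definite description: until a measure with its property has been glued
  from charts and shown unique, nothing can be said about it. This is the purpose of the change of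
  variables.\<close>

section \<open>Change of variables in dimension indexed by a finite type\<close>

text \<open>The library proves the change of variables formula only for well-ordered index types; \<open>'n idx\<close> is a
  well-ordered copy of an arbitrary finite type.\<close>

typedef (overloaded) ('n::finite) idx = "{..<CARD('n)}"
  by (rule exI[of _ 0]) simp

instantiation idx :: (finite) linorder
begin
definition "i \<le> j \<longleftrightarrow> Rep_idx i \<le> Rep_idx j"
definition "i < j \<longleftrightarrow> Rep_idx i < Rep_idx j"
instance
  by intro_classes (auto simp: less_eq_idx_def less_idx_def Rep_idx_inject)
end

instance idx :: (finite) finite
proof
  show "finite (UNIV :: 'a idx set)"
    by (rule finite_imageD[of Rep_idx]) (auto intro!: finite_subset[of _ "{..<CARD('a)}"] injI
      simp: Rep_idx_inject Rep_idx[simplified])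
qed

instance idx :: (finite) wellorder
proof -
  have "wf {(x :: 'a idx, y). x < y}"
    by (auto simp add: trancl_def tranclp_less intro!: finite_acyclic_wf acyclicI)
  thus "OFCLASS('a idx, wellorder_class)"
    by (rule wf_wellorderI) intro_classes
qed

lemma card_idx: "CARD('n::finite idx) = CARD('n)"
proof -
  have "bij_betw (Rep_idx :: 'n idx \<Rightarrow> nat) UNIV {..<CARD('n)}"
    by (rule bij_betw_byWitness[where f'=Abs_idx])
      (auto simp: Rep_idx_inverse Abs_idx_inverse Rep_idx[simplified])
  from bij_betw_same_card[OF this] show ?thesis by simp
qed

definition idx_of :: "'n::finite \<Rightarrow> 'n idx" where
  "idx_of = (SOME b. bij b)"

lemma bij_idx_of: "bij (idx_of :: 'n::finite \<Rightarrow> 'n idx)"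
proof -
  have "\<exists>b :: 'n \<Rightarrow> 'n idx. bij b"
    by (metis finite_same_card_bij card_idx finite)
  thus ?thesis unfolding idx_of_def by (rule someI_ex)
qed

text \<open>Conjugation by a bijection turns a transposition into a transposition, so the sign is
  preserved by induction over products of transpositions.\<close>

lemma sign_conj_bij:
  fixes b :: "'a::finite \<Rightarrow> 'b::finite"
  assumes b: "bij b" and p: "p permutes UNIV"
  shows "sign (b \<circ> p \<circ> inv b) = sign p"
  using p finite
proof (induction rule: permutes_induct)
  case id
  have "b \<circ> id \<circ> inv b = id"
    using b by (auto simp: fun_eq_iff bij_is_surj surj_f_inv_f)
  thus ?case by (metis sign_id)
next
  case (swap x y p)
  have inj: "inj b" and surj: "surj b" using b by (auto simp: bij_def)
  have eq: "b \<circ> (Transposition.transpose x y \<circ> p) \<circ> inv b = Transposition.transpose (b x) (b y) \<circ> (b \<circ> p \<circ> inv b)"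
  proof
    fix z
    show "(b \<circ> (Transposition.transpose x y \<circ> p) \<circ> inv b) z
        = (Transposition.transpose (b x) (b y) \<circ> (b \<circ> p \<circ> inv b)) z"
      using inj by (cases "p (inv b z) = x"; cases "p (inv b z) = y")
        (simp_all add: inj_eq transpose_apply_other)
  qed
  have perm: "permutation p" using swap by (auto simp: permutation_permutes)
  have "bij (b \<circ> p \<circ> inv b)"
    using b swap permutes_bij bij_imp_bij_inv by (metis bij_comp)
  hence "(b \<circ> p \<circ> inv b) permutes UNIV"
    by (rule bij_imp_permutes) simp
  hence perm': "permutation (b \<circ> p \<circ> inv b)"
    unfolding permutation_permutes by (intro exI[of _ UNIV]) simp
  show ?case
    unfolding eq sign_compose[OF permutation_swap_id perm'] sign_compose[OF permutation_swap_id perm]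
    using swap inj by (simp add: sign_swap_id inj_eq o_def)
qed

text \<open>In the Leibniz formula, conjugation by \<open>b\<close> is a sign-preserving bijection
  between the two index sets of permutations.\<close>

lemma det_reindex:
  fixes b :: "'a::finite \<Rightarrow> 'b::finite" and M :: "real^'b^'b"
  assumes b: "bij b"
  shows "det (\<chi> i j. M $ b i $ b j) = det M"
proof -
  let ?c = "\<lambda>p. b \<circ> p \<circ> inv b"
  have inj: "inj b" and surj: "surj b" using b by (auto simp: bij_def)
  have bb: "bij_betw ?c {p. p permutes UNIV} {p. p permutes UNIV}"
  proof (rule bij_betw_byWitness[where f'="\<lambda>p. inv b \<circ> p \<circ> b"])
    show "?c ` {p. p permutes UNIV} \<subseteq> {p. p permutes UNIV}"
      using b permutes_bij bij_imp_bij_inv by (auto intro!: bij_imp_permutes bij_comp)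
    show "(\<lambda>p. inv b \<circ> p \<circ> b) ` {p. p permutes UNIV} \<subseteq> {p. p permutes UNIV}"
      using b permutes_bij bij_imp_bij_inv by (auto intro!: bij_imp_permutes bij_comp)
  qed (auto simp: fun_eq_iff surj_f_inv_f[OF surj] inv_f_f[OF inj])
  have "det M = (\<Sum>p\<in>{p. p permutes UNIV}. of_int (sign (?c p)) * (\<Prod>i\<in>UNIV. M $ i $ ?c p i))"
    unfolding det_def by (rule sum.reindex_bij_betw[OF bb, symmetric])
  also have "\<dots> = (\<Sum>p\<in>{p. p permutes UNIV}. of_int (sign p) * (\<Prod>i\<in>UNIV. M $ b i $ b (p i)))"
  proof (intro sum.cong refl)
    fix p :: "'a \<Rightarrow> 'a" assume p: "p \<in> {p. p permutes UNIV}"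
    have "(\<Prod>i\<in>UNIV. M $ i $ ?c p i) = (\<Prod>i\<in>UNIV. M $ b i $ ?c p (b i))"
      by (rule prod.reindex_bij_betw[OF b, symmetric])
    thus "of_int (sign (?c p)) * (\<Prod>i\<in>UNIV. M $ i $ ?c p i)
        = of_int (sign p) * (\<Prod>i\<in>UNIV. M $ b i $ b (p i))"
      using sign_conj_bij[OF b] p by (simp add: inv_f_f[OF inj])
  qed
  also have "\<dots> = det (\<chi> i j. M $ b i $ b j)"
    unfolding det_def by simp
  finally show ?thesis by simp
qed

section \<open>Relabelling of coordinates\<close>

definition reindex :: "('a::finite \<Rightarrow> 'b::finite) \<Rightarrow> real^'b \<Rightarrow> real^'a" where
  "reindex b x = (\<chi> i. x $ b i)"

lemma linear_reindex: "linear (reindex b)"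
  by (rule linearI) (auto simp: reindex_def vec_eq_iff)

lemma bounded_linear_reindex: "bounded_linear (reindex b)"
  using linear_reindex linear_linear by blast

lemma continuous_on_reindex: "continuous_on S (reindex b)"
  using bounded_linear_reindex linear_continuous_on by blast

lemma measurable_reindex [measurable]: "reindex b \<in> borel_measurable borel"
  by (intro borel_measurable_continuous_onI continuous_on_reindex)

lemma reindex_inv:
  assumes "bij b" shows "reindex b (reindex (inv b) x) = x" "reindex (inv b) (reindex b y) = y"
  using assms by (auto simp: reindex_def vec_eq_iff bij_def surj_f_inv_f)

text \<open>Lebesgue measure is determined by boxes, and relabelling coordinates maps a box to a box
  with the same side lengths in another order.\<close>

lemma distr_reindex:
  fixes b :: "'a::finite \<Rightarrow> 'b::finite"
  assumes b: "bij b"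
  shows "distr lborel borel (reindex b) = lborel"
proof (rule lborel_eqI[symmetric])
  fix l u :: "real^'a"
  assume le: "\<And>k. k \<in> Basis \<Longrightarrow> l \<bullet> k \<le> u \<bullet> k"
  have le': "l $ i \<le> u $ i" for i using le[of "axis i 1"] by (auto simp: inner_axis)
  let ?r = "reindex (inv b)"
  have pre: "reindex b -` box l u = box (?r l) (?r u)"
    using b by (auto simp: mem_box_cart reindex_def bij_def)
      (metis surj_f_inv_f, metis surj_f_inv_f, metis inv_f_f, metis inv_f_f)
  have "emeasure (distr lborel borel (reindex b)) (box l u) = emeasure lborel (reindex b -` box l u)"
    by (subst emeasure_distr) auto
  also have "\<dots> = emeasure lborel (box (?r l) (?r u))" by (simp add: pre)
  also have "\<dots> = (\<Prod>k\<in>Basis. (?r u - ?r l) \<bullet> k)"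
    using le' by (intro emeasure_lborel_box) (auto simp: Basis_vec_def inner_axis reindex_def)
  also have "(\<Prod>k\<in>Basis. (?r u - ?r l) \<bullet> k) = (\<Prod>i\<in>UNIV. (?r u - ?r l) $ i)"
    unfolding Basis_vec_def
    by (subst prod.UNION_disjoint) (auto simp: axis_eq_axis inner_axis)
  also have "\<dots> = (\<Prod>i\<in>UNIV. (u - l) $ i)"
    using prod.reindex_bij_betw[OF b, of "\<lambda>i. (?r u - ?r l) $ i"] b
    by (simp add: reindex_def bij_def inv_f_f)
  also have "\<dots> = (\<Prod>k\<in>Basis. (u - l) \<bullet> k)"
    unfolding Basis_vec_def
    by (subst prod.UNION_disjoint) (auto simp: axis_eq_axis inner_axis)
  finally show "emeasure (distr lborel borel (reindex b)) (box l u) = (\<Prod>k\<in>Basis. (u - l) \<bullet> k)" .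
qed simp

text \<open>If the Jacobian factor is integrable, this is the formula for finite Lebesgue measure;
  otherwise the image cannot have finite measure and both sides are infinite.\<close>

lemma emeasure_differentiable_image_wellorder:
  fixes h :: "real^'n::{finite,wellorder} \<Rightarrow> real^'n::_"
  assumes S: "S \<in> sets borel" and hS: "h ` S \<in> sets borel"
    and der: "\<And>x. x \<in> S \<Longrightarrow> (h has_derivative h' x) (at x within S)" and inj: "inj_on h S"
    and meas: "(\<lambda>x. indicator S x * \<bar>det (matrix (h' x))\<bar>) \<in> borel_measurable borel"
  shows "emeasure lborel (h ` S) = (\<integral>\<^sup>+x. ennreal (indicator S x * \<bar>det (matrix (h' x))\<bar>) \<partial>lborel)"
proof -
  let ?D = "\<lambda>x. \<bar>det (matrix (h' x))\<bar>"
  have SL: "S \<in> sets lebesgue" and hSL: "h ` S \<in> sets lebesgue" using S hS by auto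
  have ind: "indicator S x * ?D x = (if x \<in> S then ?D x else 0)" for x by auto
  have nn: "0 \<le> indicator S x * ?D x" for x by (auto simp: indicator_def)
  \<comment> \<open>For a nonnegative function gauge integrability is absolute integrability, which
    for a Borel function is integrability over \<open>lborel\<close>.\<close>
  have to_lborel: "(?D integrable_on S) \<longleftrightarrow> integrable lborel (\<lambda>x. indicator S x * ?D x)"
  proof -
    have "?D integrable_on S \<longleftrightarrow> ?D absolutely_integrable_on S"
      by (simp add: absolutely_integrable_on_iff_nonneg)
    also have "\<dots> \<longleftrightarrow> integrable lebesgue (\<lambda>x. indicator S x * ?D x)"
      by (simp add: set_integrable_def)
    also have "\<dots> \<longleftrightarrow> integrable lborel (\<lambda>x. indicator S x * ?D x)"
      using meas by (intro integrable_completion) auto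
    finally show ?thesis .
  qed
  show ?thesis
  proof (cases "?D integrable_on S")
    case True
    have "measure lebesgue (h ` S) = integral S ?D"
      by (rule measure_differentiable_image_eq[OF SL der inj True])
    moreover have "h ` S \<in> lmeasurable"
      using measurable_differentiable_image_eq[OF SL der inj] True by simp
    ultimately have "emeasure lborel (h ` S) = ennreal (integral S ?D)"
      using hS emeasure_eq_measure2[of "h ` S" lebesgue] by (simp add: emeasure_completion)
    also have "integral S ?D = integral UNIV (\<lambda>x. indicator S x * ?D x)"
      unfolding ind integral_restrict_UNIV ..
    also have "\<dots> = (LINT x|lborel. indicator S x * ?D x)"
      using True to_lborel integral_lborel by blast
    also have "ennreal \<dots> = (\<integral>\<^sup>+x. ennreal (indicator S x * ?D x) \<partial>lborel)"
      using True to_lborel nn by (intro nn_integral_eq_integral[symmetric]) auto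
    finally show ?thesis .
  next
    case False
    hence "h ` S \<notin> lmeasurable"
      using measurable_differentiable_image_eq[OF SL der inj] by simp
    hence "emeasure lborel (h ` S) = \<infinity>"
      using hSL hS by (auto simp: fmeasurable_def less_top[symmetric])
    moreover have "(\<integral>\<^sup>+x. ennreal (indicator S x * ?D x) \<partial>lborel) = \<infinity>"
    proof (rule ccontr)
      assume "\<not> ?thesis"
      hence "integrable lborel (\<lambda>x. indicator S x * ?D x)"
        using meas nn by (intro integrableI_nonneg) (auto simp: less_top)
      thus False using False to_lborel by simp
    qed
    ultimately show ?thesis by simp
  qed
qed

text \<open>Conjugating \<open>h\<close> by a relabelling of coordinates changes neither volumes nor
  Jacobian determinants, so the well-ordered case carries over.\<close>

lemma emeasure_differentiable_image:
  fixes h :: "real^'n::finite \<Rightarrow> real^'n"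
  assumes S: "S \<in> sets borel" and hS: "h ` S \<in> sets borel"
    and der: "\<And>x. x \<in> S \<Longrightarrow> (h has_derivative h' x) (at x within S)" and inj: "inj_on h S"
    and meas: "(\<lambda>x. indicator S x * \<bar>det (matrix (h' x))\<bar>) \<in> borel_measurable borel"
  shows "emeasure lborel (h ` S) = (\<integral>\<^sup>+x. ennreal (indicator S x * \<bar>det (matrix (h' x))\<bar>) \<partial>lborel)"
proof -
  define b where "b = inv (idx_of :: 'n \<Rightarrow> 'n idx)"
  have b: "bij b" unfolding b_def by (rule bij_imp_bij_inv[OF bij_idx_of])
  have ib: "bij (inv b)" using b by (rule bij_imp_bij_inv)
  let ?P = "reindex b" and ?Q = "reindex (inv b)"
  have PQ: "?P (?Q x) = x" "?Q (?P y) = y" for x y using reindex_inv[OF b] by auto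
  let ?S = "?P ` S" and ?h = "?P \<circ> h \<circ> ?Q"
  let ?h' = "\<lambda>y. ?P \<circ> h' (?Q y) \<circ> ?Q"
  \<comment> \<open>Images under \<open>?P\<close> are preimages under the continuous
    \<open>?Q\<close>, which gives both their measurability and their measure.\<close>
  have img: "?P ` T = ?Q -` T" for T
    using PQ by (auto simp: image_iff) metis
  have img_borel: "?P ` T \<in> sets borel" if "T \<in> sets borel" for T
    unfolding img using measurable_sets[OF measurable_reindex that, of "inv b"] by simp
  have em_img: "emeasure lborel (?P ` T) = emeasure lborel T" if "T \<in> sets borel" for T
  proof -
    have "emeasure lborel T = emeasure (distr lborel borel ?Q) T"
      by (simp add: distr_reindex[OF ib])
    also have "\<dots> = emeasure lborel (?P ` T)"
      unfolding img using that by (subst emeasure_distr) auto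
    finally show ?thesis ..
  qed
  have himg: "?h ` ?S = ?P ` (h ` S)"
    by (auto simp: PQ image_iff)
  have det_eq: "det (matrix (?h' (?P x))) = det (matrix (h' x))" if "x \<in> S" for x
  proof -
    have "matrix (?h' (?P x)) = (\<chi> i j. matrix (h' x) $ b i $ b j)"
    proof -
      have "?Q (axis j 1) = axis (b j) 1" for j
        using b by (auto simp: reindex_def axis_def vec_eq_iff bij_def inv_f_f surj_f_inv_f)
      thus ?thesis by (simp add: matrix_def PQ vec_eq_iff) (simp add: reindex_def)
    qed
    thus ?thesis by (simp add: det_reindex[OF b])
  qed
  have ind: "indicator ?S y * \<bar>det (matrix (?h' y))\<bar> = indicator S (?Q y) * \<bar>det (matrix (h' (?Q y)))\<bar>" for y
    using det_eq[of "?Q y"] by (auto simp: indicator_def PQ img)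
  have "emeasure lborel (h ` S) = emeasure lborel (?h ` ?S)"
    unfolding himg using em_img[OF hS] by simp
  also have "\<dots> = (\<integral>\<^sup>+y. ennreal (indicator ?S y * \<bar>det (matrix (?h' y))\<bar>) \<partial>lborel)"
  proof (rule emeasure_differentiable_image_wellorder)
    show "?S \<in> sets borel" "?h ` ?S \<in> sets borel"
      unfolding himg using img_borel S hS by auto
    show "inj_on ?h ?S"
      using inj by (auto simp: inj_on_def PQ) (metis PQ(2))
    fix y assume "y \<in> ?S"
    then obtain x where x: "x \<in> S" "y = ?P x" by auto
    have Q: "(?Q has_derivative ?Q) (at y within ?S)" for y
      by (intro bounded_linear_imp_has_derivative bounded_linear_reindex)
    have QS: "?Q ` ?S = S" by (auto simp: PQ image_iff)
    have "(h has_derivative h' x) (at (?Q y) within ?Q ` ?S)"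
      using der[OF x(1)] x(2) QS PQ by simp
    hence 1: "(h \<circ> ?Q has_derivative h' x \<circ> ?Q) (at y within ?S)"
      using Q by (intro diff_chain_within)
    have "(?P has_derivative ?P) (at ((h \<circ> ?Q) y) within (h \<circ> ?Q) ` ?S)"
      by (intro bounded_linear_imp_has_derivative bounded_linear_reindex)
    from diff_chain_within[OF 1 this]
    show "(?h has_derivative ?h' y) (at y within ?S)"
      using x PQ by (simp add: comp_assoc[symmetric] o_assoc del: o_apply)
  next
    show "(\<lambda>y. indicator ?S y * \<bar>det (matrix (?h' y))\<bar>) \<in> borel_measurable borel"
      unfolding ind using measurable_compose[OF measurable_reindex meas, of "inv b"] by simp
  qed
  also have "\<dots> = (\<integral>\<^sup>+y. ennreal (indicator S (?Q y) * \<bar>det (matrix (h' (?Q y)))\<bar>) \<partial>lborel)"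
    unfolding ind ..
  also have "\<dots> = (\<integral>\<^sup>+x. ennreal (indicator S x * \<bar>det (matrix (h' x))\<bar>) \<partial>distr lborel borel ?Q)"
    using meas by (subst nn_integral_distr) auto
  also have "\<dots> = (\<integral>\<^sup>+x. ennreal (indicator S x * \<bar>det (matrix (h' x))\<bar>) \<partial>lborel)"
    unfolding distr_reindex[OF ib] ..
  finally show ?thesis .
qed

text \<open>It suffices that \<open>h\<close> pushes Lebesgue measure on \<open>S\<close>, weighted
  by the Jacobian, forward to Lebesgue measure on \<open>T\<close>. This is a statement about sets;
  integrands then follow from the integral over an image measure.\<close>

lemma nn_integral_change_of_variables:
  fixes h k :: "real^'n::finite \<Rightarrow> real^'n" and f :: "real^'n \<Rightarrow> ennreal"
  assumes S: "open S" and T: "open T" and hom: "homeomorphism S T h k"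
    and der: "\<And>x. x \<in> S \<Longrightarrow> (h has_derivative h' x) (at x)"
    and cont: "continuous_on S (\<lambda>x. det (matrix (h' x)))"
    and f: "f \<in> borel_measurable borel"
  shows "(\<integral>\<^sup>+y. f y * indicator T y \<partial>lborel)
       = (\<integral>\<^sup>+x. f (h x) * ennreal \<bar>det (matrix (h' x))\<bar> * indicator S x \<partial>lborel)"
proof -
  let ?D = "\<lambda>x. \<bar>det (matrix (h' x))\<bar>"
  have hk: "h ` S = T" "k ` T = S" "continuous_on S h" "continuous_on T k"
    "\<And>x. x \<in> S \<Longrightarrow> k (h x) = x" "\<And>y. y \<in> T \<Longrightarrow> h (k y) = y"
    using hom by (auto simp: homeomorphism_def)
  have SB: "S \<in> sets borel" "T \<in> sets borel" using S T by auto
  have mD: "(\<lambda>x. indicator S x * ?D x) \<in> borel_measurable borel"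
    using borel_measurable_continuous_on_indicator[OF SB(1) continuous_on_rabs[OF cont]] by simp
  have mh: "h \<in> borel_measurable (restrict_space borel S)"
    using hk(3) by (rule borel_measurable_continuous_on_restrict)
  have mk: "k \<in> borel_measurable (restrict_space borel T)"
    using hk(4) by (rule borel_measurable_continuous_on_restrict)
  have sets_eq: "sets (restrict_space lborel S) = sets (restrict_space borel S)"
    by (simp add: sets_restrict_space)
  define M where "M = density (restrict_space lborel S) (\<lambda>x. ennreal (?D x))"
  have mD': "(\<lambda>x. ennreal (?D x)) \<in> borel_measurable (restrict_space lborel S)"
    using measurable_compose[OF borel_measurable_continuous_on_restrict[OF continuous_on_rabs[OF cont]] measurable_ennreal]
      sets_eq measurable_cong_sets by blast
  have mh': "h \<in> measurable M borel"
    using mh unfolding M_def using measurable_cong_sets[of "density (restrict_space lborel S) (\<lambda>x. ennreal (?D x))" "restrict_space borel S"]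
      sets_eq by simp
  have eq: "distr M (restrict_space lborel T) h = restrict_space lborel T"
  proof (rule measure_eqI)
    show "sets (distr M (restrict_space lborel T) h) = sets (restrict_space lborel T)" by simp
    fix B assume "B \<in> sets (distr M (restrict_space lborel T) h)"
    hence B: "B \<in> sets borel" "B \<subseteq> T"
      using SB by (auto simp: sets_restrict_space_iff)
    have kB: "h -` B \<inter> S \<in> sets borel"
      using measurable_sets[OF mh B(1)] SB by (auto simp: space_restrict_space sets_restrict_space_iff)
    have hkB: "h ` (h -` B \<inter> S) = B" using B hk by auto
    have mh2: "h \<in> measurable M (restrict_space lborel T)"
      using mh' hk(1) unfolding M_def
      by (intro measurable_restrict_space2) (auto simp: space_restrict_space)
    have "emeasure (distr M (restrict_space lborel T) h) B = emeasure M (h -` B \<inter> S)"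
      using B SB by (subst emeasure_distr[OF mh2]) (auto simp: sets_restrict_space_iff M_def space_restrict_space)
    also have "\<dots> = (\<integral>\<^sup>+x. ennreal (?D x) * indicator (h -` B \<inter> S) x \<partial>restrict_space lborel S)"
      unfolding M_def using mD' kB SB by (subst emeasure_density) (auto simp: sets_restrict_space_iff)
    also have "\<dots> = (\<integral>\<^sup>+x. ennreal (indicator (h -` B \<inter> S) x * ?D x) \<partial>lborel)"
      using SB by (subst nn_integral_restrict_space) (auto intro!: nn_integral_cong simp: indicator_def)
    also have "\<dots> = emeasure lborel (h ` (h -` B \<inter> S))"
    proof (rule emeasure_differentiable_image[symmetric])
      show "h -` B \<inter> S \<in> sets borel" "h ` (h -` B \<inter> S) \<in> sets borel"
        using kB hkB B by auto
      show "inj_on h (h -` B \<inter> S)" using hk(5) by (metis Int_iff inj_onI)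
      show "(h has_derivative h' x) (at x within h -` B \<inter> S)" if "x \<in> h -` B \<inter> S" for x
        using der that has_derivative_at_withinI by blast
      have "(\<lambda>x. indicator (h -` B \<inter> S) x * (indicator S x * ?D x)) \<in> borel_measurable borel"
        using kB by (intro borel_measurable_times[OF _ mD] borel_measurable_indicator) auto
      moreover have "(\<lambda>x. indicator (h -` B \<inter> S) x * (indicator S x * ?D x))
         = (\<lambda>x. indicator (h -` B \<inter> S) x * ?D x)" by (auto simp: indicator_def)
      ultimately show "(\<lambda>x. indicator (h -` B \<inter> S) x * ?D x) \<in> borel_measurable borel" by simp
    qed
    also have "\<dots> = emeasure (restrict_space lborel T) B"
      using hkB B SB by (simp add: emeasure_restrict_space)
    finally show "emeasure (distr M (restrict_space lborel T) h) B = emeasure (restrict_space lborel T) B" .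
  qed
  have mh2: "h \<in> measurable M (restrict_space lborel T)"
    using mh' hk(1) unfolding M_def
    by (intro measurable_restrict_space2) (auto simp: space_restrict_space)
  have fT: "f \<in> borel_measurable (restrict_space lborel T)"
    using f by (simp add: measurable_restrict_space1)
  have "(\<integral>\<^sup>+y. f y * indicator T y \<partial>lborel) = (\<integral>\<^sup>+y. f y \<partial>restrict_space lborel T)"
    using SB by (subst nn_integral_restrict_space) auto
  also have "\<dots> = (\<integral>\<^sup>+y. f y \<partial>distr M (restrict_space lborel T) h)" by (simp only: eq)
  also have "\<dots> = (\<integral>\<^sup>+x. f (h x) \<partial>M)"
    using fT mh2 by (intro nn_integral_distr) auto
  also have "\<dots> = (\<integral>\<^sup>+x. ennreal (?D x) * f (h x) \<partial>restrict_space lborel S)"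
    unfolding M_def using mD' measurable_compose[OF mh2 fT] 
    by (intro nn_integral_density) (auto simp: M_def)
  also have "\<dots> = (\<integral>\<^sup>+x. f (h x) * ennreal (?D x) * indicator S x \<partial>lborel)"
    using SB by (subst nn_integral_restrict_space) (auto intro!: nn_integral_cong simp: indicator_def mult_ac)
  finally show ?thesis .
qed

section \<open>Calculus of smooth maps\<close>

lemma has_derivative_cong_open:
  assumes "open S" "x \<in> S" "\<And>y. y \<in> S \<Longrightarrow> f y = h y"
  shows "(f has_derivative D) (at x) \<longleftrightarrow> (h has_derivative D) (at x)"
  using assms has_derivative_transform_within_open[of f D x UNIV S h]
    has_derivative_transform_within_open[of h D x UNIV S f] by auto

lemma frechet_derivative_cong_open:
  assumes "open S" "x \<in> S" "\<And>y. y \<in> S \<Longrightarrow> f y = h y"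
  shows "frechet_derivative f (at x) = frechet_derivative h (at x)"
  unfolding frechet_derivative_def using has_derivative_cong_open[OF assms] by auto

lemma C_on_cong:
  assumes "open S" "\<And>y. y \<in> S \<Longrightarrow> f y = h y"
  shows "C_on k f S \<longleftrightarrow> C_on k h S"
  using assms(2)
proof (induction k arbitrary: f h)
  case 0 thus ?case by (simp cong: continuous_on_cong)
next
  case (Suc k)
  have "f differentiable_on S \<longleftrightarrow> h differentiable_on S"
    unfolding differentiable_on_eq_differentiable_at[OF assms(1)] differentiable_def
    using has_derivative_cong_open[OF assms(1) _ Suc.prems] by auto
  moreover have "C_on k (\<lambda>x. frechet_derivative f (at x) v) S \<longleftrightarrow> C_on k (\<lambda>x. frechet_derivative h (at x) v) S" for v
    by (rule Suc.IH) (simp add: frechet_derivative_cong_open[OF assms(1) _ Suc.prems])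
  ultimately show ?case by simp
qed

lemma C_on_subset: "C_on k f S \<Longrightarrow> T \<subseteq> S \<Longrightarrow> C_on k f T"
  by (induction k arbitrary: f) (auto intro: continuous_on_subset differentiable_on_subset)

lemma C_on_SucD: "C_on (Suc k) f S \<Longrightarrow> C_on k f S"
  by (induction k arbitrary: f) (auto intro: differentiable_imp_continuous_on)

lemma C_on_has_derivative:
  assumes "C_on (Suc k) f S" "open S" "x \<in> S"
  shows "(f has_derivative frechet_derivative f (at x)) (at x)"
  using assms by (simp add: differentiable_on_eq_differentiable_at frechet_derivative_works)

text \<open>\<open>C_on\<close> speaks of the derivative selected by
  \<open>frechet_derivative\<close>; this rule admits any explicit formula for it.\<close>

lemma C_on_SucI:
  assumes "open S" "\<And>x. x \<in> S \<Longrightarrow> (f has_derivative D x) (at x)"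
    and "\<And>v. C_on k (\<lambda>x. D x v) S"
  shows "C_on (Suc k) f S"
proof -
  have "C_on k (\<lambda>x. frechet_derivative f (at x) v) S" for v
    using C_on_cong[OF assms(1), of "\<lambda>x. frechet_derivative f (at x) v" "\<lambda>x. D x v" k] assms(3)
      frechet_derivative_at[OF assms(2)] by fastforce
  moreover have "f differentiable_on S"
    using assms(1,2) by (auto simp: differentiable_on_eq_differentiable_at differentiable_def)
  ultimately show ?thesis by simp
qed

lemma C_on_const: "open S \<Longrightarrow> C_on k (\<lambda>x. c) S"
proof (induction k arbitrary: c)
  case (Suc k)
  show ?case
    by (rule C_on_SucI[OF Suc.prems has_derivative_const]) (rule Suc.IH[OF Suc.prems])
qed simp

lemma C_on_add:
  assumes "open S" "C_on k f S" "C_on k h S"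
  shows "C_on k (\<lambda>x. f x + h x) S"
  using assms(2,3)
proof (induction k arbitrary: f h)
  case (Suc k)
  show ?case
  proof (rule C_on_SucI[OF assms(1)])
    show "((\<lambda>x. f x + h x) has_derivative (\<lambda>v. frechet_derivative f (at x) v + frechet_derivative h (at x) v)) (at x)"
      if "x \<in> S" for x
      using Suc.prems assms(1) that by (intro has_derivative_add) (auto intro: C_on_has_derivative)
    show "C_on k (\<lambda>x. frechet_derivative f (at x) v + frechet_derivative h (at x) v) S" for v
      using Suc.prems by (intro Suc.IH) auto
  qed
qed (auto intro: continuous_on_add)

text \<open>One product rule serves multiplication, scaling and the inner product. The derivative
  again consists of terms \<open>B\<close> applied to maps of order \<open>k\<close>, which is what
  the induction needs.\<close>

lemma C_on_bilinear:
  assumes "bounded_bilinear B" "open S" "C_on k f S" "C_on k h S"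
  shows "C_on k (\<lambda>x. B (f x) (h x)) S"
  using assms(3,4)
proof (induction k arbitrary: f h)
  case (Suc k)
  show ?case
  proof (rule C_on_SucI[OF assms(2)])
    show "((\<lambda>x. B (f x) (h x)) has_derivative (\<lambda>v. B (f x) (frechet_derivative h (at x) v) + B (frechet_derivative f (at x) v) (h x))) (at x)"
      if "x \<in> S" for x
      using Suc.prems assms(2) that
      by (intro bounded_bilinear.FDERIV[OF assms(1)]) (auto intro: C_on_has_derivative)
    show "C_on k (\<lambda>x. B (f x) (frechet_derivative h (at x) v) + B (frechet_derivative f (at x) v) (h x)) S" for v
      using Suc.prems C_on_SucD[OF Suc.prems(1)] C_on_SucD[OF Suc.prems(2)]
      by (intro C_on_add assms(2) Suc.IH) auto
  qed
qed (use assms bounded_bilinear.continuous_on in auto)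

lemma C_on_powr:
  fixes f :: "'a::euclidean_space \<Rightarrow> real"
  assumes "open S" "C_on k f S" "\<And>x. x \<in> S \<Longrightarrow> f x > 0"
  shows "C_on k (\<lambda>x. f x powr s) S"
  using assms(2)
\<comment> \<open>The exponent must vary, because differentiating lowers it by one.\<close>
proof (induction k arbitrary: s)
  case 0
  thus ?case using assms(3) by (auto intro!: continuous_intros dest: order_less_imp_not_eq2)
next
  case (Suc k)
  note bm = bounded_bilinear_mult
  show ?case
  proof (rule C_on_SucI[OF assms(1)])
    show "((\<lambda>x. f x powr s) has_derivative (\<lambda>v. s * f x powr (s - 1) * frechet_derivative f (at x) v)) (at x)"
      if "x \<in> S" for x
    proof -
      have "((\<lambda>y. y powr s) has_derivative (\<lambda>v. s * f x powr (s - 1) * v)) (at (f x))"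
        using has_real_derivative_powr[OF assms(3)[OF that], of s]
        by (simp add: has_field_derivative_def)
      from has_derivative_compose[OF C_on_has_derivative[OF Suc.prems assms(1) that] this]
      show ?thesis .
    qed
    show "C_on k (\<lambda>x. s * f x powr (s - 1) * frechet_derivative f (at x) v) S" for v
      using Suc.prems C_on_SucD[OF Suc.prems] assms(1)
      by (intro C_on_bilinear[OF bm] C_on_const Suc.IH) auto
  qed
qed

lemma smooth_map_on_imp:
  assumes "smooth_map_on S f" "open S"
  shows "continuous_on S f"
    and "x \<in> S \<Longrightarrow> (f has_derivative frechet_derivative f (at x)) (at x)"
    and "continuous_on S (\<lambda>x. frechet_derivative f (at x) v)"
proof -
  have "C_on 0 f S" "C_on 1 f S" using assms unfolding smooth_map_on_def by blast+
  thus "continuous_on S f" "x \<in> S \<Longrightarrow> (f has_derivative frechet_derivative f (at x)) (at x)"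
    "continuous_on S (\<lambda>x. frechet_derivative f (at x) v)"
    using C_on_has_derivative[of 0 f S x] assms(2) by auto
qed

text \<open>The factor 1 / |f| is the power -1/2 of the inner product of \<open>f\<close> with
  itself, a smooth positive function where \<open>f\<close> has no zero.\<close>

lemma smooth_map_on_normalize:
  fixes f :: "'a::euclidean_space \<Rightarrow> complex"
  assumes "open S" "smooth_map_on S f" "\<And>x. x \<in> S \<Longrightarrow> f x \<noteq> 0"
  shows "smooth_map_on S (\<lambda>x. f x /\<^sub>R cmod (f x))"
  unfolding smooth_map_on_def
proof
  fix k
  have f: "C_on k f S" using assms(2) by (simp add: smooth_map_on_def)
  have "C_on k (\<lambda>x. ((f x \<bullet> f x) powr (- (1/2))) *\<^sub>R f x) S"
    using assms(1,3) f
    by (intro C_on_bilinear[OF bounded_bilinear_scaleR] C_on_powr C_on_bilinear[OF bounded_bilinear_inner]) auto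
  moreover have "((f x \<bullet> f x) powr (- (1/2))) *\<^sub>R f x = f x /\<^sub>R cmod (f x)" if "x \<in> S" for x
    using assms(3)[OF that] by (simp add: dot_square_norm powr_minus powr_half_sqrt)
  ultimately show "C_on k (\<lambda>x. f x /\<^sub>R cmod (f x)) S"
    using C_on_cong[OF assms(1), of "\<lambda>x. ((f x \<bullet> f x) powr (- (1/2))) *\<^sub>R f x" "\<lambda>x. f x /\<^sub>R cmod (f x)"]
    by fast
qed

section \<open>Charts and the metric\<close>

lemma continuous_on_det [continuous_intros]:
  fixes M :: "'a::topological_space \<Rightarrow> real^'n^'n"
  assumes "continuous_on S M"
  shows "continuous_on S (\<lambda>x. det (M x))"
  unfolding det_def using assms by (intro continuous_intros) 

lemma linear_vec_expand:
  fixes L :: "real^'n \<Rightarrow> 'b::real_vector"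
  assumes "linear L"
  shows "L x = (\<Sum>j\<in>UNIV. (x $ j) *\<^sub>R L (axis j 1))"
proof -
  have "L x = L (\<Sum>j\<in>UNIV. (x $ j) *\<^sub>R axis j 1)"
    using basis_expansion[of x] by (simp add: scalar_mult_eq_scaleR)
  thus ?thesis using assms by (simp add: linear_sum linear_scale)
qed

definition Re_vec :: "complex^'n \<Rightarrow> real^'n" where "Re_vec w = (\<chi> i. Re (w $ i))"
definition Im_vec :: "complex^'n \<Rightarrow> real^'n" where "Im_vec w = (\<chi> i. Im (w $ i))"

text \<open>The transformation law of \<open>smooth_one_form\<close> without the smoothness clause.
  The forms derived from \<open>f\<close> below are shown to be continuous only.\<close>

definition covariant ::
    "('m::topological_space, 'n::finite) chart set \<Rightarrow> (('m, 'n) chart \<Rightarrow> 'm \<Rightarrow> 'b::real_normed_vector ^ 'n) \<Rightarrow> bool" where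
  "covariant A w \<longleftrightarrow> (\<forall>c\<in>A. \<forall>d\<in>A. \<forall>p\<in>fst c \<inter> fst d.
        w c p = (\<chi> i. \<Sum>j\<in>UNIV. (jacobian c d p $ j $ i) *\<^sub>R (w d p $ j)))"

locale riemannian_manifold =
  fixes A :: "('m::{t2_space, second_countable_topology}, 'n::finite) chart set"
    and g :: "('m, 'n) chart \<Rightarrow> 'm \<Rightarrow> real ^ 'n ^ 'n"
  assumes closed_manifold: "closed_connected_riemannian_manifold A g"
begin

lemma compact_UNIV: "compact (UNIV :: 'm set)"
  using closed_manifold by (simp add: closed_connected_riemannian_manifold_def)

lemma atlas: "smooth_atlas A" and metric: "riemannian_metric A g"
  using closed_manifold by (auto simp: closed_connected_riemannian_manifold_def)

lemma chart_open:
  assumes "c \<in> A"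
  shows "open (fst c)" "open (snd c ` fst c)"
    "homeomorphism (fst c) (snd c ` fst c) (snd c) (chart_inv c)"
  using atlas assms unfolding smooth_atlas_def by blast+

lemma chart_cover: "\<exists>c\<in>A. p \<in> fst c"
  using atlas unfolding smooth_atlas_def by (metis UNIV_I UN_E)

lemma chart_at_in: "chart_at A p \<in> A" "p \<in> fst (chart_at A p)"
  using someI_ex[of "\<lambda>c. c \<in> A \<and> p \<in> fst c"] chart_cover[of p] unfolding chart_at_def by blast+

lemma chart_inv_snd [simp]: "c \<in> A \<Longrightarrow> p \<in> fst c \<Longrightarrow> chart_inv c (snd c p) = p"
  using chart_open(3) by (auto simp: homeomorphism_def)

lemma chart_inv_in: "c \<in> A \<Longrightarrow> x \<in> snd c ` fst c \<Longrightarrow> chart_inv c x \<in> fst c"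
  using chart_open(3)[of c] by (auto simp: homeomorphism_def)

lemma snd_chart_inv: "c \<in> A \<Longrightarrow> x \<in> snd c ` fst c \<Longrightarrow> snd c (chart_inv c x) = x"
  using chart_open(3)[of c] by (auto simp: homeomorphism_def)

lemma continuous_snd: "c \<in> A \<Longrightarrow> continuous_on (fst c) (snd c)"
  using chart_open(3)[of c] by (auto simp: homeomorphism_def)

lemma continuous_chart_inv: "c \<in> A \<Longrightarrow> continuous_on (snd c ` fst c) (chart_inv c)"
  using chart_open(3)[of c] by (auto simp: homeomorphism_def)

lemma snd_image_eq:
  assumes "c \<in> A"
  shows "snd c ` (fst c \<inter> W) = (snd c ` fst c) \<inter> chart_inv c -` W"
  using assms by (auto simp: chart_inv_in image_iff)

lemma open_snd_image:
  assumes "c \<in> A" "open W"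
  shows "open (snd c ` (fst c \<inter> W))"
  unfolding snd_image_eq[OF assms(1)]
  using continuous_open_preimage[OF continuous_chart_inv chart_open(2)] assms by blast

lemma continuous_on_chart:
  assumes "c \<in> A" "W \<subseteq> fst c" "continuous_on (snd c ` W) (T \<circ> chart_inv c)"
  shows "continuous_on W T"
proof -
  have "continuous_on W ((T \<circ> chart_inv c) \<circ> snd c)"
    using continuous_on_subset[OF continuous_snd[OF assms(1)] assms(2)] assms(3)
    by (rule continuous_on_compose)
  thus ?thesis
    by (rule continuous_on_eq) (use assms in auto)
qed

lemma continuous_on_UNIV_charts:
  assumes "\<And>c. c \<in> A \<Longrightarrow> continuous_on (fst c) f"
  shows "continuous_on UNIV f"
proof -
  have "continuous_on (\<Union>c\<in>A. fst c) f"
    using assms chart_open(1) by (intro continuous_on_open_UN) auto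
  moreover have "(\<Union>c\<in>A. fst c) = UNIV" using chart_cover by auto
  ultimately show ?thesis by simp
qed

lemma transition_derivative:
  assumes "c \<in> A" "d \<in> A" "p \<in> fst c" "p \<in> fst d"
  shows "((snd d \<circ> chart_inv c) has_derivative (\<lambda>v. jacobian c d p *v v)) (at (snd c p))"
    and "continuous_on (snd c ` (fst c \<inter> fst d)) (\<lambda>x. jacobian c d (chart_inv c x))"
proof -
  let ?h = "snd d \<circ> chart_inv c" and ?S = "snd c ` (fst c \<inter> fst d)"
  have S: "open ?S" using open_snd_image assms chart_open by blast
  have sm: "smooth_map_on ?S ?h"
    using atlas assms unfolding smooth_atlas_def by blast
  have "(?h has_derivative frechet_derivative ?h (at (snd c p))) (at (snd c p))"
    using smooth_map_on_imp(2)[OF sm S] assms by blast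
  moreover from this have "linear (frechet_derivative ?h (at (snd c p)))"
    by (rule has_derivative_linear)
  ultimately show "(?h has_derivative (\<lambda>v. jacobian c d p *v v)) (at (snd c p))"
    unfolding jacobian_def by (simp add: matrix_works)
  have "continuous_on ?S (\<lambda>x. matrix (frechet_derivative ?h (at x)))"
    unfolding matrix_def
    by (intro continuous_on_vec_lambda continuous_on_component smooth_map_on_imp(3)[OF sm S])
  thus "continuous_on ?S (\<lambda>x. jacobian c d (chart_inv c x))"
    by (rule continuous_on_eq) (use assms in \<open>auto simp: jacobian_def\<close>)
qed

lemma chart_derivative_transform:
  assumes "c \<in> A" "d \<in> A" "p \<in> fst c" "p \<in> fst d"
    and L: "(F \<circ> chart_inv d has_derivative L) (at (snd d p))"
  shows "(F \<circ> chart_inv c has_derivative (\<lambda>v. L (jacobian c d p *v v))) (at (snd c p))"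
proof -
  let ?h = "snd d \<circ> chart_inv c" and ?S = "snd c ` (fst c \<inter> fst d)"
  have S: "open ?S" using open_snd_image assms chart_open by blast
  have "((F \<circ> chart_inv d) \<circ> ?h has_derivative L \<circ> (\<lambda>v. jacobian c d p *v v)) (at (snd c p))"
    using transition_derivative(1)[OF assms(1-4)] L assms
    by (intro diff_chain_at) auto
  hence "((F \<circ> chart_inv d) \<circ> ?h has_derivative (\<lambda>v. L (jacobian c d p *v v))) (at (snd c p))"
    unfolding o_def .
  thus ?thesis
  proof (rule has_derivative_transform_within_open[OF _ S])
    show "snd c p \<in> ?S" using assms by blast
    show "((F \<circ> chart_inv d) \<circ> ?h) x = (F \<circ> chart_inv c) x" if "x \<in> ?S" for x
      using that assms by auto
  qed
qed

section \<open>The metric on vectors and the dual norm on covectors\<close>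

lemma metric_sym: "c \<in> A \<Longrightarrow> p \<in> fst c \<Longrightarrow> transpose (g c p) = g c p"
  and metric_pos: "c \<in> A \<Longrightarrow> p \<in> fst c \<Longrightarrow> v \<noteq> 0 \<Longrightarrow> v \<bullet> (g c p *v v) > 0"
  and metric_transform: "c \<in> A \<Longrightarrow> d \<in> A \<Longrightarrow> p \<in> fst c \<Longrightarrow> p \<in> fst d \<Longrightarrow>
     g c p = transpose (jacobian c d p) ** g d p ** jacobian c d p"
  using metric unfolding riemannian_metric_def by blast+

lemma metric_nonneg: "c \<in> A \<Longrightarrow> p \<in> fst c \<Longrightarrow> v \<bullet> (g c p *v v) \<ge> 0"
  using metric_pos[of c p v] by (cases "v = 0") auto

lemma metric_swap: "c \<in> A \<Longrightarrow> p \<in> fst c \<Longrightarrow> u \<bullet> (g c p *v v) = (g c p *v u) \<bullet> v"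
  using dot_lmul_matrix[of u "g c p" v] metric_sym[of c p] by (metis transpose_matrix_vector)

lemma metric_speed_transform:
  assumes "c \<in> A" "d \<in> A" "p \<in> fst c" "p \<in> fst d"
  shows "v \<bullet> (g c p *v v) = (jacobian c d p *v v) \<bullet> (g d p *v (jacobian c d p *v v))"
  unfolding metric_transform[OF assms] matrix_vector_mul_assoc[symmetric]
  by (metis dot_lmul_matrix inner_commute transpose_matrix_vector transpose_transpose)

lemma metric_continuous: "c \<in> A \<Longrightarrow> continuous_on (fst c) (g c)"
  using metric chart_open(2) unfolding riemannian_metric_def
  by (intro continuous_on_chart[OF _ order_refl] smooth_map_on_imp(1)) auto

lemma invertible_of_ker:
  fixes M :: "real^'n^'n" assumes "\<And>v. M *v v = 0 \<Longrightarrow> v = 0"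
  shows "invertible M"
  using assms unfolding invertible_left_inverse matrix_left_invertible_ker by simp

lemma metric_invertible: "c \<in> A \<Longrightarrow> p \<in> fst c \<Longrightarrow> invertible (g c p)"
  by (rule invertible_of_ker) (metis inner_zero_right less_irrefl metric_pos)

lemma metric_inv:
  assumes "c \<in> A" "p \<in> fst c"
  shows "g c p *v (matrix_inv (g c p) *v a) = a" "matrix_inv (g c p) *v (g c p *v a) = a"
proof -
  have "g c p ** matrix_inv (g c p) = mat 1 \<and> matrix_inv (g c p) ** g c p = mat 1"
    using metric_invertible[OF assms] unfolding invertible_def matrix_inv_def by (rule someI_ex)
  thus "g c p *v (matrix_inv (g c p) *v a) = a" "matrix_inv (g c p) *v (g c p *v a) = a"
    by (simp_all add: matrix_vector_mul_assoc)
qed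

lemma jacobian_invertible:
  assumes "c \<in> A" "d \<in> A" "p \<in> fst c" "p \<in> fst d"
  shows "invertible (jacobian c d p)"
proof (rule invertible_of_ker)
  fix v assume "jacobian c d p *v v = 0"
  hence "v \<bullet> (g c p *v v) = 0" using metric_speed_transform[OF assms] by simp
  thus "v = 0" using metric_pos[OF assms(1,3)] by force
qed

text \<open>The squared length of the covector with components \<open>a\<close>, with respect to the
  dual metric.\<close>

definition q :: "('m, 'n) chart \<Rightarrow> 'm \<Rightarrow> real^'n \<Rightarrow> real" where
  "q c p a = a \<bullet> (matrix_inv (g c p) *v a)"

lemma q_nonneg: "c \<in> A \<Longrightarrow> p \<in> fst c \<Longrightarrow> q c p a \<ge> 0"
  using metric_nonneg[of c p "matrix_inv (g c p) *v a"] by (simp add: q_def metric_inv inner_commute)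

lemma q_scale: "q c p (r *\<^sub>R a) = r\<^sup>2 * q c p a"
  by (simp add: q_def matrix_vector_mult_scaleR power2_eq_square)

lemma q_Cauchy_Schwarz:
  assumes c: "c \<in> A" "p \<in> fst c"
  shows "(a \<bullet> v)\<^sup>2 \<le> q c p a * (v \<bullet> (g c p *v v))"
proof (cases "v = 0")
  case False
  define b where "b = matrix_inv (g c p) *v a"
  \<comment> \<open>\<open>s\<close> is the coefficient of the projection of \<open>b\<close> onto
    \<open>v\<close> that is orthogonal for the metric; here \<open>b\<close> is \<open>a\<close>
    with its index raised.\<close>
  define s where "s = (b \<bullet> (g c p *v v)) / (v \<bullet> (g c p *v v))"
  let ?B = "\<lambda>u v. u \<bullet> (g c p *v v)"
  have a: "a = g c p *v b" unfolding b_def using metric_inv[OF c] by simp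
  have av: "a \<bullet> v = ?B b v" using metric_swap[OF c] a by simp
  have qa: "q c p a = ?B b b" unfolding q_def a b_def[symmetric] 
    using metric_inv[OF c] a b_def by (simp add: inner_commute)
  have vv: "?B v v > 0" using metric_pos[OF c False] .
  have "0 \<le> ?B (b - s *\<^sub>R v) (b - s *\<^sub>R v)" by (rule metric_nonneg[OF c])
  also have "\<dots> = ?B b b - s * ?B b v - s * ?B v b + s\<^sup>2 * ?B v v"
    by (simp add: matrix_vector_mult_diff_distrib matrix_vector_mult_scaleR inner_diff_left inner_diff_right power2_eq_square algebra_simps)
  also have "?B v b = ?B b v" using metric_swap[OF c, of v b] by (simp add: inner_commute)
  also have "?B b b - s * ?B b v - s * ?B b v + s\<^sup>2 * ?B v v = ?B b b - (?B b v)\<^sup>2 / ?B v v"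
    using vv by (simp add: s_def power2_eq_square field_simps)
  finally have "(?B b v)\<^sup>2 / ?B v v \<le> ?B b b" by simp
  thus ?thesis using vv unfolding av qa by (simp add: pos_divide_le_eq)
qed simp

text \<open>Raising the index commutes with the change of chart: if \<open>b\<close> is dual to the
  pulled back covector, then \<open>?J *v b\<close> is dual to \<open>a\<close>, and both sides are
  the pairing of \<open>a\<close> with \<open>?J *v b\<close>.\<close>

lemma q_transform:
  assumes cd: "c \<in> A" "d \<in> A" "p \<in> fst c" "p \<in> fst d"
  shows "q c p (transpose (jacobian c d p) *v a) = q d p a"
proof -
  let ?J = "jacobian c d p"
  define b where "b = matrix_inv (g c p) *v (transpose ?J *v a)"
  have "g c p *v b = transpose ?J *v a" unfolding b_def using metric_inv[OF cd(1,3)] by simp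
  hence "transpose ?J *v (g d p *v (?J *v b)) = transpose ?J *v a"
    unfolding metric_transform[OF cd] by (simp add: matrix_vector_mul_assoc[symmetric])
  moreover have inj: "inj ((*v) (transpose ?J))"
    using jacobian_invertible[OF cd] by (simp add: transpose_invertible inj_matrix_vector_mult)
  ultimately have "g d p *v (?J *v b) = a" by (metis (no_types) injD[OF inj])
  hence "?J *v b = matrix_inv (g d p) *v a" using metric_inv(2)[OF cd(2,4), of "?J *v b"] by simp
  thus ?thesis unfolding q_def b_def[symmetric]
    by (simp add: dot_lmul_matrix)
qed

text \<open>\<open>matrix_inv\<close> is defined by choice. Cramer's rule writes the raised covector
  as a quotient of determinants, whose continuity is visible.\<close>

lemma continuous_q:
  assumes "c \<in> A" "W \<subseteq> fst c" "continuous_on W a"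
  shows "continuous_on W (\<lambda>p. q c p (a p))"
proof -
  have eq: "q c p (a p) = a p \<bullet> (\<chi> k. det (\<chi> i j. if j = k then a p $ i else g c p $ i $ j) / det (g c p))"
    if "p \<in> W" for p
  proof -
    have "det (g c p) \<noteq> 0" using metric_invertible that assms invertible_det_nz by blast
    moreover have "g c p *v (matrix_inv (g c p) *v a p) = a p"
      using metric_inv(1) that assms by blast
    ultimately have "matrix_inv (g c p) *v a p
        = (\<chi> k. det (\<chi> i j. if j = k then a p $ i else g c p $ i $ j) / det (g c p))"
      using cramer by blast
    thus ?thesis unfolding q_def by (rule arg_cong)
  qed
  have gc: "continuous_on W (g c)" using metric_continuous assms continuous_on_subset by blast
  have "continuous_on W (\<lambda>p. if j = k then a p $ i else g c p $ i $ j)" for i j k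
    using assms gc by (cases "j = k") (auto intro!: continuous_intros)
  moreover have "det (g c p) \<noteq> 0" if "p \<in> W" for p
    using metric_invertible that assms invertible_det_nz by blast
  ultimately have "continuous_on W (\<lambda>p. a p \<bullet> (\<chi> k. det (\<chi> i j. if j = k then a p $ i else g c p $ i $ j) / det (g c p)))"
    using assms gc by (intro continuous_intros) auto
  thus ?thesis by (rule continuous_on_eq) (simp add: eq)
qed

text \<open>The inverse metric is real, so the real and imaginary parts of a complex covector
  contribute separately.\<close>

lemma Re_form_inner:
  "Re (form_inner A g w w p) = q (chart_at A p) p (Re_vec (w (chart_at A p) p)) + q (chart_at A p) p (Im_vec (w (chart_at A p) p))"
proof -
  have "Re (complex_of_real r * z * cnj z') = Re z * (r * Re z') + Im z * (r * Im z')" for r z z'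
    by (simp add: algebra_simps)
  thus ?thesis
    by (simp add: form_inner_def Let_def q_def Re_vec_def Im_vec_def matrix_vector_mult_def
        inner_vec_def sum_distrib_left sum.distrib) (simp add: mult_ac)
qed

text \<open>\<open>form_norm\<close> evaluates in the selected chart \<open>chart_at A p\<close>,
  which may jump with \<open>p\<close>. Covariance permits a fixed chart, as continuity arguments
  require.\<close>

lemma form_norm_chart:
  assumes "covariant A w" "c \<in> A" "p \<in> fst c"
  shows "form_norm A g w p = sqrt (q c p (Re_vec (w c p)) + q c p (Im_vec (w c p)))"
proof -
  let ?d = "chart_at A p"
  have d: "?d \<in> A" "p \<in> fst ?d" by (rule chart_at_in)+
  have w: "w c p = (\<chi> i. \<Sum>j\<in>UNIV. (jacobian c ?d p $ j $ i) *\<^sub>R (w ?d p $ j))"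
    using assms d unfolding covariant_def by blast
  have "Re_vec (w c p) = transpose (jacobian c ?d p) *v Re_vec (w ?d p)"
    "Im_vec (w c p) = transpose (jacobian c ?d p) *v Im_vec (w ?d p)"
    by (simp_all add: w Re_vec_def Im_vec_def vec_eq_iff matrix_vector_mult_def transpose_def)
  thus ?thesis
    unfolding form_norm_def Re_form_inner using q_transform[OF assms(2) d(1) assms(3) d(2)] by simp
qed

lemma continuous_form_norm:
  assumes "covariant A w" "\<And>c. c \<in> A \<Longrightarrow> continuous_on (fst c) (w c)"
  shows "continuous_on UNIV (form_norm A g w)"
proof (rule continuous_on_UNIV_charts)
  fix c assume c: "c \<in> A"
  have "continuous_on (fst c) (\<lambda>p. sqrt (q c p (Re_vec (w c p)) + q c p (Im_vec (w c p))))"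
    unfolding Re_vec_def Im_vec_def using assms(2)[OF c]
    by (intro continuous_on_real_sqrt continuous_on_add continuous_q[OF c order_refl] continuous_on_vec_lambda continuous_intros) auto
  thus "continuous_on (fst c) (form_norm A g w)"
    by (rule continuous_on_eq) (simp add: form_norm_chart[OF assms(1) c])
qed

end

section \<open>Riemannian volume\<close>

context riemannian_manifold
begin

definition dens :: "('m, 'n) chart \<Rightarrow> real^'n \<Rightarrow> ennreal" where
  "dens c x = ennreal (sqrt (det (g c (chart_inv c x))))"

definition chart_vol :: "('m, 'n) chart \<Rightarrow> 'm set \<Rightarrow> ennreal" where
  "chart_vol c B = (\<integral>\<^sup>+x\<in>snd c ` B. dens c x \<partial>lborel)"

text \<open>Pushing the density forward to the whole manifold gives an honest measure, so that the
  countable additivity of \<open>chart_vol\<close> comes for free.\<close>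

definition chart_measure :: "('m, 'n) chart \<Rightarrow> 'm measure" where
  "chart_measure c = distr (density (restrict_space lborel (snd c ` fst c)) (dens c)) borel (chart_inv c)"

lemma chart_inv_measurable: "c \<in> A \<Longrightarrow> chart_inv c \<in> measurable (restrict_space borel (snd c ` fst c)) borel"
  by (intro borel_measurable_continuous_on_restrict continuous_chart_inv)

lemma sets_restrict_lborel: "sets (restrict_space lborel S) = sets (restrict_space borel S)"
  by (simp add: sets_restrict_space)

lemma snd_image_borel:
  assumes "c \<in> A" "B \<in> sets borel" "B \<subseteq> fst c"
  shows "snd c ` B \<in> sets borel"
proof -
  have "snd c ` B = chart_inv c -` B \<inter> space (restrict_space borel (snd c ` fst c))"
    using snd_image_eq[OF assms(1), of B] assms(3) by (auto simp: space_restrict_space Int_absorb1)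
  also have "\<dots> \<in> sets (restrict_space borel (snd c ` fst c))"
    using measurable_sets[OF chart_inv_measurable[OF assms(1)] assms(2)] .
  finally show ?thesis
    using chart_open(2)[OF assms(1)] by (auto simp: sets_restrict_space_iff)
qed

lemma continuous_sqrt_det:
  "c \<in> A \<Longrightarrow> continuous_on (snd c ` fst c) (\<lambda>x. sqrt (det (g c (chart_inv c x))))"
  using metric chart_open(2)[of c] smooth_map_on_imp(1)[of "snd c ` fst c" "g c \<circ> chart_inv c"]
  unfolding riemannian_metric_def o_def
  by (intro continuous_intros) auto

lemma dens_measurable: "c \<in> A \<Longrightarrow> dens c \<in> borel_measurable (restrict_space borel (snd c ` fst c))"
  unfolding dens_def
  by (rule measurable_compose[OF borel_measurable_continuous_on_restrict[OF continuous_sqrt_det] measurable_ennreal])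

lemma emeasure_chart_measure:
  assumes c: "c \<in> A" and B: "B \<in> sets borel"
  shows "emeasure (chart_measure c) B = chart_vol c (B \<inter> fst c)"
proof -
  let ?R = "restrict_space lborel (snd c ` fst c)"
  have m: "chart_inv c \<in> measurable (density ?R (dens c)) borel"
    using chart_inv_measurable[OF c] measurable_cong_sets[OF sets_restrict_lborel refl] by auto
  have d: "dens c \<in> borel_measurable ?R"
    using dens_measurable[OF c] measurable_cong_sets[OF sets_restrict_lborel refl] by blast
  have U: "snd c ` fst c \<inter> space lborel \<in> sets lborel" using chart_open(2)[OF c] by simp
  have eq: "chart_inv c -` B \<inter> snd c ` fst c = snd c ` (B \<inter> fst c)"
    using snd_image_eq[OF c, of B] by (simp add: Int_commute)
  have s: "chart_inv c -` B \<inter> snd c ` fst c \<in> sets ?R"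
    unfolding eq using snd_image_borel[OF c] B chart_open(1,2)[OF c] by (auto simp: sets_restrict_space_iff)
  have "emeasure (chart_measure c) B = emeasure (density ?R (dens c)) (chart_inv c -` B \<inter> snd c ` fst c)"
    unfolding chart_measure_def using m B by (subst emeasure_distr) (auto simp: space_restrict_space)
  also have "\<dots> = (\<integral>\<^sup>+x. dens c x * indicator (snd c ` (B \<inter> fst c)) x \<partial>?R)"
    using d s unfolding eq by (subst emeasure_density) auto
  also have "\<dots> = chart_vol c (B \<inter> fst c)"
    unfolding chart_vol_def using U
    by (subst nn_integral_restrict_space) (auto intro!: nn_integral_cong simp: indicator_def)
  finally show ?thesis .
qed

lemma sets_chart_measure [simp]: "sets (chart_measure c) = sets borel"
  by (simp add: chart_measure_def)

lemma inj_on_snd: "c \<in> A \<Longrightarrow> inj_on (snd c) (fst c)"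
  by (rule inj_on_inverseI[of _ "chart_inv c"]) simp

lemma sqrt_det_transform:
  assumes cd: "c \<in> A" "d \<in> A" "p \<in> fst c" "p \<in> fst d"
  shows "sqrt (det (g c p)) = sqrt (det (g d p)) * \<bar>det (jacobian c d p)\<bar>"
proof -
  have "det (g c p) = det (g d p) * (det (jacobian c d p))\<^sup>2"
    unfolding metric_transform[OF cd] by (simp add: det_mul power2_eq_square)
  thus ?thesis by (simp add: real_sqrt_mult)
qed

text \<open>The factor by which \<open>sqrt (det g)\<close> changes between charts is exactly the
  absolute Jacobian determinant of the change of variables.\<close>

lemma chart_vol_transition:
  assumes c: "c \<in> A" and d: "d \<in> A" and B: "B \<in> sets borel" "B \<subseteq> fst c" "B \<subseteq> fst d"
  shows "chart_vol c B = chart_vol d B"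
proof -
  let ?W = "fst c \<inter> fst d"
  let ?S = "snd c ` ?W" and ?T = "snd d ` ?W" and ?h = "snd d \<circ> chart_inv c" and ?k = "snd c \<circ> chart_inv d"
  let ?f = "\<lambda>y. dens d y * indicator (snd d ` B) y"
  have dB: "snd d ` B \<in> sets borel" using snd_image_borel d B by blast
  have T': "snd d ` fst d \<in> sets borel" using chart_open(2)[OF d] by simp
  \<comment> \<open>\<open>dens d\<close> is known to be measurable on the range of the chart only.
    Cutting off there first makes the integrand Borel on the whole space.\<close>
  have f: "?f \<in> borel_measurable borel"
  proof -
    have m1: "(\<lambda>y. dens d y * indicator (snd d ` fst d) y) \<in> borel_measurable borel"
      using dens_measurable[OF d] T' by (subst (asm) borel_measurable_restrict_space_iff_ennreal) auto
    hence "(\<lambda>y. (dens d y * indicator (snd d ` fst d) y) * indicator (snd d ` B) y) \<in> borel_measurable borel"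
      using m1 dB by measurable
    moreover have "(\<lambda>y. (dens d y * indicator (snd d ` fst d) y) * indicator (snd d ` B) y) = ?f"
    proof
      show "(dens d y * indicator (snd d ` fst d) y) * indicator (snd d ` B) y = ?f y" for y
        using B by (cases "y \<in> snd d ` B") (auto simp: indicator_def)
    qed
    ultimately show ?thesis by simp
  qed
  have "chart_vol d B = (\<integral>\<^sup>+y. ?f y * indicator ?T y \<partial>lborel)"
    unfolding chart_vol_def
  proof (rule nn_integral_cong)
    have "snd d ` B \<subseteq> ?T" using B by blast
    thus "?f y = ?f y * indicator ?T y" for y
      by (cases "y \<in> ?T") (auto simp: indicator_def)
  qed
  also have "\<dots> = (\<integral>\<^sup>+x. ?f (?h x) * ennreal \<bar>det (matrix (\<lambda>v. jacobian c d (chart_inv c x) *v v))\<bar> * indicator ?S x \<partial>lborel)"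
  proof (rule nn_integral_change_of_variables)
    show "open ?S" using open_snd_image[OF c] chart_open(1)[OF d] by blast
    show "open ?T" using open_snd_image[OF d, of "fst c"] chart_open(1)[OF c] by (simp add: Int_commute)
    show "homeomorphism ?S ?T ?h ?k"
    proof (rule homeomorphismI)
      show "continuous_on ?S ?h"
        using c d by (intro continuous_on_compose continuous_on_subset[OF continuous_chart_inv[OF c]]
            continuous_on_subset[OF continuous_snd[OF d]]) auto
      show "continuous_on ?T ?k"
        using c d by (intro continuous_on_compose continuous_on_subset[OF continuous_chart_inv[OF d]]
            continuous_on_subset[OF continuous_snd[OF c]]) auto
    qed (use c d in auto)
    show "(?h has_derivative (\<lambda>v. jacobian c d (chart_inv c x) *v v)) (at x)" if "x \<in> ?S" for x
      using that transition_derivative(1)[OF c d] c by auto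
    show "continuous_on ?S (\<lambda>x. det (matrix (\<lambda>v. jacobian c d (chart_inv c x) *v v)))"
      unfolding matrix_of_matrix_vector_mul
      using transition_derivative(2)[OF c d] continuous_on_det by (cases "?W = {}") auto
    show "?f \<in> borel_measurable borel" by (rule f)
  qed
  also have "\<dots> = chart_vol c B"
    unfolding chart_vol_def matrix_of_matrix_vector_mul
  proof (rule nn_integral_cong)
    fix x
    show "?f (?h x) * ennreal \<bar>det (jacobian c d (chart_inv c x))\<bar> * indicator ?S x = dens c x * indicator (snd c ` B) x"
    proof (cases "x \<in> ?S")
      case True
      then obtain p where p: "p \<in> fst c" "p \<in> fst d" "x = snd c p" by auto
      have "snd d p \<in> snd d ` B \<longleftrightarrow> p \<in> B" "snd c p \<in> snd c ` B \<longleftrightarrow> p \<in> B"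
        using inj_on_image_mem_iff[OF inj_on_snd[OF d] p(2) B(3)] inj_on_image_mem_iff[OF inj_on_snd[OF c] p(1) B(2)]
        by auto
      moreover have "dens d (snd d p) * ennreal \<bar>det (jacobian c d p)\<bar> = dens c (snd c p)"
        using p c d sqrt_det_transform[OF c d p(1,2)] by (simp add: dens_def ennreal_mult'')
      ultimately show ?thesis using p c d True by (simp add: indicator_def)
    next
      case False
      moreover have "snd c ` B \<subseteq> ?S" using B by blast
      ultimately have "x \<notin> snd c ` B" by blast
      thus ?thesis using False by simp
    qed
  qed
  finally show ?thesis ..
qed

lemma finite_chart_cover:
  obtains cs :: "nat \<Rightarrow> ('m, 'n) chart" and N :: nat
  where "\<And>i. i < N \<Longrightarrow> cs i \<in> A" "(\<Union>i<N. fst (cs i)) = UNIV"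
proof -
  obtain C where C: "C \<subseteq> A" "finite C" "UNIV \<subseteq> (\<Union>c\<in>C. fst c)"
    using compactE_image[OF compact_UNIV, of A fst] chart_open(1) chart_cover by (metis UNIV_I UN_iff subsetI)
  obtain cs where "bij_betw cs {..<card C} C"
    using ex_bij_betw_nat_finite[OF C(2)] by (auto simp: atLeast0LessThan)
  hence img: "cs ` {..<card C} = C" by (simp add: bij_betw_def)
  show ?thesis
  proof (rule that)
    show "cs i \<in> A" if "i < card C" for i using img C(1) that by auto
    have "(\<Union>i<card C. fst (cs i)) = (\<Union>c\<in>cs ` {..<card C}. fst c)" by simp
    hence "UNIV \<subseteq> (\<Union>i<card C. fst (cs i))" using C(3) unfolding img by simp
    thus "(\<Union>i<card C. fst (cs i)) = UNIV" by (rule equalityI[OF subset_UNIV])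
  qed
qed

section \<open>Existence and uniqueness of the Riemannian measure\<close>

definition is_vol :: "'m measure \<Rightarrow> bool" where
  "is_vol \<mu> \<longleftrightarrow> sets \<mu> = sets borel \<and>
     (\<forall>c\<in>A. \<forall>B\<in>sets borel. B \<subseteq> fst c \<longrightarrow> emeasure \<mu> B = chart_vol c B)"

text \<open>Finitely many charts are cut into disjoint Borel pieces, each measured in its own chart.
  Agreement of chart volumes on overlaps gives the required values in every chart, and the same
  pieces determine the measure uniquely.\<close>

lemma ex1_vol: "\<exists>!\<mu>. is_vol \<mu>"
proof -
  obtain cs :: "nat \<Rightarrow> ('m, 'n) chart" and N where cs: "\<And>i. i < N \<Longrightarrow> cs i \<in> A" "(\<Union>i<N. fst (cs i)) = UNIV"
    by (rule finite_chart_cover) blast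
  \<comment> \<open>\<open>P i\<close> collects the points whose first chart in the enumeration is
    the one with index \<open>i\<close>.\<close>
  define P where "P i = fst (cs i) - (\<Union>j<i. fst (cs j))" for i
  have P: "disjoint_family_on P {..<N}" "(\<Union>i<N. P i) = UNIV" "\<And>i. P i \<subseteq> fst (cs i)"
  proof -
    show "disjoint_family_on P {..<N}"
      unfolding disjoint_family_on_def P_def by auto (metis lessThan_iff linorder_neqE_nat)
    show "(\<Union>i<N. P i) = UNIV"
    proof (rule equalityI[OF subset_UNIV], rule subsetI)
      fix x :: 'm
      define i where "i = (LEAST i. i < N \<and> x \<in> fst (cs i))"
      have "\<exists>i. i < N \<and> x \<in> fst (cs i)" using cs(2) by auto
      hence "i < N \<and> x \<in> fst (cs i)" unfolding i_def by (rule LeastI_ex)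
      moreover have "x \<notin> fst (cs j)" if "j < i" for j
        using not_less_Least[of j "\<lambda>i. i < N \<and> x \<in> fst (cs i)"] that calculation
        unfolding i_def[symmetric] by auto
      ultimately show "x \<in> (\<Union>i<N. P i)" unfolding P_def by auto
    qed
  qed (auto simp: P_def)
  have Pb: "P i \<in> sets borel" if "i < N" for i
    unfolding P_def using that cs chart_open(1) by (intro sets.Diff sets.finite_UN) auto
  have split: "(\<Sum>i<N. emeasure \<nu> (B \<inter> P i)) = emeasure \<nu> B" if "sets \<nu> = sets borel" "B \<in> sets borel" for \<nu> B
  proof -
    have "(\<Sum>i<N. emeasure \<nu> (B \<inter> P i)) = emeasure \<nu> (\<Union>i<N. B \<inter> P i)"
    proof (rule sum_emeasure)
      show "disjoint_family_on (\<lambda>i. B \<inter> P i) {..<N}"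
        using P(1) unfolding disjoint_family_on_def by blast
    qed (use that Pb in auto)
    also have "(\<Union>i<N. B \<inter> P i) = B" using P(2) by auto
    finally show ?thesis .
  qed
  define m where "m B = (\<Sum>i<N. emeasure (chart_measure (cs i)) (B \<inter> P i))" for B
  define \<mu> where "\<mu> = measure_of UNIV (sets borel) m"
  have sets\<mu>: "sets \<mu> = sets borel"
    unfolding \<mu>_def by (metis sets.sets_measure_of_eq space_borel)
  have "countably_additive (sets borel) m"
  proof (rule countably_additiveI)
    fix F :: "nat \<Rightarrow> 'm set" assume F: "range F \<subseteq> sets borel" "disjoint_family F"
    have "(\<Sum>n. m (F n)) = (\<Sum>i<N. \<Sum>n. emeasure (chart_measure (cs i)) (F n \<inter> P i))"
      unfolding m_def by (rule suminf_sum) simp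
    also have "\<dots> = (\<Sum>i<N. emeasure (chart_measure (cs i)) (\<Union>n. F n \<inter> P i))"
      using F Pb by (intro sum.cong suminf_emeasure refl) (auto simp: disjoint_family_on_def)
    also have "\<dots> = m (\<Union> (range F))"
      unfolding m_def by (intro sum.cong refl arg_cong2[where f=emeasure]) auto
    finally show "(\<Sum>n. m (F n)) = m (\<Union> (range F))" .
  qed
  moreover have "positive (sets borel) m" unfolding positive_def m_def by simp
  moreover have "sigma_algebra UNIV (sets (borel :: 'm measure))"
    by (metis sets.sigma_algebra_axioms space_borel)
  ultimately have em: "emeasure \<mu> B = m B" if "B \<in> sets borel" for B
    unfolding \<mu>_def using that by (intro emeasure_measure_of_sigma)
  have \<mu>: "is_vol \<mu>"
    unfolding is_vol_def
  proof (intro conjI ballI impI sets\<mu>)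
    fix c B assume c: "c \<in> A" and B: "B \<in> sets borel" "B \<subseteq> fst c"
    have "emeasure \<mu> B = (\<Sum>i<N. emeasure (chart_measure (cs i)) (B \<inter> P i))"
      using em[OF B(1)] by (simp add: m_def)
    \<comment> \<open>On each piece the chart used for gluing is exchanged for \<open>c\<close>;
      afterwards the pieces can be reassembled inside a single measure.\<close>
    also have "\<dots> = (\<Sum>i<N. emeasure (chart_measure c) (B \<inter> P i))"
    proof (intro sum.cong refl)
      fix i assume i: "i \<in> {..<N}"
      have BP: "B \<inter> P i \<in> sets borel" using B Pb i by auto
      have sub: "B \<inter> P i \<subseteq> fst (cs i)" "B \<inter> P i \<subseteq> fst c" using B P(3) by auto
      have "emeasure (chart_measure (cs i)) (B \<inter> P i) = chart_vol (cs i) (B \<inter> P i)"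
        using emeasure_chart_measure[OF cs(1) BP] i sub(1) by (simp add: Int_absorb2)
      also have "\<dots> = chart_vol c (B \<inter> P i)"
        using chart_vol_transition[OF cs(1) c BP sub] i by simp
      also have "\<dots> = emeasure (chart_measure c) (B \<inter> P i)"
        using emeasure_chart_measure[OF c BP] sub(2) by (simp add: Int_absorb2)
      finally show "emeasure (chart_measure (cs i)) (B \<inter> P i) = emeasure (chart_measure c) (B \<inter> P i)" .
    qed
    also have "\<dots> = emeasure (chart_measure c) B" by (rule split) (use B in auto)
    also have "\<dots> = chart_vol c B" using emeasure_chart_measure[OF c B(1)] B(2) by (simp add: Int_absorb2)
    finally show "emeasure \<mu> B = chart_vol c B" .
  qed
  show ?thesis
  proof (rule ex1I[of is_vol, OF \<mu>])
    fix \<nu> assume \<nu>: "is_vol \<nu>"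
    show "\<nu> = \<mu>"
    proof (rule measure_eqI)
      show "sets \<nu> = sets \<mu>" using \<nu> \<mu> by (simp add: is_vol_def)
      fix B assume "B \<in> sets \<nu>"
      hence B: "B \<in> sets borel" using \<nu> by (simp add: is_vol_def)
      have "emeasure \<nu> (B \<inter> P i) = emeasure \<mu> (B \<inter> P i)" if "i < N" for i
      proof -
        have "B \<inter> P i \<in> sets borel" "B \<inter> P i \<subseteq> fst (cs i)" using B Pb P(3) that by auto
        thus ?thesis using \<nu> \<mu> cs(1)[OF that] unfolding is_vol_def by simp
      qed
      hence "(\<Sum>i<N. emeasure \<nu> (B \<inter> P i)) = (\<Sum>i<N. emeasure \<mu> (B \<inter> P i))" by simp
      thus "emeasure \<nu> B = emeasure \<mu> B"
        using split[OF _ B, of \<nu>] split[OF _ B, of \<mu>] \<nu> \<mu> by (simp add: is_vol_def)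
    qed
  qed
qed

lemma vol_is_vol: "is_vol (vol A g)"
proof -
  have "vol A g = (THE \<mu>. is_vol \<mu>)"
    unfolding vol_def is_vol_def chart_vol_def dens_def ..
  thus ?thesis using theI'[OF ex1_vol] by simp
qed

lemma sets_vol [simp, measurable_cong]: "sets (vol A g) = sets borel"
  using vol_is_vol by (simp add: is_vol_def)

lemma space_vol [simp]: "space (vol A g) = UNIV"
  using sets_eq_imp_space_eq[OF sets_vol] by simp

text \<open>The density is bounded on a compact coordinate ball, so every point has a neighbourhood
  of finite volume; compactness does the rest.\<close>

lemma vol_finite: "emeasure (vol A g) UNIV < \<infinity>"
proof -
  have "\<exists>V. open V \<and> p \<in> V \<and> emeasure (vol A g) V < \<infinity>" for p
  proof -
    obtain c where c: "c \<in> A" "p \<in> fst c" using chart_cover by blast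
    then obtain e where e: "e > 0" "cball (snd c p) e \<subseteq> snd c ` fst c"
      using chart_open(2)[OF c(1)] open_contains_cball by (metis imageI)
    let ?V = "fst c \<inter> snd c -` ball (snd c p) e"
    have V: "open ?V" using continuous_open_preimage[OF continuous_snd[OF c(1)] chart_open(1)[OF c(1)]] by simp
    have img: "snd c ` ?V \<subseteq> ball (snd c p) e" by auto
    have "compact ((\<lambda>x. sqrt (det (g c (chart_inv c x)))) ` cball (snd c p) e)"
      using continuous_on_subset[OF continuous_sqrt_det[OF c(1)] e(2)] compact_cball by (rule compact_continuous_image)
    then obtain K where K: "\<And>x. x \<in> cball (snd c p) e \<Longrightarrow> norm (sqrt (det (g c (chart_inv c x)))) \<le> K"
      using compact_imp_bounded bounded_iff by (metis imageI)
    have "emeasure (vol A g) ?V = (\<integral>\<^sup>+x\<in>snd c ` ?V. dens c x \<partial>lborel)"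
      using vol_is_vol c V unfolding is_vol_def chart_vol_def by auto
    also have "\<dots> \<le> (\<integral>\<^sup>+x. ennreal K * indicator (cball (snd c p) e) x \<partial>lborel)"
    proof (intro nn_integral_mono)
      fix x
      have "dens c x \<le> ennreal K" if "x \<in> snd c ` ?V"
        unfolding dens_def using K[of x] img that by (intro ennreal_leI) auto
      thus "dens c x * indicator (snd c ` ?V) x \<le> ennreal K * indicator (cball (snd c p) e) x"
        using img by (auto simp: indicator_def)
    qed
    also have "\<dots> = ennreal K * emeasure lborel (cball (snd c p) e)"
      by (rule nn_integral_cmult_indicator) simp
    also have "\<dots> < \<infinity>" using emeasure_lborel_cball_finite[of "snd c p" e] by (simp add: ennreal_mult_less_top)
    finally show ?thesis using V c e by (intro exI[of _ ?V]) auto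
  qed
  then obtain V where V: "\<And>p. open (V p)" "\<And>p. p \<in> V p" "\<And>p. emeasure (vol A g) (V p) < \<infinity>" by metis
  obtain C where C: "finite C" "UNIV \<subseteq> (\<Union>p\<in>C. V p)"
    using compactE_image[OF compact_UNIV, of UNIV V] V by (metis UNIV_I UN_I subsetI)
  have "emeasure (vol A g) UNIV \<le> emeasure (vol A g) (\<Union>p\<in>C. V p)"
    using C V(1) by (intro emeasure_mono sets.finite_UN) auto
  also have "\<dots> \<le> (\<Sum>p\<in>C. emeasure (vol A g) (V p))"
    using C V(1) by (intro emeasure_subadditive_finite) auto
  also have "\<dots> < \<infinity>" using C V(3) by (simp add: less_top)
  finally show ?thesis .
qed

lemma finite_measure_vol: "finite_measure (vol A g)"
  using vol_finite by (intro finite_measureI) auto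

end

section \<open>Short curves\<close>

context riemannian_manifold
begin

lemma C1_curve_on_subinterval:
  assumes "C1_curve_on A \<gamma> a b" "a \<le> a'" "b' \<le> b"
  shows "C1_curve_on A \<gamma> a' b'"
  unfolding C1_curve_on_def
proof (intro conjI ballI)
  have sub: "{a'..b'} \<subseteq> {a..b}" using assms by auto
  show "continuous_on {a'..b'} \<gamma>"
    using assms(1) continuous_on_subset[OF _ sub] unfolding C1_curve_on_def by blast
  fix c assume "c \<in> A"
  then obtain v where v: "continuous_on {t \<in> {a..b}. \<gamma> t \<in> fst c} v"
    "\<And>t. t \<in> {a..b} \<Longrightarrow> \<gamma> t \<in> fst c \<Longrightarrow> ((snd c \<circ> \<gamma>) has_vector_derivative v t) (at t within {a..b})"
    using assms(1) unfolding C1_curve_on_def by blast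
  have "continuous_on {t \<in> {a'..b'}. \<gamma> t \<in> fst c} v"
    by (rule continuous_on_subset[OF v(1)]) (use sub in auto)
  moreover have "((snd c \<circ> \<gamma>) has_vector_derivative v t) (at t within {a'..b'})"
    if "t \<in> {a'..b'}" "\<gamma> t \<in> fst c" for t
    using has_vector_derivative_within_subset[OF v(2) sub] that sub by blast
  ultimately show "\<exists>v. continuous_on {t \<in> {a'..b'}. \<gamma> t \<in> fst c} v \<and> (\<forall>t\<in>{a'..b'}. \<gamma> t \<in> fst c \<longrightarrow>
         (snd c \<circ> \<gamma> has_vector_derivative v t) (at t within {a'..b'}))" by blast
qed

text \<open>\<open>curve_speed\<close> uses a selected chart and the two-sided derivative. At
  interior parameters both agree with the derivative in any chart, by the chain rule and the
  transformation law of the metric.\<close>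

lemma curve_speed_chart:
  assumes C1: "C1_curve_on A \<gamma> a b" and t: "a < t" "t < b" and c: "c \<in> A" "\<gamma> t \<in> fst c"
    and v: "((snd c \<circ> \<gamma>) has_vector_derivative v) (at t within {a..b})"
  shows "curve_speed A g \<gamma> t = sqrt (v \<bullet> (g c (\<gamma> t) *v v))"
proof -
  let ?d = "chart_at A (\<gamma> t)"
  have d: "?d \<in> A" "\<gamma> t \<in> fst ?d" by (rule chart_at_in)+
  have at: "at t within {a..b} = at t" using t by (rule at_within_Icc_at)
  have ct: "continuous_on {a..b} \<gamma>" using C1 unfolding C1_curve_on_def by blast
  have tab: "t \<in> {a..b}" using t by simp
  obtain w where w: "((snd ?d \<circ> \<gamma>) has_vector_derivative w) (at t)"
    using C1 d tab unfolding C1_curve_on_def at[symmetric] by blast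
  let ?J = "jacobian ?d c (\<gamma> t)" and ?S = "{a<..<b} \<inter> \<gamma> -` fst ?d"
  have S: "open ?S"
    by (rule continuous_open_preimage[OF continuous_on_subset[OF ct]]) (use d chart_open in auto)
  have "((snd c \<circ> chart_inv ?d) \<circ> (snd ?d \<circ> \<gamma>) has_derivative (\<lambda>v. ?J *v v) \<circ> (\<lambda>x. x *\<^sub>R w)) (at t)"
    using w transition_derivative(1)[OF d(1) c(1) d(2) c(2)]
    by (intro diff_chain_at) (auto simp: has_vector_derivative_def)
  hence "((snd c \<circ> chart_inv ?d) \<circ> (snd ?d \<circ> \<gamma>) has_vector_derivative (?J *v w)) (at t)"
    by (simp add: has_vector_derivative_def o_def matrix_vector_mult_scaleR)
  hence "((snd c \<circ> \<gamma>) has_vector_derivative (?J *v w)) (at t)"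
    by (rule has_vector_derivative_transform_within_open[OF _ S]) (use t d in auto)
  hence "v = ?J *v w" using v unfolding at by (rule vector_derivative_unique_at[rotated])
  moreover have "vector_derivative (snd ?d \<circ> \<gamma>) (at t) = w" using w by (rule vector_derivative_at)
  ultimately show ?thesis
    unfolding curve_speed_def Let_def using metric_speed_transform[OF d(1) c(1) d(2) c(2), of w] by simp
qed

text \<open>Measurability of the speed of a curve is never shown, and the nonnegative integral is additive only for
  measurable functions; hence lower bounds for lengths are witnessed by measurable minorants.\<close>

definition speed_minorant :: "(real \<Rightarrow> 'm) \<Rightarrow> real \<Rightarrow> real \<Rightarrow> (real \<Rightarrow> ennreal) \<Rightarrow> bool" where
  "speed_minorant \<gamma> a b e \<longleftrightarrow> e \<in> borel_measurable lborel \<and>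
     (AE t in lborel. e t \<le> ennreal (curve_speed A g \<gamma> t) * indicator {a..b} t)"

lemma speed_minorant_le: "speed_minorant \<gamma> a b e \<Longrightarrow>
   (\<integral>\<^sup>+t. e t \<partial>lborel) \<le> (\<integral>\<^sup>+t\<in>{a..b}. ennreal (curve_speed A g \<gamma> t) \<partial>lborel)"
  unfolding speed_minorant_def by (intro nn_integral_mono_AE) auto

lemma speed_minorant_add:
  assumes "speed_minorant \<gamma> a b e" "speed_minorant \<gamma> b d f" "a \<le> b" "b \<le> d"
  shows "speed_minorant \<gamma> a d (\<lambda>t. e t + f t)"
proof -
  \<comment> \<open>The two intervals share \<open>b\<close>, where the sum would count the speed
    twice.\<close>
  have "AE t in lborel. t \<noteq> b" by (rule AE_lborel_singleton)
  moreover have "AE t in lborel. e t \<le> ennreal (curve_speed A g \<gamma> t) * indicator {a..b} t"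
    "AE t in lborel. f t \<le> ennreal (curve_speed A g \<gamma> t) * indicator {b..d} t"
    using assms unfolding speed_minorant_def by auto
  ultimately have "AE t in lborel. e t + f t \<le> ennreal (curve_speed A g \<gamma> t) * indicator {a..d} t"
  proof eventually_elim
    case (elim t)
    have "e t + f t \<le> ennreal (curve_speed A g \<gamma> t) * indicator {a..b} t + ennreal (curve_speed A g \<gamma> t) * indicator {b..d} t"
      using elim by (intro add_mono) auto
    also have "\<dots> = ennreal (curve_speed A g \<gamma> t) * indicator {a..d} t"
      using elim(1) assms(3,4) by (auto simp: indicator_def)
    finally show ?case .
  qed
  thus ?thesis using assms unfolding speed_minorant_def by auto
qed

text \<open>The increment of \<open>H\<close> is the integral of the continuous derivative
  \<open>E\<close> along the curve, and the bound on \<open>D\<close> makes the norm of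
  \<open>E\<close> divided by \<open>K\<close> a measurable minorant of the speed.\<close>

lemma C1_curve_estimate:
  fixes H :: "'m \<Rightarrow> 'b::euclidean_space"
  assumes C1: "C1_curve_on A \<gamma> a b" and ab: "a < b" and c: "c \<in> A" "W \<subseteq> fst c" and W: "\<And>t. t \<in> {a..b} \<Longrightarrow> \<gamma> t \<in> W"
    and H: "\<And>p. p \<in> W \<Longrightarrow> (H \<circ> chart_inv c has_derivative D p) (at (snd c p))"
    and contD: "\<And>v. continuous_on W (\<lambda>p. D p v)"
    and K: "K > 0" "\<And>p v. p \<in> W \<Longrightarrow> norm (D p v) \<le> K * sqrt (v \<bullet> (g c p *v v))"
  shows "\<exists>e. speed_minorant \<gamma> a b e \<and> ennreal (norm (H (\<gamma> b) - H (\<gamma> a)) / K) \<le> (\<integral>\<^sup>+t. e t \<partial>lborel)"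
proof -
  have Wc: "\<gamma> t \<in> fst c" if "t \<in> {a..b}" for t using W[OF that] c by auto
  have ct: "continuous_on {a..b} \<gamma>" using C1 unfolding C1_curve_on_def by blast
  have "{t \<in> {a..b}. \<gamma> t \<in> fst c} = {a..b}" using Wc by auto
  then obtain v where v: "continuous_on {a..b} v"
    "\<And>t. t \<in> {a..b} \<Longrightarrow> ((snd c \<circ> \<gamma>) has_vector_derivative v t) (at t within {a..b})"
    using C1 c(1) Wc unfolding C1_curve_on_def by metis
  define E where "E t = D (\<gamma> t) (v t)" for t
  have linD: "linear (D p)" if "p \<in> W" for p using H[OF that] by (rule has_derivative_linear)
  \<comment> \<open>\<open>D\<close> is continuous in the point for each fixed vector only, so the
    moving vector \<open>v t\<close> is expanded in the standard basis.\<close>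
  have contE: "continuous_on {a..b} E"
  proof -
    have "continuous_on {a..b} (\<lambda>t. \<Sum>j\<in>UNIV. (v t $ j) *\<^sub>R D (\<gamma> t) (axis j 1))"
    proof (intro continuous_intros)
      show "continuous_on {a..b} (\<lambda>t. D (\<gamma> t) (axis j 1))" for j
        by (rule continuous_on_compose2[OF contD ct]) (use W in auto)
    qed (use v in auto)
    moreover have "(\<Sum>j\<in>UNIV. (v t $ j) *\<^sub>R D (\<gamma> t) (axis j 1)) = E t" if "t \<in> {a..b}" for t
      unfolding E_def using linear_vec_expand[OF linD[OF W[OF that]], of "v t"] by simp
    ultimately show ?thesis by (rule continuous_on_eq)
  qed
  have der: "((\<lambda>t. H (\<gamma> t)) has_vector_derivative E t) (at t within {a..b})" if t: "t \<in> {a..b}" for t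
  proof -
    have "(H \<circ> chart_inv c has_derivative D (\<gamma> t)) (at ((snd c \<circ> \<gamma>) t) within (snd c \<circ> \<gamma>) ` {a..b})"
      using H[OF W[OF t]] by (simp add: has_derivative_at_withinI)
    from diff_chain_within[OF v(2)[OF t, unfolded has_vector_derivative_def] this]
    have "((H \<circ> chart_inv c) \<circ> (snd c \<circ> \<gamma>) has_vector_derivative E t) (at t within {a..b})"
      unfolding has_vector_derivative_def E_def
      using linD[OF W[OF t]] by (simp add: o_def linear_scale)
    thus ?thesis
      by (rule has_vector_derivative_transform[OF t, rotated]) (use Wc c in auto)
  qed
  have "(E has_integral (H (\<gamma> b) - H (\<gamma> a))) {a..b}"
    using der ab by (intro fundamental_theorem_of_calculus) auto
  hence "norm (H (\<gamma> b) - H (\<gamma> a)) = norm (integral {a..b} E)" by (simp add: integral_unique)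
  also have "\<dots> \<le> integral {a..b} (\<lambda>t. norm (E t))"
    using contE by (intro integral_norm_bound_integral integrable_continuous_real continuous_intros) auto
  finally have 1: "norm (H (\<gamma> b) - H (\<gamma> a)) / K \<le> integral {a..b} (\<lambda>t. norm (E t)) / K"
    using K(1) by (simp add: divide_right_mono)
  have contEK: "continuous_on {a..b} (\<lambda>t. norm (E t) / K)" using contE K(1) by (intro continuous_intros) auto
  have int: "set_integrable lborel {a..b} (\<lambda>t. norm (E t) / K)"
    using contEK by (rule borel_integrable_atLeastAtMost')
  define e where "e t = ennreal (norm (E t) / K) * indicator {a..b} t" for t
  have e_alt: "e t = ennreal (indicator {a..b} t *\<^sub>R (norm (E t) / K))" for t
    unfolding e_def by (auto simp: indicator_def)
  have "integral {a..b} (\<lambda>t. norm (E t)) / K = integral {a..b} (\<lambda>t. norm (E t) / K)"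
    by simp
  also have "\<dots> = (LINT t:{a..b}|lborel. norm (E t) / K)"
    by (rule set_borel_integral_eq_integral(2)[OF int, symmetric])
  also have "ennreal \<dots> = (\<integral>\<^sup>+t. e t \<partial>lborel)"
    unfolding e_alt set_lebesgue_integral_def using int K(1) unfolding set_integrable_def
    by (intro nn_integral_eq_integral[symmetric]) auto
  finally have 2: "ennreal (norm (H (\<gamma> b) - H (\<gamma> a)) / K) \<le> (\<integral>\<^sup>+t. e t \<partial>lborel)"
    using 1 by (metis ennreal_leI)
  have me: "e \<in> borel_measurable lborel"
    unfolding e_alt using int unfolding set_integrable_def by (intro measurable_compose[OF borel_measurable_integrable measurable_ennreal])
  \<comment> \<open>At the end points the curve has only one-sided derivatives here, whereas
    \<open>curve_speed\<close> takes a two-sided one.\<close>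
  have "AE t in lborel. t \<noteq> a" "AE t in lborel. t \<noteq> b" by (rule AE_lborel_singleton)+
  hence "AE t in lborel. e t \<le> ennreal (curve_speed A g \<gamma> t) * indicator {a..b} t"
  proof eventually_elim
    case (elim t)
    show ?case
    proof (cases "t \<in> {a..b}")
      case True
      hence "a < t" "t < b" using elim by auto
      from curve_speed_chart[OF C1 this c(1) Wc[OF True] v(2)[OF True]]
      have "norm (E t) \<le> K * curve_speed A g \<gamma> t"
        unfolding E_def using K(2)[OF W[OF True]] by simp
      thus ?thesis using K(1) True by (simp add: e_def ennreal_leI divide_le_eq mult.commute)
    qed (simp add: e_def)
  qed
  thus ?thesis using 2 me unfolding speed_minorant_def by blast
qed

text \<open>Induction over the breakpoints, with a final partial piece up to \<open>s\<close>. The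
  curve has to stay in \<open>W\<close> only until time \<open>s\<close>, which lets the estimate be
  used to show that a curve does not leave a set.\<close>

lemma piecewise_C1_estimate:
  fixes H :: "'m \<Rightarrow> 'b::euclidean_space" and tt :: "nat \<Rightarrow> real"
  assumes tt: "tt 0 = 0" "\<And>k. k < N \<Longrightarrow> tt k < tt (Suc k) \<and> C1_curve_on A \<gamma> (tt k) (tt (Suc k))"
    and c: "c \<in> A" "W \<subseteq> fst c"
    and H: "\<And>p. p \<in> W \<Longrightarrow> (H \<circ> chart_inv c has_derivative D p) (at (snd c p))"
    and contD: "\<And>v. continuous_on W (\<lambda>p. D p v)"
    and K: "K > 0" "\<And>p v. p \<in> W \<Longrightarrow> norm (D p v) \<le> K * sqrt (v \<bullet> (g c p *v v))"
    and k: "k \<le> N" and s: "s \<in> {0..tt k}" and W: "\<And>t. t \<in> {0..s} \<Longrightarrow> \<gamma> t \<in> W"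
  shows "\<exists>e. speed_minorant \<gamma> 0 s e \<and> ennreal (norm (H (\<gamma> s) - H (\<gamma> 0)) / K) \<le> (\<integral>\<^sup>+t. e t \<partial>lborel)"
  using k s W
proof (induction k arbitrary: s)
  case 0
  hence "s = 0" using tt by auto
  thus ?case by (intro exI[of _ "\<lambda>_. 0"]) (auto simp: speed_minorant_def)
next
  case (Suc k)
  show ?case
  proof (cases "s \<le> tt k")
    case True
    thus ?thesis using Suc.prems by (intro Suc.IH) auto
  next
    case False
    have mono: "0 \<le> tt j" if "j \<le> N" for j
      using that by (induction j) (use tt in \<open>auto intro: less_imp_le order_trans\<close>, metis Suc_le_lessD le_less less_imp_le order.trans tt(2))
    have k: "k < N" "0 \<le> tt k" using Suc.prems mono by auto
    have "\<exists>e. speed_minorant \<gamma> 0 (tt k) e \<and> ennreal (norm (H (\<gamma> (tt k)) - H (\<gamma> 0)) / K) \<le> (\<integral>\<^sup>+t. e t \<partial>lborel)"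
      using Suc.prems k False by (intro Suc.IH) auto
    then obtain e where e: "speed_minorant \<gamma> 0 (tt k) e"
      "ennreal (norm (H (\<gamma> (tt k)) - H (\<gamma> 0)) / K) \<le> (\<integral>\<^sup>+t. e t \<partial>lborel)" by blast
    have C1: "C1_curve_on A \<gamma> (tt k) s"
      using C1_curve_on_subinterval[of \<gamma> "tt k" "tt (Suc k)"] tt(2)[OF k(1)] Suc.prems by auto
    have "\<exists>e. speed_minorant \<gamma> (tt k) s e \<and> ennreal (norm (H (\<gamma> s) - H (\<gamma> (tt k))) / K) \<le> (\<integral>\<^sup>+t. e t \<partial>lborel)"
    proof (rule C1_curve_estimate[OF C1 _ c _ H contD K])
      show "tt k < s" using False by simp
      show "\<gamma> t \<in> W" if "t \<in> {tt k..s}" for t using that Suc.prems k by auto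
    qed
    then obtain f where f: "speed_minorant \<gamma> (tt k) s f"
      "ennreal (norm (H (\<gamma> s) - H (\<gamma> (tt k))) / K) \<le> (\<integral>\<^sup>+t. f t \<partial>lborel)" by blast
    have "speed_minorant \<gamma> 0 s (\<lambda>t. e t + f t)"
      using speed_minorant_add[OF e(1) f(1)] k False by simp
    moreover have "ennreal (norm (H (\<gamma> s) - H (\<gamma> 0)) / K) \<le> (\<integral>\<^sup>+t. e t + f t \<partial>lborel)"
    proof -
      have "norm (H (\<gamma> s) - H (\<gamma> 0)) \<le> norm (H (\<gamma> (tt k)) - H (\<gamma> 0)) + norm (H (\<gamma> s) - H (\<gamma> (tt k)))"
        by norm
      hence "norm (H (\<gamma> s) - H (\<gamma> 0)) / K \<le> norm (H (\<gamma> (tt k)) - H (\<gamma> 0)) / K + norm (H (\<gamma> s) - H (\<gamma> (tt k))) / K"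
        using K(1) by (simp add: field_simps)
      hence "ennreal (norm (H (\<gamma> s) - H (\<gamma> 0)) / K)
          \<le> ennreal (norm (H (\<gamma> (tt k)) - H (\<gamma> 0)) / K) + ennreal (norm (H (\<gamma> s) - H (\<gamma> (tt k))) / K)"
        using K(1) by (simp add: ennreal_leI flip: ennreal_plus)
      also have "\<dots> \<le> (\<integral>\<^sup>+t. e t \<partial>lborel) + (\<integral>\<^sup>+t. f t \<partial>lborel)"
        using e f by (intro add_mono)
      also have "\<dots> = (\<integral>\<^sup>+t. e t + f t \<partial>lborel)"
        using e f unfolding speed_minorant_def by (intro nn_integral_add[symmetric]) auto
      finally show ?thesis .
    qed
    ultimately show ?thesis by blast
  qed
qed

definition curve_length :: "(real \<Rightarrow> 'm) \<Rightarrow> ennreal" where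
  "curve_length \<gamma> = (\<integral>\<^sup>+t\<in>{0..1}. ennreal (curve_speed A g \<gamma> t) \<partial>lborel)"

text \<open>A mean value inequality in terms of length. It is applied with a coordinate map for
  \<open>H\<close> to confine curves, and with a real function to bound its growth.\<close>

lemma curve_estimate:
  fixes H :: "'m \<Rightarrow> 'b::euclidean_space"
  assumes \<gamma>: "piecewise_C1_curve A \<gamma>"
    and c: "c \<in> A" "W \<subseteq> fst c"
    and H: "\<And>p. p \<in> W \<Longrightarrow> (H \<circ> chart_inv c has_derivative D p) (at (snd c p))"
    and contD: "\<And>v. continuous_on W (\<lambda>p. D p v)"
    and K: "K > 0" "\<And>p v. p \<in> W \<Longrightarrow> norm (D p v) \<le> K * sqrt (v \<bullet> (g c p *v v))"
    and s: "s \<in> {0..1}" and W: "\<And>t. t \<in> {0..s} \<Longrightarrow> \<gamma> t \<in> W"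
    and len: "curve_length \<gamma> < ennreal r"
  shows "norm (H (\<gamma> s) - H (\<gamma> 0)) < K * r"
proof -
  obtain N :: nat and tt where tt: "tt 0 = 0" "tt N = 1"
    "\<And>k. k < N \<Longrightarrow> tt k < tt (Suc k) \<and> C1_curve_on A \<gamma> (tt k) (tt (Suc k))"
    using \<gamma> unfolding piecewise_C1_curve_def by blast
  have "\<exists>e. speed_minorant \<gamma> 0 s e \<and> ennreal (norm (H (\<gamma> s) - H (\<gamma> 0)) / K) \<le> (\<integral>\<^sup>+t. e t \<partial>lborel)"
    by (rule piecewise_C1_estimate[OF tt(1,3) c H contD K order_refl]) (use s tt W in auto)
  then obtain e where e: "speed_minorant \<gamma> 0 s e"
    "ennreal (norm (H (\<gamma> s) - H (\<gamma> 0)) / K) \<le> (\<integral>\<^sup>+t. e t \<partial>lborel)" by blast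
  note e(2)
  also have "(\<integral>\<^sup>+t. e t \<partial>lborel) \<le> (\<integral>\<^sup>+t\<in>{0..s}. ennreal (curve_speed A g \<gamma> t) \<partial>lborel)"
    using e(1) by (rule speed_minorant_le)
  also have "\<dots> \<le> curve_length \<gamma>"
    unfolding curve_length_def using s by (intro nn_integral_mono) (auto simp: indicator_def)
  also note len
  finally have "norm (H (\<gamma> s) - H (\<gamma> 0)) / K < r"
    using K(1) by (subst (asm) ennreal_less_iff) auto
  thus ?thesis using K(1) by (simp add: divide_less_eq mult.commute)
qed

lemma piecewise_C1_curve_continuous:
  assumes "piecewise_C1_curve A \<gamma>"
  shows "continuous_on {0..1} \<gamma>"
proof -
  obtain N :: nat and tt where tt: "tt 0 = 0" "tt N = 1"
    "\<And>k. k < N \<Longrightarrow> tt k < tt (Suc k) \<and> C1_curve_on A \<gamma> (tt k) (tt (Suc k))"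
    using assms unfolding piecewise_C1_curve_def by blast
  have "0 \<le> tt k \<and> continuous_on {0..tt k} \<gamma>" if "k \<le> N" for k
    using that
  proof (induction k)
    case 0 thus ?case using tt(1) by simp
  next
    case (Suc k)
    hence k: "0 \<le> tt k" "tt k < tt (Suc k)" "continuous_on {0..tt k} \<gamma>" "continuous_on {tt k..tt (Suc k)} \<gamma>"
      using tt(3)[of k] unfolding C1_curve_on_def by auto
    have "{0..tt (Suc k)} = {0..tt k} \<union> {tt k..tt (Suc k)}" using k by auto
    thus ?case using k continuous_on_closed_Un[of "{0..tt k}" "{tt k..tt (Suc k)}" \<gamma>] by auto
  qed
  from this[of N] tt show ?thesis by simp
qed

text \<open>On a compact coordinate ball the Euclidean norm is at most \<open>K\<close> times the
  Riemannian one. A curve starting within R/2 of the centre and shorter than R / (2 K) therefore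
  cannot reach distance R.\<close>

lemma short_curves_stay:
  assumes U: "open U" "p0 \<in> U"
  obtains V r where "open V" "p0 \<in> V" "r > 0"
    "\<And>\<gamma> t. piecewise_C1_curve A \<gamma> \<Longrightarrow> \<gamma> 0 \<in> V \<Longrightarrow> curve_length \<gamma> < ennreal r \<Longrightarrow> t \<in> {0..1} \<Longrightarrow> \<gamma> t \<in> U"
proof -
  obtain c where c: "c \<in> A" "p0 \<in> fst c" using chart_cover by blast
  let ?x = "snd c"
  have "open (?x ` (fst c \<inter> U))" using open_snd_image[OF c(1) U(1)] .
  then obtain R where R: "R > 0" "cball (?x p0) R \<subseteq> ?x ` (fst c \<inter> U)"
    using open_contains_cball c U by (metis IntI imageI)
  define B where "B = chart_inv c ` cball (?x p0) R"
  have Bsub: "B \<subseteq> fst c \<inter> U" unfolding B_def using R c by fastforce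
  have contB: "continuous_on (cball (?x p0) R) (chart_inv c)"
    using continuous_on_subset[OF continuous_chart_inv[OF c(1)]] R by blast
  have cB: "compact B" unfolding B_def by (rule compact_continuous_image[OF contB compact_cball])
  \<comment> \<open>The trace of the inverse metric: by \<open>q_Cauchy_Schwarz\<close> for the
    coordinate covectors, \<open>S p\<close> bounds the ratio of the squared Euclidean norm to the
    squared Riemannian norm.\<close>
  define S where "S p = (\<Sum>i\<in>UNIV. q c p (axis i 1))" for p
  have "continuous_on B S"
    unfolding S_def using Bsub by (intro continuous_on_sum continuous_q[OF c(1)] continuous_on_const) auto
  hence "compact (S ` B)" using cB by (rule compact_continuous_image)
  then obtain M where M: "\<And>p. p \<in> B \<Longrightarrow> norm (S p) \<le> M"
    using compact_imp_bounded bounded_iff by (metis imageI)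
  define K where "K = sqrt (\<bar>M\<bar> + 1)"
  have K: "K > 0" unfolding K_def by simp
  have bound: "norm v \<le> K * sqrt (v \<bullet> (g c p *v v))" if p: "p \<in> B" for p v
  proof -
    have pc: "p \<in> fst c" using p Bsub by blast
    have "(norm v)\<^sup>2 = (\<Sum>i\<in>UNIV. (axis i 1 \<bullet> v)\<^sup>2)"
      by (simp add: norm_vec_def L2_set_def sum_nonneg inner_axis')
    also have "\<dots> \<le> (\<Sum>i\<in>UNIV. q c p (axis i 1) * (v \<bullet> (g c p *v v)))"
      by (intro sum_mono q_Cauchy_Schwarz[OF c(1) pc])
    also have "\<dots> = S p * (v \<bullet> (g c p *v v))" by (simp add: S_def sum_distrib_right)
    also have "\<dots> \<le> (\<bar>M\<bar> + 1) * (v \<bullet> (g c p *v v))"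
      using M[OF p] metric_nonneg[OF c(1) pc] by (intro mult_right_mono) auto
    finally have "sqrt ((norm v)\<^sup>2) \<le> sqrt ((\<bar>M\<bar> + 1) * (v \<bullet> (g c p *v v)))" by (rule real_sqrt_le_mono)
    thus ?thesis by (simp add: K_def real_sqrt_mult)
  qed
  define V where "V = fst c \<inter> ?x -` ball (?x p0) (R/2)"
  define W where "W = fst c \<inter> ?x -` ball (?x p0) R"
  have openVW: "open V" "open W"
    unfolding V_def W_def using continuous_open_preimage[OF continuous_snd[OF c(1)] chart_open(1)[OF c(1)]] by auto
  have WB: "W \<subseteq> B"
  proof
    fix p assume "p \<in> W"
    hence "p = chart_inv c (?x p)" "?x p \<in> cball (?x p0) R" using c by (auto simp: W_def)
    thus "p \<in> B" unfolding B_def by blast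
  qed
  show thesis
  proof (rule that[of V "R / (2 * K)"])
    show "open V" "p0 \<in> V" "R / (2 * K) > 0" using openVW R c K by (auto simp: V_def)
    fix \<gamma> s assume \<gamma>: "piecewise_C1_curve A \<gamma>" "\<gamma> 0 \<in> V" "curve_length \<gamma> < ennreal (R / (2 * K))" "s \<in> {0..1::real}"
    \<comment> \<open>A length bound strictly between leaves room for the closed set
      \<open>C\<close> inside the open set \<open>W\<close>.\<close>
    obtain l where l: "0 \<le> l" "curve_length \<gamma> < ennreal l" "l < R / (2 * K)"
    proof -
      obtain y where y: "curve_length \<gamma> < y" "y < ennreal (R / (2 * K))" using dense[OF \<gamma>(3)] by blast
      show thesis
      proof (rule that[of "enn2real y"])
        have "y < top" using y(2) by (rule less_trans) simp
        thus "curve_length \<gamma> < ennreal (enn2real y)" using y by simp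
        show "enn2real y < R / (2 * K)"
          using y(2) \<open>y < top\<close> R K by (metis enn2real_nonneg ennreal_enn2real ennreal_less_iff)
      qed simp
    qed
    have ct: "continuous_on {0..1} \<gamma>" using piecewise_C1_curve_continuous[OF \<gamma>(1)] .
    define C where "C = chart_inv c ` cball (?x p0) (dist (?x p0) (?x (\<gamma> 0)) + K * l)"
    have lt: "dist (?x p0) (?x (\<gamma> 0)) + K * l < R"
    proof -
      have "K * l < R / 2" using l(3) K by (simp add: field_simps)
      thus ?thesis using \<gamma>(2) by (auto simp: V_def)
    qed
    have CW: "C \<subseteq> W"
    proof
      fix p assume "p \<in> C"
      then obtain x where x: "p = chart_inv c x" "dist (?x p0) x \<le> dist (?x p0) (?x (\<gamma> 0)) + K * l"
        by (auto simp: C_def)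
      hence "x \<in> cball (?x p0) R" "dist (?x p0) x < R" using lt by auto
      moreover have "x \<in> ?x ` fst c" using calculation(1) R(2) by blast
      ultimately show "p \<in> W" using chart_inv_in[OF c(1)] snd_chart_inv[OF c(1)] x(1) by (auto simp: W_def)
    qed
    have closedC: "closed C"
      unfolding C_def using lt
      by (intro compact_imp_closed compact_continuous_image continuous_on_subset[OF contB]) (auto simp: subset_iff)
    have inC: "\<gamma> s \<in> C" if s: "s \<in> {0..1}" "\<And>t. t \<in> {0..s} \<Longrightarrow> \<gamma> t \<in> W" for s
    proof -
      have "norm (?x (\<gamma> s) - ?x (\<gamma> 0)) < K * l"
      proof (rule curve_estimate[where H = "?x" and W = W and c = c and D = "\<lambda>p v. v"])
        show "(?x \<circ> chart_inv c has_derivative (\<lambda>v. v)) (at (?x p))" if "p \<in> W" for p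
        proof (rule has_derivative_transform_within_open[OF has_derivative_ident chart_open(2)[OF c(1)]])
          show "?x p \<in> ?x ` fst c" using that by (auto simp: W_def)
          show "x = (?x \<circ> chart_inv c) x" if "x \<in> ?x ` fst c" for x
            using snd_chart_inv[OF c(1) that] by simp
        qed
      qed (use \<gamma> c K l bound WB s in \<open>auto simp: W_def intro: continuous_on_const\<close>)
      hence "dist (?x (\<gamma> 0)) (?x (\<gamma> s)) \<le> K * l" by (simp add: dist_norm norm_minus_commute)
      hence "?x (\<gamma> s) \<in> cball (?x p0) (dist (?x p0) (?x (\<gamma> 0)) + K * l)"
        using dist_triangle[of "?x p0" "?x (\<gamma> s)" "?x (\<gamma> 0)"] by simp
      moreover have "\<gamma> s \<in> W" using s by auto
      hence "\<gamma> s = chart_inv c (?x (\<gamma> s))" using c by (auto simp: W_def)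
      ultimately show ?thesis unfolding C_def by blast
    qed
    have "\<gamma> t \<in> W" if "t \<in> {0..1}" for t
    proof (rule ccontr)
      assume nW: "\<gamma> t \<notin> W"
      \<comment> \<open>\<open>Inf T\<close> is the first exit time from \<open>W\<close>. Before it
        the curve lies in \<open>C\<close>; as \<open>C\<close> is closed, so does the exit point,
        although \<open>C\<close> is contained in \<open>W\<close>.\<close>
      define T where "T = {0..1} \<inter> \<gamma> -` (- W)"
      have "closed T" unfolding T_def using ct openVW(2) by (intro continuous_closed_preimage) auto
      moreover have "T \<noteq> {}" "bdd_below T" using nW that by (auto simp: T_def bdd_below_def)
      ultimately have Inf: "Inf T \<in> T" by (intro closed_contains_Inf)
      hence T01: "Inf T \<in> {0..1}" and TW: "\<gamma> (Inf T) \<notin> W" by (auto simp: T_def)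
      have before: "\<gamma> s \<in> W" if "0 \<le> s" "s < Inf T" for s
      proof (rule ccontr)
        assume "\<gamma> s \<notin> W"
        hence "s \<in> T" using that T01 by (auto simp: T_def)
        thus False using cInf_lower[OF _ \<open>bdd_below T\<close>, of s] that by simp
      qed
      have "\<gamma> 0 \<in> W" using \<gamma>(2) R by (auto simp: V_def W_def)
      hence pos: "0 < Inf T" using TW T01 by (metis atLeastAtMost_iff less_eq_real_def)
      have "{0..<Inf T} \<subseteq> {0..1} \<inter> \<gamma> -` C"
        using inC before T01 by auto
      moreover have "closed ({0..1} \<inter> \<gamma> -` C)"
        using ct closedC by (intro continuous_closed_preimage) auto
      ultimately have "closure {0..<Inf T} \<subseteq> {0..1} \<inter> \<gamma> -` C" by (rule closure_minimal)
      moreover have "Inf T \<in> closure {0..<Inf T}" using pos by (simp add: closure_atLeastLessThan)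
      ultimately have "\<gamma> (Inf T) \<in> C" by blast
      thus False using CW TW by blast
    qed
    hence "\<gamma> s \<in> W" using \<gamma>(4) by blast
    thus "\<gamma> s \<in> U" using WB Bsub by blast
  qed
qed

text \<open>Near each point \<open>N\<close> is almost constant and short curves stay near, so the
  mean value inequality applies with an almost optimal constant. Compactness makes the admissible
  length uniform in the starting point.\<close>

lemma uniform_increment_bound:
  fixes F N :: "'m \<Rightarrow> real"
  assumes F: "\<And>c p. c \<in> A \<Longrightarrow> p \<in> fst c \<Longrightarrow> (F \<circ> chart_inv c has_derivative D c p) (at (snd c p))"
    and contD: "\<And>c v. c \<in> A \<Longrightarrow> continuous_on (fst c) (\<lambda>p. D c p v)"
    and N: "continuous_on UNIV N" "\<And>p. N p \<ge> 0"
    and bound: "\<And>c p v. c \<in> A \<Longrightarrow> p \<in> fst c \<Longrightarrow> \<bar>D c p v\<bar> \<le> N p * sqrt (v \<bullet> (g c p *v v))"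
    and \<epsilon>: "\<epsilon> > 0"
  obtains r0 where "r0 > 0"
    "\<And>\<gamma> r. piecewise_C1_curve A \<gamma> \<Longrightarrow> r \<le> r0 \<Longrightarrow> curve_length \<gamma> < ennreal r \<Longrightarrow>
        F (\<gamma> 1) < F (\<gamma> 0) + r * (N (\<gamma> 0) + \<epsilon>)"
proof -
  define good where "good V \<rho> \<longleftrightarrow> open V \<and> \<rho> > 0 \<and>
      (\<forall>\<gamma> r. piecewise_C1_curve A \<gamma> \<longrightarrow> \<gamma> 0 \<in> V \<longrightarrow> r \<le> \<rho> \<longrightarrow> curve_length \<gamma> < ennreal r \<longrightarrow>
        F (\<gamma> 1) < F (\<gamma> 0) + r * (N (\<gamma> 0) + \<epsilon>))" for V \<rho>
  have "\<exists>V \<rho>. p0 \<in> V \<and> good V \<rho>" for p0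
  proof -
    obtain c where c: "c \<in> A" "p0 \<in> fst c" using chart_cover by blast
    \<comment> \<open>One third of \<epsilon> pays for the bound on \<open>N\<close> along the
      curve, another for replacing \<open>N p0\<close> by the value of \<open>N\<close> at the start
      of the curve.\<close>
    define U where "U = fst c \<inter> N -` {N p0 - \<epsilon>/3 <..< N p0 + \<epsilon>/3}"
    have "open U" unfolding U_def
      by (rule continuous_open_preimage[OF continuous_on_subset[OF N(1)]]) (use chart_open(1)[OF c(1)] in auto)
    moreover have "p0 \<in> U" using c \<epsilon> by (auto simp: U_def)
    ultimately obtain V \<rho> where V: "open V" "p0 \<in> V" "\<rho> > 0"
      "\<And>\<gamma> t. piecewise_C1_curve A \<gamma> \<Longrightarrow> \<gamma> 0 \<in> V \<Longrightarrow> curve_length \<gamma> < ennreal \<rho> \<Longrightarrow> t \<in> {0..1} \<Longrightarrow> \<gamma> t \<in> U"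
      using short_curves_stay by metis
    have "good V \<rho>"
      unfolding good_def
    proof (intro conjI allI impI V)
      fix \<gamma> r assume \<gamma>: "piecewise_C1_curve A \<gamma>" "\<gamma> 0 \<in> V" "r \<le> \<rho>" "curve_length \<gamma> < ennreal r"
      have "curve_length \<gamma> < ennreal \<rho>" using \<gamma>(3,4) by (meson ennreal_leI less_le_trans)
      hence inU: "\<gamma> t \<in> U" if "t \<in> {0..1}" for t using V(4) \<gamma> that by blast
      have r: "r > 0" using \<gamma>(4) by (metis ennreal_less_zero_iff not_gr_zero not_less_zero order.strict_trans2 zero_le)
      have "norm (F (\<gamma> 1) - F (\<gamma> 0)) < (N p0 + \<epsilon>/3) * r"
      proof (rule curve_estimate[where W = U and c = c and D = "D c"])
        show "N p0 + \<epsilon>/3 > 0" using N(2)[of p0] \<epsilon> by simp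
        show "continuous_on U (\<lambda>p. D c p v)" for v
          by (rule continuous_on_subset[OF contD[OF c(1)]]) (auto simp: U_def)
        show "norm (D c p v) \<le> (N p0 + \<epsilon>/3) * sqrt (v \<bullet> (g c p *v v))" if "p \<in> U" for p v
        proof -
          have p: "p \<in> fst c" "N p \<le> N p0 + \<epsilon>/3" using that by (auto simp: U_def)
          have "norm (D c p v) \<le> N p * sqrt (v \<bullet> (g c p *v v))" using bound[OF c(1) p(1)] by simp
          also have "\<dots> \<le> (N p0 + \<epsilon>/3) * sqrt (v \<bullet> (g c p *v v))"
            using p metric_nonneg[OF c(1) p(1)] by (intro mult_right_mono) auto
          finally show ?thesis .
        qed
      qed (use \<gamma> c F inU in \<open>auto simp: U_def\<close>)
      also have "(N p0 + \<epsilon>/3) * r \<le> r * (N (\<gamma> 0) + \<epsilon>)"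
        using inU[of 0] r \<epsilon> by (subst mult.commute) (auto simp: U_def intro!: mult_left_mono)
      finally show "F (\<gamma> 1) < F (\<gamma> 0) + r * (N (\<gamma> 0) + \<epsilon>)" by simp
    qed
    thus ?thesis using V(2) by blast
  qed
  then obtain V \<rho> where V: "\<And>p. p \<in> V p" "\<And>p. good (V p) (\<rho> p)" by metis
  have opV: "\<And>p. open (V p)" using V(2) good_def by blast
  obtain C where C: "finite C" "UNIV \<subseteq> (\<Union>p\<in>C. V p)"
    using compactE_image[OF compact_UNIV, of UNIV V] opV V(1) by (metis UNIV_I UN_I subsetI)
  have ne: "C \<noteq> {}" using C by auto
  show thesis
  proof (rule that[of "Min (\<rho> ` C)"])
    show "Min (\<rho> ` C) > 0" using C ne V(2) by (auto simp: good_def)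
    fix \<gamma> r assume \<gamma>: "piecewise_C1_curve A \<gamma>" "r \<le> Min (\<rho> ` C)" "curve_length \<gamma> < ennreal r"
    obtain p where p: "p \<in> C" "\<gamma> 0 \<in> V p" using C by blast
    have "r \<le> \<rho> p" using \<gamma>(2) C p by (auto simp: ne)
    thus "F (\<gamma> 1) < F (\<gamma> 0) + r * (N (\<gamma> 0) + \<epsilon>)" using V(2)[of p] \<gamma> p unfolding good_def by blast
  qed
qed

text \<open>The connecting curve is traversed from the point of the neighbourhood to the set. The
  increment is then governed by \<open>h\<close> at that point, so the neighbourhood lies in a
  superlevel set of \<open>F + h\<close>.\<close>

lemma open_nbhd_superlevel:
  fixes F N :: "'m \<Rightarrow> real"
  assumes r: "r > 0" and inc: "\<And>\<gamma>. piecewise_C1_curve A \<gamma> \<Longrightarrow> curve_length \<gamma> < ennreal r \<Longrightarrow> F (\<gamma> 1) < F (\<gamma> 0) + h (\<gamma> 0)"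
  shows "open_nbhd A g {p. F p > t} r \<subseteq> {p. F p + h p > t}"
proof
  fix p assume "p \<in> open_nbhd A g {p. F p > t} r"
  then obtain q where q: "F q > t" "riemannian_dist A g p q < ennreal r"
    unfolding open_nbhd_def by blast
  then obtain \<gamma> where "piecewise_C1_curve A \<gamma>" "\<gamma> 0 = p" "\<gamma> 1 = q" "curve_length \<gamma> < ennreal r"
    unfolding riemannian_dist_def INF_less_iff curve_length_def by blast
  thus "p \<in> {p. F p + h p > t}" using inc[of \<gamma>] q by auto
qed

end

section \<open>Polar decomposition of a smooth function\<close>

text \<open>Differentiating |T| = 1 shows that \<open>cnj (T x) * T' v\<close> is imaginary, and
  differentiating Im (cnj T * F) = 0 determines its imaginary part. \<open>T\<close> is any
  unit-valued phase near the point, so that an arbitrarily selected extension is covered.\<close>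

lemma derivative_of_phase:
  fixes T F :: "'a::real_normed_vector \<Rightarrow> complex"
  assumes S: "open S" "x \<in> S" and T: "(T has_derivative T') (at x)" and F: "(F has_derivative F') (at x)"
    and unit: "\<And>y. y \<in> S \<Longrightarrow> cmod (T y) = 1" and phase: "\<And>y. y \<in> S \<Longrightarrow> F y = cmod (F y) *\<^sub>R T y"
    and nz: "F x \<noteq> 0"
  shows "T' v = T x * \<i> * complex_of_real (Im (cnj (F x) * F' v) / (cmod (F x))\<^sup>2)"
proof -
  let ?n = "cmod (F x)"
  have n: "?n > 0" using nz by simp
  have const: "D v = 0" if D: "(h has_derivative D) (at x)" and h: "\<And>y. y \<in> S \<Longrightarrow> h y = k" for h :: "'a \<Rightarrow> real" and D k
  proof -
    have "((\<lambda>y. k) has_derivative D) (at x)"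
      by (rule has_derivative_transform_within_open[OF D S]) (rule h)
    hence "D = (\<lambda>_. 0)" using has_derivative_const by (rule has_derivative_unique)
    thus ?thesis by simp
  qed
  have "((\<lambda>y. Re (cnj (T y) * T y)) has_derivative (\<lambda>v. Re (cnj (T x) * T' v + cnj (T' v) * T x))) (at x)"
    by (intro derivative_intros bounded_linear.has_derivative[OF bounded_linear_Re] has_derivative_mult
        bounded_linear.has_derivative[OF bounded_linear_cnj] T)
  moreover have "Re (cnj (T y) * T y) = 1" if "y \<in> S" for y
    using unit[OF that] by (simp add: complex_norm_square[symmetric] mult.commute flip: of_real_power)
  ultimately have "Re (cnj (T x) * T' v + cnj (T' v) * T x) = 0" by (rule const)
  hence 1: "Re (cnj (T x) * T' v) = 0" by (simp add: algebra_simps)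
  have "((\<lambda>y. Im (cnj (T y) * F y)) has_derivative (\<lambda>v. Im (cnj (T x) * F' v + cnj (T' v) * F x))) (at x)"
    by (intro derivative_intros bounded_linear.has_derivative[OF bounded_linear_Im] has_derivative_mult
        bounded_linear.has_derivative[OF bounded_linear_cnj] T F)
  moreover have "Im (cnj (T y) * F y) = 0" if "y \<in> S" for y
    by (subst phase[OF that]) (simp add: algebra_simps)
  ultimately have "Im (cnj (T x) * F' v + cnj (T' v) * F x) = 0" by (rule const)
  hence 2: "Im (cnj (T x) * F' v) = ?n * Im (cnj (T x) * T' v)"
    by (subst (asm) phase[OF S(2)]) (simp add: algebra_simps)
  have cF: "cnj (F x) = of_real ?n * cnj (T x)"
    by (subst phase[OF S(2)]) (simp add: scaleR_conv_of_real)
  have "Im (cnj (F x) * F' v) = ?n * Im (cnj (T x) * F' v)"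
    unfolding cF by (simp add: algebra_simps)
  hence "Im (cnj (F x) * F' v) / ?n\<^sup>2 = Im (cnj (T x) * T' v)"
    using n unfolding 2 by (simp add: power2_eq_square)
  moreover have "cnj (T x) * T' v = \<i> * of_real (Im (cnj (T x) * T' v))"
    using 1 by (simp add: complex_eq_iff)
  moreover have "T' v = T x * (cnj (T x) * T' v)"
    using unit[OF S(2)] by (simp add: complex_norm_square[symmetric] mult.assoc[symmetric] flip: of_real_power)
  ultimately show ?thesis by (simp add: mult.assoc)
qed

lemma smooth_map_on_subset: "smooth_map_on S f \<Longrightarrow> T \<subseteq> S \<Longrightarrow> smooth_map_on T f"
  unfolding smooth_map_on_def using C_on_subset by blast

locale magnetic_function = riemannian_manifold A g
  for A :: "('m::{t2_space, second_countable_topology}, 'n::finite) chart set"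
    and g :: "('m, 'n) chart \<Rightarrow> 'm \<Rightarrow> real ^ 'n ^ 'n" +
  fixes \<alpha> :: "('m, 'n) chart \<Rightarrow> 'm \<Rightarrow> real ^ 'n" and f :: "'m \<Rightarrow> complex"
  assumes smooth_form: "smooth_one_form A \<alpha>" and smooth_f: "smooth_fun A f"
begin

definition fd :: "('m, 'n) chart \<Rightarrow> 'm \<Rightarrow> real^'n \<Rightarrow> complex" where
  "fd c p = frechet_derivative (f \<circ> chart_inv c) (at (snd c p))"

abbreviation Df :: "('m, 'n) chart \<Rightarrow> 'm \<Rightarrow> complex ^ 'n" where "Df \<equiv> magnetic_D \<alpha> f"

lemma Df_component: "Df c p $ i = fd c p (axis i 1) + \<i> * complex_of_real (\<alpha> c p $ i) * f p"
  by (simp add: magnetic_D_def fd_def)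

lemma f_smooth_chart: "c \<in> A \<Longrightarrow> smooth_map_on (snd c ` fst c) (f \<circ> chart_inv c)"
  using smooth_f unfolding smooth_fun_def smooth_on_open_def by simp

lemma fd_derivative: "c \<in> A \<Longrightarrow> p \<in> fst c \<Longrightarrow> (f \<circ> chart_inv c has_derivative fd c p) (at (snd c p))"
  unfolding fd_def using smooth_map_on_imp(2)[OF f_smooth_chart chart_open(2)] by blast

lemma fd_continuous: "c \<in> A \<Longrightarrow> continuous_on (fst c) (\<lambda>p. fd c p v)"
  by (rule continuous_on_chart[OF _ order_refl], assumption,
      rule continuous_on_eq[OF smooth_map_on_imp(3)[OF f_smooth_chart chart_open(2), of c v]])
    (auto simp: fd_def)

lemma f_continuous: "continuous_on UNIV f"
proof (rule continuous_on_UNIV_charts)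
  fix c assume c: "c \<in> A"
  show "continuous_on (fst c) f"
    by (rule continuous_on_chart[OF c order_refl smooth_map_on_imp(1)[OF f_smooth_chart chart_open(2)]]) (fact c)+
qed

lemma \<alpha>_continuous: "c \<in> A \<Longrightarrow> continuous_on (fst c) (\<alpha> c)"
  using smooth_form chart_open(2) unfolding smooth_one_form_def
  by (intro continuous_on_chart[OF _ order_refl] smooth_map_on_imp(1)) auto

lemma continuous_Df: "c \<in> A \<Longrightarrow> continuous_on (fst c) (Df c)"
  using fd_continuous[of c] \<alpha>_continuous[of c] continuous_on_subset[OF f_continuous subset_UNIV, of "fst c"]
  unfolding magnetic_D_def fd_def[symmetric]
  by (intro continuous_on_vec_lambda continuous_intros) auto

lemma Df_transform:
  assumes cd: "c \<in> A" "d \<in> A" "p \<in> fst c" "p \<in> fst d"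
  shows "Df c p $ i = (\<Sum>j\<in>UNIV. (jacobian c d p $ j $ i) *\<^sub>R (Df d p $ j))"
proof -
  let ?J = "jacobian c d p"
  have "fd c p = (\<lambda>v. fd d p (?J *v v))"
    using chart_derivative_transform[OF cd fd_derivative[OF cd(2,4)]] fd_derivative[OF cd(1,3)]
    by (rule has_derivative_unique[rotated])
  hence "fd c p (axis i 1) = fd d p (?J *v axis i 1)" by simp
  also have "\<dots> = (\<Sum>j\<in>UNIV. ((?J *v axis i 1) $ j) *\<^sub>R fd d p (axis j 1))"
    by (rule linear_vec_expand[OF has_derivative_linear[OF fd_derivative[OF cd(2,4)]]])
  also have "\<dots> = (\<Sum>j\<in>UNIV. (?J $ j $ i) *\<^sub>R fd d p (axis j 1))"
    by (simp add: matrix_vector_mult_basis column_def)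
  finally have 1: "fd c p (axis i 1) = (\<Sum>j\<in>UNIV. (?J $ j $ i) *\<^sub>R fd d p (axis j 1))" .
  have "\<alpha> c p = (\<chi> i. \<Sum>j\<in>UNIV. (?J $ j $ i) *\<^sub>R (\<alpha> d p $ j))"
    using smooth_form cd unfolding smooth_one_form_def by blast
  hence 2: "\<alpha> c p $ i = (\<Sum>j\<in>UNIV. (?J $ j $ i) * (\<alpha> d p $ j))" by simp
  show ?thesis
    unfolding Df_component 1 2
    by (simp add: scaleR_add_right sum.distrib sum_distrib_left sum_distrib_right scaleR_conv_of_real
        distrib_left mult_ac)
qed

lemma covariant_Df: "covariant A Df"
  unfolding covariant_def vec_eq_iff using Df_transform by simp

text \<open>Writing \<open>f = \<rho> \<tau>\<close> in polar form, these are \<open>\<rho> d\<rho>\<close> and \<open>\<rho>\<^sup>2 (d + i \<alpha>) \<tau> / (i \<tau>)\<close>.\<close>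

definition radial_part :: "('m, 'n) chart \<Rightarrow> 'm \<Rightarrow> complex ^ 'n" where
  "radial_part c p = (\<chi> i. complex_of_real (Re (cnj (f p) * Df c p $ i)))"

definition phase_part :: "('m, 'n) chart \<Rightarrow> 'm \<Rightarrow> complex ^ 'n" where
  "phase_part c p = (\<chi> i. complex_of_real (Im (cnj (f p) * Df c p $ i)))"

lemma covariant_parts: "covariant A radial_part" "covariant A phase_part"
proof -
  have 1: "cnj (f p) * Df c p $ i = (\<Sum>j\<in>UNIV. (jacobian c d p $ j $ i) *\<^sub>R (cnj (f p) * Df d p $ j))"
    if "c \<in> A" "d \<in> A" "p \<in> fst c" "p \<in> fst d" for c d p i
    by (simp add: Df_transform[OF that] sum_distrib_left)
  have "radial_part c p $ i = (\<Sum>j\<in>UNIV. (jacobian c d p $ j $ i) *\<^sub>R radial_part d p $ j)"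
    "phase_part c p $ i = (\<Sum>j\<in>UNIV. (jacobian c d p $ j $ i) *\<^sub>R phase_part d p $ j)"
    if "c \<in> A" "d \<in> A" "p \<in> fst c" "p \<in> fst d" for c d p i
    unfolding radial_part_def phase_part_def vec_lambda_beta 1[OF that]
    by (simp_all add: scaleR_conv_of_real)
  thus "covariant A radial_part" "covariant A phase_part"
    unfolding covariant_def by (simp_all add: vec_eq_iff)
qed

lemma continuous_parts:
  "c \<in> A \<Longrightarrow> continuous_on (fst c) (radial_part c)" "c \<in> A \<Longrightarrow> continuous_on (fst c) (phase_part c)"
  unfolding radial_part_def phase_part_def
  using continuous_Df[of c] continuous_on_subset[OF f_continuous subset_UNIV, of "fst c"]
  by (auto intro!: continuous_on_vec_lambda continuous_intros)

definition norm_sq :: "'m \<Rightarrow> real" where "norm_sq p = (cmod (f p))\<^sup>2"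
definition radial_norm :: "'m \<Rightarrow> real" where "radial_norm = form_norm A g radial_part"
definition phase_norm :: "'m \<Rightarrow> real" where "phase_norm = form_norm A g phase_part"
definition D_norm :: "'m \<Rightarrow> real" where "D_norm = form_norm A g Df"

lemma continuous_norm_sq: "continuous_on UNIV norm_sq"
  unfolding norm_sq_def using f_continuous by (intro continuous_intros)

lemma continuous_norms: "continuous_on UNIV radial_norm" "continuous_on UNIV phase_norm" "continuous_on UNIV D_norm"
  unfolding radial_norm_def phase_norm_def D_norm_def
  using continuous_form_norm covariant_parts continuous_parts covariant_Df continuous_Df by blast+

lemma Re_Im_vec_parts [simp]:
  "Im_vec (radial_part c p) = 0" "Im_vec (phase_part c p) = 0"
  "Re_vec (radial_part c p) = Re (f p) *\<^sub>R Re_vec (Df c p) + Im (f p) *\<^sub>R Im_vec (Df c p)"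
  "Re_vec (phase_part c p) = Re (f p) *\<^sub>R Im_vec (Df c p) - Im (f p) *\<^sub>R Re_vec (Df c p)"
  by (simp_all add: Im_vec_def Re_vec_def radial_part_def phase_part_def vec_eq_iff)

lemma q_zero [simp]: "q c p 0 = 0" by (simp add: q_def)

lemma norms_chart:
  assumes "c \<in> A" "p \<in> fst c"
  shows "radial_norm p = sqrt (q c p (Re_vec (radial_part c p)))" "phase_norm p = sqrt (q c p (Re_vec (phase_part c p)))"
    "D_norm p = sqrt (q c p (Re_vec (Df c p)) + q c p (Im_vec (Df c p)))"
  unfolding radial_norm_def phase_norm_def D_norm_def
  using form_norm_chart[OF covariant_parts(1) assms] form_norm_chart[OF covariant_parts(2) assms]
    form_norm_chart[OF covariant_Df assms] by (simp_all del: Re_Im_vec_parts(3,4))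

lemma norms_nonneg: "radial_norm p \<ge> 0" "phase_norm p \<ge> 0" "D_norm p \<ge> 0"
  using norms_chart[OF chart_at_in, of p] q_nonneg[OF chart_at_in] by (simp_all del: Re_Im_vec_parts)

text \<open>The two parts are the real and imaginary parts of \<open>cnj f * Df\<close>, and
  multiplication by \<open>cnj f\<close> scales the length of the complex covector \<open>Df\<close>
  by |f|.\<close>

lemma pythagoras: "(radial_norm p)\<^sup>2 + (phase_norm p)\<^sup>2 = norm_sq p * (D_norm p)\<^sup>2"
proof -
  obtain c where c: "c \<in> A" "p \<in> fst c" using chart_cover by blast
  let ?u = "Re_vec (Df c p)" and ?v = "Im_vec (Df c p)" and ?x = "Re (f p)" and ?y = "Im (f p)"
  have "q c p (?x *\<^sub>R ?u + ?y *\<^sub>R ?v) + q c p (?x *\<^sub>R ?v - ?y *\<^sub>R ?u) = (?x\<^sup>2 + ?y\<^sup>2) * (q c p ?u + q c p ?v)"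
    by (simp add: q_def matrix_vector_right_distrib matrix_vector_mult_diff_distrib matrix_vector_mult_scaleR
        inner_add_left inner_add_right inner_diff_left inner_diff_right power2_eq_square algebra_simps)
  thus ?thesis
    unfolding norms_chart[OF c] norm_sq_def cmod_power2
    using q_nonneg[OF c] by simp
qed

text \<open>The Cauchy-Schwarz inequality in the plane against the vector (1, 2), whose defect is
  the square of \<open>2 * phase_norm p - radial_norm p\<close>. The weight 2 is that of
  \<open>d\<rho>\<^sup>2 = 2 \<rho> d\<rho>\<close>.\<close>

lemma parts_bound: "phase_norm p + 2 * radial_norm p \<le> sqrt 5 * (cmod (f p) * D_norm p)"
proof -
  have "(phase_norm p + 2 * radial_norm p)\<^sup>2 + (2 * phase_norm p - radial_norm p)\<^sup>2 = 5 * ((radial_norm p)\<^sup>2 + (phase_norm p)\<^sup>2)"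
    by (simp add: power2_eq_square algebra_simps)
  hence "(phase_norm p + 2 * radial_norm p)\<^sup>2 \<le> 5 * ((radial_norm p)\<^sup>2 + (phase_norm p)\<^sup>2)" 
    using zero_le_power2[of "2 * phase_norm p - radial_norm p"] by linarith
  also have "\<dots> = (sqrt 5 * (cmod (f p) * D_norm p))\<^sup>2"
    by (simp add: pythagoras norm_sq_def power_mult_distrib)
  finally show ?thesis
    by (rule power2_le_imp_le) (simp add: norms_nonneg)
qed

definition dF :: "('m, 'n) chart \<Rightarrow> 'm \<Rightarrow> real^'n \<Rightarrow> real" where
  "dF c p v = 2 * Re (cnj (f p) * fd c p v)"

lemma norm_sq_derivative:
  assumes "c \<in> A" "p \<in> fst c"
  shows "(norm_sq \<circ> chart_inv c has_derivative dF c p) (at (snd c p))"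
proof -
  have "((\<lambda>x. (f \<circ> chart_inv c) x \<bullet> (f \<circ> chart_inv c) x) has_derivative
      (\<lambda>v. (f \<circ> chart_inv c) (snd c p) \<bullet> fd c p v + fd c p v \<bullet> (f \<circ> chart_inv c) (snd c p))) (at (snd c p))"
    by (intro has_derivative_inner fd_derivative assms)
  moreover have "(\<lambda>x. (f \<circ> chart_inv c) x \<bullet> (f \<circ> chart_inv c) x) = norm_sq \<circ> chart_inv c"
    by (auto simp: norm_sq_def dot_square_norm)
  moreover have "(\<lambda>v. (f \<circ> chart_inv c) (snd c p) \<bullet> fd c p v + fd c p v \<bullet> (f \<circ> chart_inv c) (snd c p)) = dF c p"
    using assms by (auto simp: dF_def inner_complex_def algebra_simps)
  ultimately show ?thesis by simp
qed

lemma dF_continuous: "c \<in> A \<Longrightarrow> continuous_on (fst c) (\<lambda>p. dF c p v)"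
  unfolding dF_def using fd_continuous continuous_on_subset[OF f_continuous subset_UNIV, of "fst c"]
  by (intro continuous_intros) auto

text \<open>The potential drops out: it contributes i \<alpha> |f|^2 to \<open>cnj f * Df\<close>,
  which is imaginary. Hence the differential of \<open>norm_sq\<close> is twice the radial part, and
  \<open>q_Cauchy_Schwarz\<close> applies.\<close>

lemma dF_bound:
  assumes c: "c \<in> A" "p \<in> fst c"
  shows "\<bar>dF c p v\<bar> \<le> 2 * radial_norm p * sqrt (v \<bullet> (g c p *v v))"
proof -
  let ?w = "Re_vec (radial_part c p)"
  have comp: "?w $ i = Re (cnj (f p) * fd c p (axis i 1))" for i
    unfolding Re_vec_def radial_part_def by (simp add: Df_component algebra_simps)
  have "fd c p v = (\<Sum>j\<in>UNIV. (v $ j) *\<^sub>R fd c p (axis j 1))"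
    by (rule linear_vec_expand[OF has_derivative_linear[OF fd_derivative[OF c]]])
  hence "Re (cnj (f p) * fd c p v) = ?w \<bullet> v"
    unfolding inner_vec_def comp
    by (simp add: sum_distrib_left Re_sum algebra_simps del: Re_Im_vec_parts)
  hence eq: "dF c p v = 2 * (?w \<bullet> v)" by (simp add: dF_def del: Re_Im_vec_parts)
  have "sqrt ((?w \<bullet> v)\<^sup>2) \<le> sqrt (q c p ?w * (v \<bullet> (g c p *v v)))"
    by (rule real_sqrt_le_mono[OF q_Cauchy_Schwarz[OF c]])
  hence "\<bar>?w \<bullet> v\<bar> \<le> radial_norm p * sqrt (v \<bullet> (g c p *v v))"
    unfolding norms_chart(1)[OF c] by (simp add: real_sqrt_mult del: Re_Im_vec_parts)
  thus ?thesis unfolding eq by (simp add: abs_mult del: Re_Im_vec_parts)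
qed

section \<open>The phase as a test map on superlevel sets\<close>

definition superlevel :: "real \<Rightarrow> 'm set" where "superlevel t = {p. norm_sq p > t}"

lemma open_superlevel: "open (superlevel t)"
  unfolding superlevel_def using continuous_norm_sq by (intro open_Collect_less) auto

text \<open>At zeros of \<open>f\<close> the quotient takes the value 0; the superlevel sets with
  nonnegative level contain no such point.\<close>

definition \<tau> :: "'m \<Rightarrow> complex" where "\<tau> p = f p /\<^sub>R cmod (f p)"

lemma superlevel_nonzero: "t \<ge> 0 \<Longrightarrow> p \<in> superlevel t \<Longrightarrow> f p \<noteq> 0"
  by (auto simp: superlevel_def norm_sq_def)

text \<open>Superlevel sets are open, so \<tau> serves as its own local extension.\<close>

lemma \<tau>_U1: "t \<ge> 0 \<Longrightarrow> \<tau> \<in> smooth_U1_maps A (superlevel t)"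
  unfolding smooth_U1_maps_def
proof (intro CollectI ballI)
  fix p assume t: "t \<ge> 0" and p: "p \<in> superlevel t"
  have "smooth_on_open A (superlevel t) \<tau>"
    unfolding smooth_on_open_def
  proof (intro conjI ballI open_superlevel)
    fix c assume c: "c \<in> A"
    let ?S = "snd c ` (fst c \<inter> superlevel t)"
    have "smooth_map_on ?S (\<lambda>x. (f \<circ> chart_inv c) x /\<^sub>R cmod ((f \<circ> chart_inv c) x))"
    proof (rule smooth_map_on_normalize)
      show "open ?S" using open_snd_image[OF c open_superlevel] .
      show "smooth_map_on ?S (f \<circ> chart_inv c)"
        by (rule smooth_map_on_subset[OF f_smooth_chart[OF c]]) auto
    qed (use superlevel_nonzero t c in auto)
    thus "smooth_map_on ?S (\<tau> \<circ> chart_inv c)" by (simp add: \<tau>_def o_def)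
  qed
  moreover have "\<forall>q\<in>superlevel t. cmod (\<tau> q) = 1"
    using superlevel_nonzero[OF t] by (auto simp: \<tau>_def)
  ultimately have "local_U1_extension A (superlevel t) \<tau> p \<tau>"
    using p unfolding local_U1_extension_def by blast
  thus "\<exists>\<sigma>. local_U1_extension A (superlevel t) \<tau> p \<sigma>" by blast
qed

text \<open>The extension \<sigma> is selected arbitrarily, but on the open superlevel set it must
  agree with \<tau> near \<open>p\<close>, so \<open>derivative_of_phase\<close> determines its
  differential.\<close>

lemma magnetic_D_norm_on_\<tau>:
  assumes t: "t \<ge> 0" and p: "p \<in> superlevel t"
  shows "magnetic_D_norm_on A g \<alpha> (superlevel t) \<tau> p = phase_norm p / norm_sq p"
proof -
  define \<sigma> where "\<sigma> = (SOME \<sigma>. local_U1_extension A (superlevel t) \<tau> p \<sigma>)"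
  have "local_U1_extension A (superlevel t) \<tau> p \<sigma>"
    unfolding \<sigma>_def 
    by (rule someI_ex[of "local_U1_extension A (superlevel t) \<tau> p"])
      (use \<tau>_U1[OF t] p in \<open>auto simp: smooth_U1_maps_def\<close>)
  then obtain V where V: "p \<in> V" "smooth_on_open A V \<sigma>" "\<And>q. q \<in> V \<Longrightarrow> cmod (\<sigma> q) = 1"
    "\<And>q. q \<in> V \<Longrightarrow> q \<in> superlevel t \<Longrightarrow> \<sigma> q = \<tau> q"
    unfolding local_U1_extension_def by blast
  have oV: "open V" using V(2) by (simp add: smooth_on_open_def)
  let ?c = "chart_at A p"
  have c: "?c \<in> A" "p \<in> fst ?c" by (rule chart_at_in)+
  let ?S = "snd ?c ` (fst ?c \<inter> (V \<inter> superlevel t))"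
  have S: "open ?S" using open_snd_image[OF c(1)] oV open_superlevel by blast
  have xS: "snd ?c p \<in> ?S" using c V p by blast
  have nz: "f p \<noteq> 0" using superlevel_nonzero[OF t p] .
  have sm: "smooth_map_on (snd ?c ` (fst ?c \<inter> V)) (\<sigma> \<circ> chart_inv ?c)"
    using V(2) c(1) unfolding smooth_on_open_def by blast
  have der: "(\<sigma> \<circ> chart_inv ?c has_derivative frechet_derivative (\<sigma> \<circ> chart_inv ?c) (at (snd ?c p))) (at (snd ?c p))"
    using smooth_map_on_imp(2)[OF sm open_snd_image[OF c(1) oV]] c V(1) by blast
  have phase: "frechet_derivative (\<sigma> \<circ> chart_inv ?c) (at (snd ?c p)) v
      = \<sigma> p * \<i> * complex_of_real (Im (cnj (f p) * fd ?c p v) / norm_sq p)" for v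
  proof -
    have "cmod ((\<sigma> \<circ> chart_inv ?c) y) = 1"
      "(f \<circ> chart_inv ?c) y = cmod ((f \<circ> chart_inv ?c) y) *\<^sub>R (\<sigma> \<circ> chart_inv ?c) y" if "y \<in> ?S" for y
      using that V(3,4) c(1) superlevel_nonzero[OF t] by (auto simp: \<tau>_def)
    from derivative_of_phase[OF S xS der fd_derivative[OF c] this, of v] show ?thesis
      using c nz by (simp only: o_apply chart_inv_snd norm_sq_def) simp
  qed
  \<comment> \<open>The covector (d + i \<alpha>) \<sigma> is the complex number \<open>z\<close>
    times the real covector \<open>?w\<close>, and |z| = 1 / \<open>norm_sq p\<close> since \<sigma>
    has modulus one.\<close>
  define z where "z = \<sigma> p * \<i> / complex_of_real (norm_sq p)"
  let ?w = "Re_vec (phase_part ?c p)"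
  have Fp: "norm_sq p > 0" using nz by (simp add: norm_sq_def)
  have comp: "magnetic_D \<alpha> \<sigma> ?c p $ i = z * complex_of_real (?w $ i)" for i
  proof -
    have w: "?w $ i = Im (cnj (f p) * fd ?c p (axis i 1)) + \<alpha> ?c p $ i * norm_sq p"
      unfolding norm_sq_def cmod_power2
      by (simp add: Re_vec_def phase_part_def Df_component power2_eq_square algebra_simps del: Re_Im_vec_parts)
    show ?thesis
      unfolding magnetic_D_def w z_def using Fp by (simp add: phase field_simps)
  qed
  have vecs: "Re_vec (magnetic_D \<alpha> \<sigma> ?c p) = Re z *\<^sub>R ?w" "Im_vec (magnetic_D \<alpha> \<sigma> ?c p) = Im z *\<^sub>R ?w"
    by (simp_all add: vec_eq_iff Re_vec_def[of "magnetic_D \<alpha> \<sigma> ?c p"] Im_vec_def[of "magnetic_D \<alpha> \<sigma> ?c p"] comp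
        del: Re_Im_vec_parts)
  have "Re (form_inner A g (magnetic_D \<alpha> \<sigma>) (magnetic_D \<alpha> \<sigma>) p) = (cmod z)\<^sup>2 * q ?c p ?w"
    unfolding Re_form_inner vecs q_scale cmod_power2 by (simp add: algebra_simps del: Re_Im_vec_parts)
  hence "form_norm A g (magnetic_D \<alpha> \<sigma>) p = cmod z * phase_norm p"
    unfolding form_norm_def norms_chart(2)[OF c] by (simp add: real_sqrt_mult del: Re_Im_vec_parts)
  also have "cmod z = 1 / norm_sq p"
    using V(1,3) Fp by (simp add: z_def norm_mult norm_divide)
  finally show ?thesis unfolding magnetic_D_norm_on_def \<sigma>_def[symmetric] by simp
qed

lemma frustration_superlevel:
  assumes "t \<ge> 0"
  shows "frustration_index A g \<alpha> (superlevel t) \<le> (\<integral>\<^sup>+p. ennreal (phase_norm p / norm_sq p) * indicator (superlevel t) p \<partial>vol A g)"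
  unfolding frustration_index_def
  by (rule INF_lower2[OF \<tau>_U1[OF assms]], rule nn_integral_mono)
    (auto simp: indicator_def magnetic_D_norm_on_\<tau>[OF assms])

end

section \<open>Integration over superlevel sets\<close>

text \<open>This allows the lower limit over all small radii to be bounded by one along a sequence,
  to which Fatou's lemma applies.\<close>

lemma Liminf_antimono_filter: "G \<le> H \<Longrightarrow> Liminf H f \<le> Liminf G f"
  unfolding Liminf_def by (rule SUP_subset_mono) (auto simp: le_filter_def)

text \<open>By Fubini, \<open>u p\<close> is integrated over the levels t with 0 \<le> t < G p, an
  interval of length \<open>G p\<close>; for negative \<open>G p\<close> it is empty and
  \<open>ennreal (G p)\<close> is 0.\<close>

lemma layer_cake:
  fixes G :: "'a \<Rightarrow> real" and u :: "'a \<Rightarrow> ennreal"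
  assumes M: "sigma_finite_measure M" and [measurable]: "G \<in> borel_measurable M" "u \<in> borel_measurable M"
  shows "(\<lambda>t. \<integral>\<^sup>+p. u p * indicator {p. G p > t} p \<partial>M) \<in> borel_measurable lborel" (is ?meas)
    and "(\<integral>\<^sup>+t. (\<integral>\<^sup>+p. u p * indicator {p. G p > t} p \<partial>M) * indicator {0..} t \<partial>lborel)
      = (\<integral>\<^sup>+p. u p * ennreal (G p) \<partial>M)" (is ?eq)
proof -
  interpret M: sigma_finite_measure M by (rule M)
  interpret pair_sigma_finite "lborel :: real measure" M
    by unfold_locales
  have ind: "u p * indicator {p. G p > t} p = (if t < G p then u p else 0)" for p t
    by (simp add: indicator_def)
  have [measurable]: "(\<lambda>(t, p). if t < G p then u p else 0) \<in> borel_measurable ((lborel :: real measure) \<Otimes>\<^sub>M M)"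
    by measurable
  show ?meas unfolding ind by measurable
  have "(\<integral>\<^sup>+t. (\<integral>\<^sup>+p. u p * indicator {p. G p > t} p \<partial>M) * indicator {0..} t \<partial>lborel)
      = (\<integral>\<^sup>+t. (\<integral>\<^sup>+p. (if t < G p then u p else 0) * indicator {0..} t \<partial>M) \<partial>lborel)"
    unfolding ind by (intro nn_integral_cong nn_integral_multc[symmetric]) measurable
  also have "\<dots> = (\<integral>\<^sup>+p. (\<integral>\<^sup>+t. (if t < G p then u p else 0) * indicator {0..} t \<partial>lborel) \<partial>M)"
    by (rule Fubini'[symmetric]) measurable
  also have "\<dots> = (\<integral>\<^sup>+p. u p * ennreal (G p) \<partial>M)"
  proof (rule nn_integral_cong)
    fix p
    have "(\<integral>\<^sup>+t. (if t < G p then u p else 0) * indicator {0..} t \<partial>lborel)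
        = (\<integral>\<^sup>+t. u p * indicator {0..<G p} t \<partial>lborel)"
      by (intro nn_integral_cong) (auto simp: indicator_def)
    also have "\<dots> = u p * emeasure lborel {0..<G p}" by (rule nn_integral_cmult_indicator) simp
    also have "emeasure lborel {0..<G p} = ennreal (G p)"
      by (cases "0 \<le> G p") (auto simp: ennreal_neg)
    finally show "(\<integral>\<^sup>+t. (if t < G p then u p else 0) * indicator {0..} t \<partial>lborel) = u p * ennreal (G p)" .
  qed
  finally show ?eq .
qed

context riemannian_manifold
begin

lemma borel_measurable_vol_continuous: "continuous_on UNIV h \<Longrightarrow> h \<in> borel_measurable (vol A g)"
  using borel_measurable_continuous_onI measurable_cong_sets[OF sets_vol refl] by blast

lemma integrable_continuous:
  fixes h :: "'m \<Rightarrow> 'b::{banach, second_countable_topology}"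
  assumes "continuous_on UNIV h"
  shows "integrable (vol A g) h"
proof -
  have "bounded (h ` UNIV)"
    using compact_continuous_image[OF assms compact_UNIV] by (rule compact_imp_bounded)
  then obtain B where "\<And>p. norm (h p) \<le> B" by (auto simp: bounded_iff)
  thus ?thesis
    using borel_measurable_vol_continuous[OF assms] finite_measure_vol
    by (intro finite_measure.integrable_const_bound[where B=B]) auto
qed

lemma nn_integral_continuous:
  fixes h :: "'m \<Rightarrow> real"
  assumes "continuous_on UNIV h" "\<And>p. h p \<ge> 0"
  shows "(\<integral>\<^sup>+p. ennreal (h p) \<partial>vol A g) = ennreal (LINT p|vol A g. h p)"
  using integrable_continuous assms by (intro nn_integral_eq_integral) auto

lemma sigma_finite_vol: "sigma_finite_measure (vol A g)"
  using finite_measure_vol finite_measure_def by blast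

end

context magnetic_function
begin

lemma norm_sq_nonneg: "norm_sq p \<ge> 0"
  by (simp add: norm_sq_def)

lemma norm_sq_integrable_finite: "(\<integral>\<^sup>+p. ennreal (norm_sq p) \<partial>vol A g) < \<infinity>"
  by (simp add: nn_integral_continuous continuous_norm_sq norm_sq_nonneg)

text \<open>\<open>L\<close> is the lower limit of the measurable difference quotients
  \<open>mk k\<close>, which compare two superlevel sets instead of a set and its neighbourhood. It
  is measurable as such, and Fatou bounds its integral.\<close>

lemma boundary_area_superlevel:
  assumes \<epsilon>: "\<epsilon> > 0"
  obtains L where "L \<in> borel_measurable lborel" "\<And>t. boundary_area A g (superlevel t) \<le> L t"
    "(\<integral>\<^sup>+t. L t * indicator {0..} t \<partial>lborel) \<le> (\<integral>\<^sup>+p. ennreal (2 * radial_norm p + \<epsilon>) \<partial>vol A g)"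
proof -
  let ?V = "vol A g" and ?N = "\<lambda>p. 2 * radial_norm p"
  obtain r0 where r0: "r0 > 0"
    "\<And>\<gamma> r. piecewise_C1_curve A \<gamma> \<Longrightarrow> r \<le> r0 \<Longrightarrow> curve_length \<gamma> < ennreal r \<Longrightarrow>
        norm_sq (\<gamma> 1) < norm_sq (\<gamma> 0) + r * (?N (\<gamma> 0) + \<epsilon>)"
  proof (rule uniform_increment_bound[where F = norm_sq and N = ?N and D = dF and \<epsilon> = \<epsilon>])
    show "continuous_on UNIV ?N" using continuous_norms by (intro continuous_intros)
  qed (use norm_sq_derivative dF_continuous dF_bound norms_nonneg \<epsilon> in auto)
  define r where "r k = r0 / real (Suc k)" for k
  have r: "r k > 0" "r k \<le> r0" for k
    unfolding r_def using r0 by (auto simp: field_simps)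
  have lim: "filterlim r (at_right 0) sequentially"
    unfolding filterlim_at_right_to_0 filterlim_at
    using LIMSEQ_Suc[OF lim_const_over_n[of r0]] r(1) unfolding r_def by (auto intro!: always_eventually)
  define G where "G k p = norm_sq p + r k * (?N p + \<epsilon>)" for k p
  define W where "W H t = (\<integral>\<^sup>+p. 1 * indicator {p. H p > t} p \<partial>?V)" for H :: "'m \<Rightarrow> real" and t :: real
  have contG: "continuous_on UNIV (G k)" for k
    unfolding G_def using continuous_norms continuous_norm_sq by (intro continuous_intros)
  have incr: "0 \<le> r k * (?N p + \<epsilon>)" for k p using r(1)[of k] norms_nonneg(1)[of p] \<epsilon> by simp
  have G_ge: "norm_sq p \<le> G k p" for k p using incr by (simp add: G_def)
  have mN: "norm_sq \<in> borel_measurable ?V" and mG: "G k \<in> borel_measurable ?V"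
    and ma: "radial_norm \<in> borel_measurable ?V" for k
    using borel_measurable_vol_continuous continuous_norm_sq contG continuous_norms by auto
  have W_meas: "W H \<in> borel_measurable lborel" if "H \<in> borel_measurable ?V" for H
    unfolding W_def using layer_cake(1)[OF sigma_finite_vol that, of "\<lambda>_. 1"] by simp
  have W_int: "(\<integral>\<^sup>+t. W H t * indicator {0..} t \<partial>lborel) = (\<integral>\<^sup>+p. ennreal (H p) \<partial>?V)" if "H \<in> borel_measurable ?V" for H
    unfolding W_def using layer_cake(2)[OF sigma_finite_vol that, of "\<lambda>_. 1"] by simp
  have W_em: "W H t = emeasure ?V {p. H p > t}" if "continuous_on UNIV H" for H t
  proof -
    have "{p. H p > t} \<in> sets ?V" using that by (auto intro!: borel_open open_Collect_less)
    thus ?thesis unfolding W_def by (simp add: nn_integral_indicator)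
  qed
  define mk where "mk k t = (W (G k) t - W norm_sq t) / ennreal (r k)" for k t
  have mk_meas [measurable]: "mk k \<in> borel_measurable lborel" for k
    unfolding mk_def using W_meas[OF mG] W_meas[OF mN] by measurable
  define L where "L t = liminf (\<lambda>k. mk k t)" for t
  have L_meas: "L \<in> borel_measurable lborel"
    unfolding L_def using mk_meas by measurable
  have area: "boundary_area A g (superlevel t) \<le> L t" for t
  proof -
    let ?\<phi> = "\<lambda>r::real. (emeasure ?V (open_nbhd A g (superlevel t) r) - emeasure ?V (superlevel t)) / ennreal r"
    have "boundary_area A g (superlevel t) = Liminf (at_right 0) ?\<phi>" by (simp add: boundary_area_def)
    also have "\<dots> \<le> Liminf (filtermap r sequentially) ?\<phi>"
      using lim by (intro Liminf_antimono_filter) (simp add: filterlim_def)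
    also have "\<dots> \<le> liminf (\<lambda>k. ?\<phi> (r k))" by (rule Liminf_filtermap_le)
    also have "\<dots> \<le> L t"
      unfolding L_def
    proof (intro Liminf_mono always_eventually allI)
      fix k
      have "open_nbhd A g {p. norm_sq p > t} (r k) \<subseteq> {p. norm_sq p + r k * (?N p + \<epsilon>) > t}"
        using r r0(2) by (intro open_nbhd_superlevel) auto
      hence "open_nbhd A g (superlevel t) (r k) \<subseteq> {p. G k p > t}" by (simp add: superlevel_def G_def)
      moreover have "{p. G k p > t} \<in> sets ?V" using contG by (auto intro!: borel_open open_Collect_less)
      ultimately have "emeasure ?V (open_nbhd A g (superlevel t) (r k)) \<le> W (G k) t"
        unfolding W_em[OF contG] by (rule emeasure_mono)
      moreover have "emeasure ?V (superlevel t) = W norm_sq t"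
        unfolding W_em[OF continuous_norm_sq] superlevel_def ..
      ultimately show "?\<phi> (r k) \<le> mk k t"
        unfolding mk_def by (intro divide_right_mono_ennreal ennreal_minus_mono) auto
    qed
    finally show ?thesis .
  qed
  \<comment> \<open>By the layer cake formula the quotient integrates to the integral of (G k -
    norm_sq) / r k, which does not depend on \<open>k\<close>. Splitting the difference uses that
    \<open>norm_sq\<close> has finite integral.\<close>
  have int_mk: "(\<integral>\<^sup>+t. mk k t * indicator {0..} t \<partial>lborel) = (\<integral>\<^sup>+p. ennreal (?N p + \<epsilon>) \<partial>?V)" for k
  proof -
    let ?I = "indicator {0::real..}"
    have mW: "(\<lambda>t. W (G k) t * ?I t) \<in> borel_measurable lborel" "(\<lambda>t. W norm_sq t * ?I t) \<in> borel_measurable lborel"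
      using W_meas[OF mG] W_meas[OF mN] by measurable
    have mN': "(\<lambda>p. ennreal (?N p + \<epsilon>)) \<in> borel_measurable ?V"
      using ma by measurable
    have "(\<integral>\<^sup>+t. mk k t * ?I t \<partial>lborel) = (\<integral>\<^sup>+t. (W (G k) t * ?I t - W norm_sq t * ?I t) / ennreal (r k) \<partial>lborel)"
      unfolding mk_def by (intro nn_integral_cong) (auto simp: indicator_def)
    also have "\<dots> = (\<integral>\<^sup>+t. W (G k) t * ?I t - W norm_sq t * ?I t \<partial>lborel) / ennreal (r k)"
      by (intro nn_integral_divide borel_measurable_minus_ennreal mW)
    also have "(\<integral>\<^sup>+t. W (G k) t * ?I t - W norm_sq t * ?I t \<partial>lborel)
        = (\<integral>\<^sup>+t. W (G k) t * ?I t \<partial>lborel) - (\<integral>\<^sup>+t. W norm_sq t * ?I t \<partial>lborel)"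
    proof (rule nn_integral_diff[OF mW])
      show "(\<integral>\<^sup>+t. W norm_sq t * ?I t \<partial>lborel) \<noteq> \<infinity>"
        unfolding W_int[OF mN] using norm_sq_integrable_finite by simp
      have "W norm_sq t \<le> W (G k) t" for t
        unfolding W_def using G_ge by (intro nn_integral_mono) (auto simp: indicator_def intro: less_le_trans)
      thus "AE t in lborel. W norm_sq t * ?I t \<le> W (G k) t * ?I t"
        by (auto intro!: mult_right_mono)
    qed
    also have "\<dots> = (\<integral>\<^sup>+p. ennreal (G k p) \<partial>?V) - (\<integral>\<^sup>+p. ennreal (norm_sq p) \<partial>?V)"
      unfolding W_int[OF mN] W_int[OF mG] ..
    also have "(\<integral>\<^sup>+p. ennreal (G k p) \<partial>?V) = (\<integral>\<^sup>+p. ennreal (norm_sq p) + ennreal (r k) * ennreal (?N p + \<epsilon>) \<partial>?V)"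
      proof (rule nn_integral_cong)
      fix p
      show "ennreal (G k p) = ennreal (norm_sq p) + ennreal (r k) * ennreal (?N p + \<epsilon>)"
        unfolding G_def ennreal_plus[OF norm_sq_nonneg incr]
        using r(1)[of k] by (simp add: ennreal_mult')
    qed
    also have "\<dots> = (\<integral>\<^sup>+p. ennreal (norm_sq p) \<partial>?V) + ennreal (r k) * (\<integral>\<^sup>+p. ennreal (?N p + \<epsilon>) \<partial>?V)"
      using mN mN' by (subst nn_integral_add) (auto simp: nn_integral_cmult)
    also have "\<dots> - (\<integral>\<^sup>+p. ennreal (norm_sq p) \<partial>?V) = ennreal (r k) * (\<integral>\<^sup>+p. ennreal (?N p + \<epsilon>) \<partial>?V)"
      using norm_sq_integrable_finite by (intro ennreal_add_diff_cancel_left) simp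
    also have "\<dots> / ennreal (r k) = (\<integral>\<^sup>+p. ennreal (?N p + \<epsilon>) \<partial>?V)"
      using r(1)[of k] by (subst mult.commute) (simp add: ennreal_mult_divide_eq)
    finally show ?thesis .
  qed
  have "(\<integral>\<^sup>+t. L t * indicator {0..} t \<partial>lborel) \<le> (\<integral>\<^sup>+t. liminf (\<lambda>k. mk k t * indicator {0..} t) \<partial>lborel)"
    unfolding L_def by (intro nn_integral_mono) (auto simp: indicator_def)
  also have "\<dots> \<le> liminf (\<lambda>k. \<integral>\<^sup>+t. mk k t * indicator {0..} t \<partial>lborel)"
    by (intro nn_integral_liminf) measurable
  also have "\<dots> = (\<integral>\<^sup>+p. ennreal (?N p + \<epsilon>) \<partial>?V)"
    unfolding int_mk by (simp add: Liminf_const)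
  finally show thesis using that[OF L_meas area] by blast
qed

text \<open>The inequality is multiplied by the volume so that it also holds for null superlevel
  sets, over which the infimum does not range.\<close>

lemma cheeger_superlevel:
  assumes t: "t \<ge> 0"
  shows "cheeger_constant A g \<alpha> * emeasure (vol A g) (superlevel t)
    \<le> frustration_index A g \<alpha> (superlevel t) + boundary_area A g (superlevel t)"
proof (cases "emeasure (vol A g) (superlevel t) = 0")
  case False
  let ?v = "emeasure (vol A g) (superlevel t)"
  have fin: "?v \<noteq> top" using finite_measure.emeasure_finite[OF finite_measure_vol] by (simp add: infinity_ennreal_def)
  have "cheeger_constant A g \<alpha> \<le> cheeger_quotient A g \<alpha> (superlevel t)"
    unfolding cheeger_constant_def using False open_superlevel by (intro INF_lower) (auto simp: zero_less_iff_neq_zero)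
  hence "cheeger_constant A g \<alpha> * ?v
      \<le> (frustration_index A g \<alpha> (superlevel t) + boundary_area A g (superlevel t)) / ?v * ?v"
    unfolding cheeger_quotient_def by (rule mult_right_mono) simp
  also have "\<dots> = frustration_index A g \<alpha> (superlevel t) + boundary_area A g (superlevel t)"
    using False fin by (subst mult.commute) (simp add: ennreal_times_divide ennreal_mult_divide_eq mult.commute[of ?v])
  finally show ?thesis .
qed simp

lemma cheeger_parts:
  "cheeger_constant A g \<alpha> * (\<integral>\<^sup>+p. ennreal (norm_sq p) \<partial>vol A g)
    \<le> (\<integral>\<^sup>+p. ennreal (phase_norm p + 2 * radial_norm p) \<partial>vol A g)"
proof (rule ennreal_le_epsilon)
  fix e :: real assume e: "0 < e"
  let ?V = "vol A g" and ?h = "cheeger_constant A g \<alpha>"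
  define v where "v = measure ?V UNIV"
  have v: "v \<ge> 0" "emeasure ?V UNIV = ennreal v"
    unfolding v_def using finite_measure.emeasure_eq_measure[OF finite_measure_vol] by auto
  \<comment> \<open>The error \<epsilon> enters multiplied by the total volume \<open>v\<close>;
    adding 1 keeps the denominator positive whatever \<open>v\<close> is.\<close>
  define \<epsilon> where "\<epsilon> = e / (v + 1)"
  have \<epsilon>: "\<epsilon> > 0" "\<epsilon> * v \<le> e" unfolding \<epsilon>_def using e v by (auto simp: field_simps)
  obtain L where L: "L \<in> borel_measurable lborel" "\<And>t. boundary_area A g (superlevel t) \<le> L t"
    "(\<integral>\<^sup>+t. L t * indicator {0..} t \<partial>lborel) \<le> (\<integral>\<^sup>+p. ennreal (2 * radial_norm p + \<epsilon>) \<partial>?V)"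
    using boundary_area_superlevel[OF \<epsilon>(1)] by blast
  let ?u = "\<lambda>p. ennreal (phase_norm p / norm_sq p)"
  define I where "I t = (\<integral>\<^sup>+p. ?u p * indicator {p. norm_sq p > t} p \<partial>?V)" for t
  note [measurable] = L(1)
  have mN [measurable]: "norm_sq \<in> borel_measurable ?V" and [measurable]: "radial_norm \<in> borel_measurable ?V"
    and [measurable]: "phase_norm \<in> borel_measurable ?V"
    using borel_measurable_vol_continuous continuous_norm_sq continuous_norms by auto
  have mu: "?u \<in> borel_measurable ?V" by measurable
  have I_meas [measurable]: "I \<in> borel_measurable lborel" unfolding I_def by (rule layer_cake(1)[OF sigma_finite_vol mN mu])
  define W where "W t = (\<integral>\<^sup>+p. 1 * indicator {p. norm_sq p > t} p \<partial>?V)" for t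
  have W_meas [measurable]: "W \<in> borel_measurable lborel" unfolding W_def by (rule layer_cake(1)[OF sigma_finite_vol mN]) simp
  have W_em: "W t = emeasure ?V (superlevel t)" for t
    unfolding W_def superlevel_def[symmetric] using open_superlevel by (simp add: nn_integral_indicator)
  have "?h * (\<integral>\<^sup>+p. ennreal (norm_sq p) \<partial>?V) = ?h * (\<integral>\<^sup>+t. W t * indicator {0..} t \<partial>lborel)"
    unfolding W_def using layer_cake(2)[OF sigma_finite_vol mN, of "\<lambda>_. 1"] by simp
  also have "\<dots> = (\<integral>\<^sup>+t. ?h * (W t * indicator {0..} t) \<partial>lborel)"
    by (intro nn_integral_cmult[symmetric]) measurable
  also have "\<dots> \<le> (\<integral>\<^sup>+t. I t * indicator {0..} t + L t * indicator {0..} t \<partial>lborel)"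
  proof (rule nn_integral_mono)
    fix t :: real
    show "?h * (W t * indicator {0..} t) \<le> I t * indicator {0..} t + L t * indicator {0..} t"
    proof (cases "t \<ge> 0")
      case True
      have "?h * W t \<le> frustration_index A g \<alpha> (superlevel t) + boundary_area A g (superlevel t)"
        unfolding W_em by (rule cheeger_superlevel[OF True])
      also have "\<dots> \<le> I t + L t"
        using frustration_superlevel[OF True] L(2) unfolding I_def superlevel_def by (intro add_mono) auto
      finally show ?thesis using True by simp
    qed simp
  qed
  also have "\<dots> = (\<integral>\<^sup>+t. I t * indicator {0..} t \<partial>lborel) + (\<integral>\<^sup>+t. L t * indicator {0..} t \<partial>lborel)"
    by (intro nn_integral_add) measurable
  also have "\<dots> \<le> (\<integral>\<^sup>+p. ennreal (phase_norm p) \<partial>?V) + (\<integral>\<^sup>+p. ennreal (2 * radial_norm p + \<epsilon>) \<partial>?V)"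
  proof (rule add_mono[OF _ L(3)])
    have "(\<integral>\<^sup>+t. I t * indicator {0..} t \<partial>lborel) = (\<integral>\<^sup>+p. ?u p * ennreal (norm_sq p) \<partial>?V)"
      unfolding I_def by (rule layer_cake(2)[OF sigma_finite_vol mN mu])
    also have "\<dots> \<le> (\<integral>\<^sup>+p. ennreal (phase_norm p) \<partial>?V)"
    proof (rule nn_integral_mono)
      \<comment> \<open>Only an inequality is claimed, because at zeros of \<open>f\<close> the left
        side is 0.\<close>
      show "?u p * ennreal (norm_sq p) \<le> ennreal (phase_norm p)" for p
        using norms_nonneg[of p] norm_sq_nonneg[of p] by (cases "norm_sq p = 0") (auto simp flip: ennreal_mult)
    qed
    finally show "(\<integral>\<^sup>+t. I t * indicator {0..} t \<partial>lborel) \<le> (\<integral>\<^sup>+p. ennreal (phase_norm p) \<partial>?V)" .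
  qed
  also have "\<dots> = (\<integral>\<^sup>+p. ennreal (phase_norm p) + ennreal (2 * radial_norm p + \<epsilon>) \<partial>?V)"
    by (intro nn_integral_add[symmetric]) measurable
  also have "\<dots> = (\<integral>\<^sup>+p. ennreal (phase_norm p + 2 * radial_norm p) + ennreal \<epsilon> \<partial>?V)"
    using norms_nonneg \<epsilon> by (intro nn_integral_cong) (simp add: add_ac flip: ennreal_plus)
  also have "\<dots> = (\<integral>\<^sup>+p. ennreal (phase_norm p + 2 * radial_norm p) \<partial>?V) + (\<integral>\<^sup>+p. ennreal \<epsilon> \<partial>?V)"
    by (intro nn_integral_add) measurable
  also have "(\<integral>\<^sup>+p. ennreal \<epsilon> \<partial>?V) = ennreal (\<epsilon> * v)"
    using v \<epsilon> by (simp add: ennreal_mult)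
  also have "(\<integral>\<^sup>+p. ennreal (phase_norm p + 2 * radial_norm p) \<partial>?V) + ennreal (\<epsilon> * v)
      \<le> (\<integral>\<^sup>+p. ennreal (phase_norm p + 2 * radial_norm p) \<partial>?V) + ennreal e"
    using \<epsilon>(2) by (intro add_mono ennreal_leI) auto
  finally show "?h * (\<integral>\<^sup>+p. ennreal (norm_sq p) \<partial>?V) \<le> (\<integral>\<^sup>+p. ennreal (phase_norm p + 2 * radial_norm p) \<partial>?V) + ennreal e" .
qed

lemma cheeger_rayleigh:
  "cheeger_constant A g \<alpha> * ennreal (LINT p|vol A g. norm_sq p)
    \<le> ennreal (sqrt 5 * (sqrt (LINT p|vol A g. norm_sq p) * sqrt (LINT p|vol A g. (D_norm p)\<^sup>2)))"
proof -
  let ?V = "vol A g"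
  let ?X = "LINT p|?V. norm_sq p" and ?Y = "LINT p|?V. (D_norm p)\<^sup>2" and ?Z = "LINT p|?V. cmod (f p) * D_norm p"
  have cZ: "continuous_on UNIV (\<lambda>p. cmod (f p) * D_norm p)"
    and cY: "continuous_on UNIV (\<lambda>p. (D_norm p)\<^sup>2)"
    using f_continuous continuous_norms by (auto intro!: continuous_intros)
  have [measurable]: "f \<in> borel_measurable (vol A g)" "D_norm \<in> borel_measurable (vol A g)"
    using borel_measurable_vol_continuous f_continuous continuous_norms by auto
  have Z0: "cmod (f p) * D_norm p \<ge> 0" for p using norms_nonneg by simp
  have nonneg: "?X \<ge> 0" "?Y \<ge> 0" "?Z \<ge> 0" using norm_sq_nonneg Z0 by auto
  have "(\<integral>\<^sup>+p. ennreal (cmod (f p)) * ennreal (D_norm p) \<partial>?V)\<^sup>2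
      \<le> (\<integral>\<^sup>+p. (ennreal (cmod (f p)))\<^sup>2 \<partial>?V) * (\<integral>\<^sup>+p. (ennreal (D_norm p))\<^sup>2 \<partial>?V)"
    by (intro Cauchy_Schwarz_nn_integral) measurable
  hence "(\<integral>\<^sup>+p. ennreal (cmod (f p) * D_norm p) \<partial>?V)\<^sup>2
      \<le> (\<integral>\<^sup>+p. ennreal (norm_sq p) \<partial>?V) * (\<integral>\<^sup>+p. ennreal ((D_norm p)\<^sup>2) \<partial>?V)"
    using norms_nonneg by (simp add: ennreal_mult ennreal_power norm_sq_def)
  hence "(ennreal ?Z)\<^sup>2 \<le> ennreal ?X * ennreal ?Y"
    using nn_integral_continuous[OF cZ Z0] nn_integral_continuous[OF continuous_norm_sq norm_sq_nonneg]
      nn_integral_continuous[OF cY] by simp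
  hence "?Z\<^sup>2 \<le> ?X * ?Y" using nonneg by (simp add: ennreal_power flip: ennreal_mult)
  hence "sqrt (?Z\<^sup>2) \<le> sqrt (?X * ?Y)" by (rule real_sqrt_le_mono)
  hence Z: "?Z \<le> sqrt ?X * sqrt ?Y" using nonneg by (simp add: real_sqrt_mult)
  have "cheeger_constant A g \<alpha> * ennreal ?X \<le> (\<integral>\<^sup>+p. ennreal (phase_norm p + 2 * radial_norm p) \<partial>?V)"
    using cheeger_parts nn_integral_continuous[OF continuous_norm_sq norm_sq_nonneg] by simp
  also have "\<dots> \<le> (\<integral>\<^sup>+p. ennreal (sqrt 5 * (cmod (f p) * D_norm p)) \<partial>?V)"
    by (intro nn_integral_mono ennreal_leI parts_bound)
  also have "\<dots> = ennreal (LINT p|?V. sqrt 5 * (cmod (f p) * D_norm p))"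
    using cZ Z0 by (intro nn_integral_continuous) (auto intro!: continuous_intros)
  also have "\<dots> = ennreal (sqrt 5 * ?Z)" by simp
  also have "\<dots> \<le> ennreal (sqrt 5 * (sqrt ?X * sqrt ?Y))"
    using Z by (intro ennreal_leI mult_left_mono) auto
  finally show ?thesis .
qed

end

section \<open>Approximation of eigenfunctions\<close>

lemma square_integrable_scale:
  assumes "square_integrable M u"
  shows "square_integrable M (\<lambda>p. z * u p)"
  using assms unfolding square_integrable_def by (auto simp: norm_mult power_mult_distrib)

lemma cmod_add_sq_le: "(cmod (x + y))\<^sup>2 \<le> 2 * (cmod x)\<^sup>2 + 2 * (cmod y)\<^sup>2"
proof -
  have "(cmod (x + y))\<^sup>2 \<le> (cmod x + cmod y)\<^sup>2" by (intro power_mono norm_triangle_ineq) simp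
  also have "\<dots> \<le> 2 * (cmod x)\<^sup>2 + 2 * (cmod y)\<^sup>2"
    using zero_le_power2[of "cmod x - cmod y"] by (simp add: power2_eq_square algebra_simps)
  finally show ?thesis .
qed

lemma square_integrable_add:
  assumes "square_integrable M u" "square_integrable M v"
  shows "square_integrable M (\<lambda>p. u p + v p)"
proof -
  have [measurable]: "u \<in> borel_measurable M" "v \<in> borel_measurable M"
    using assms by (auto simp: square_integrable_def)
  have "integrable M (\<lambda>p. 2 * (cmod (u p))\<^sup>2 + 2 * (cmod (v p))\<^sup>2)"
    using assms by (auto simp: square_integrable_def)
  hence "integrable M (\<lambda>p. (cmod (u p + v p))\<^sup>2)"
  proof (rule Bochner_Integration.integrable_bound)
    show "AE p in M. norm ((cmod (u p + v p))\<^sup>2) \<le> norm (2 * (cmod (u p))\<^sup>2 + 2 * (cmod (v p))\<^sup>2)"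
      using cmod_add_sq_le by (intro AE_I2) (simp add: order_trans[OF _ abs_ge_self])
  qed measurable
  thus ?thesis by (simp add: square_integrable_def)
qed

lemma square_integrable_diff:
  assumes "square_integrable M u" "square_integrable M v"
  shows "square_integrable M (\<lambda>p. u p - v p)"
  using square_integrable_add[OF assms(1) square_integrable_scale[OF assms(2), of "-1"]] by simp

lemma L2_tendsto_add:
  assumes "\<And>k. square_integrable M (f k)" "square_integrable M u" "\<And>k. square_integrable M (h k)" "square_integrable M v"
    and "L2_tendsto M f u" "L2_tendsto M h v"
  shows "L2_tendsto M (\<lambda>k p. f k p + h k p) (\<lambda>p. u p + v p)"
  unfolding L2_tendsto_def
proof (rule tendsto_sandwich[OF always_eventually always_eventually tendsto_const])
  let ?a = "\<lambda>k. LINT p|M. (cmod (f k p - u p))\<^sup>2" and ?b = "\<lambda>k. LINT p|M. (cmod (h k p - v p))\<^sup>2"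
  show "(\<lambda>k. 2 * ?a k + 2 * ?b k) \<longlonglongrightarrow> 0"
    using tendsto_add[OF tendsto_mult_left[of _ _ _ 2] tendsto_mult_left[of _ _ _ 2]] assms(5,6)
    unfolding L2_tendsto_def by force
  show "\<forall>k. (LINT p|M. (cmod (f k p + h k p - (u p + v p)))\<^sup>2) \<le> 2 * ?a k + 2 * ?b k"
  proof
    fix k
    have i: "integrable M (\<lambda>p. (cmod (f k p - u p))\<^sup>2)" "integrable M (\<lambda>p. (cmod (h k p - v p))\<^sup>2)"
      "integrable M (\<lambda>p. (cmod (f k p + h k p - (u p + v p)))\<^sup>2)"
      using square_integrable_diff[OF assms(1,2)] square_integrable_diff[OF assms(3,4)]
        square_integrable_diff[OF square_integrable_add[OF assms(1,3)] square_integrable_add[OF assms(2,4)]]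
      by (auto simp: square_integrable_def)
    have "(LINT p|M. (cmod (f k p + h k p - (u p + v p)))\<^sup>2)
        \<le> (LINT p|M. 2 * (cmod (f k p - u p))\<^sup>2 + 2 * (cmod (h k p - v p))\<^sup>2)"
    proof (rule integral_mono)
      show "(cmod (f k p + h k p - (u p + v p)))\<^sup>2 \<le> 2 * (cmod (f k p - u p))\<^sup>2 + 2 * (cmod (h k p - v p))\<^sup>2" for p
        using cmod_add_sq_le[of "f k p - u p" "h k p - v p"] by (simp add: algebra_simps)
    qed (use i in auto)
    thus "(LINT p|M. (cmod (f k p + h k p - (u p + v p)))\<^sup>2) \<le> 2 * ?a k + 2 * ?b k" using i by simp
  qed
qed (simp add: integral_nonneg_AE)

lemma L2_tendsto_minus:
  "L2_tendsto M h v \<Longrightarrow> L2_tendsto M (\<lambda>k p. - h k p) (\<lambda>p. - v p)"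
  unfolding L2_tendsto_def using norm_minus_commute[of "h _ _" "v _"]
  by (simp add: norm_minus_commute)

text \<open>The difference of squares is controlled by Young's inequality with a parameter
  \<open>s k\<close> that tends to 0 slowly enough for \<open>e k / s k\<close> to vanish as
  well.\<close>

lemma L2_tendsto_norm:
  assumes "\<And>k. square_integrable M (f k)" "square_integrable M u" "L2_tendsto M f u"
  shows "(\<lambda>k. LINT p|M. (cmod (f k p))\<^sup>2) \<longlonglongrightarrow> (LINT p|M. (cmod (u p))\<^sup>2)"
proof -
  define e where "e k = (LINT p|M. (cmod (f k p - u p))\<^sup>2)" for k
  define U where "U = (LINT p|M. (cmod (u p))\<^sup>2)"
  \<comment> \<open>The square root of \<open>e k\<close> balances the two error terms; the added 1
    / (k + 1) keeps \<open>s k\<close> positive when \<open>e k\<close> is 0.\<close>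
  define s where "s k = sqrt (e k) + 1 / real (Suc k)" for k
  have e0: "e k \<ge> 0" for k by (simp add: e_def integral_nonneg_AE)
  have s0: "s k > 0" for k using e0 by (simp add: s_def add_nonneg_pos)
  have lim_e: "e \<longlonglongrightarrow> 0" using assms(3) by (simp add: L2_tendsto_def e_def[abs_def])
  have lim_s: "s \<longlonglongrightarrow> 0"
    unfolding s_def using tendsto_add[OF tendsto_real_sqrt[OF lim_e] LIMSEQ_Suc[OF lim_1_over_n]] by simp
  have bound: "\<bar>(LINT p|M. (cmod (f k p))\<^sup>2) - U\<bar> \<le> e k + sqrt (e k) + s k * U" for k
  proof -
    have i: "integrable M (\<lambda>p. (cmod (f k p))\<^sup>2)" "integrable M (\<lambda>p. (cmod (u p))\<^sup>2)" "integrable M (\<lambda>p. (cmod (f k p - u p))\<^sup>2)"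
      using assms(1,2) square_integrable_diff[OF assms(1,2)] by (auto simp: square_integrable_def)
    have "\<bar>(LINT p|M. (cmod (f k p))\<^sup>2) - U\<bar> = \<bar>LINT p|M. (cmod (f k p))\<^sup>2 - (cmod (u p))\<^sup>2\<bar>"
      unfolding U_def using i by simp
    also have "\<dots> \<le> (LINT p|M. \<bar>(cmod (f k p))\<^sup>2 - (cmod (u p))\<^sup>2\<bar>)" by (rule integral_abs_bound)
    also have "\<dots> \<le> (LINT p|M. (1 + 1 / s k) * (cmod (f k p - u p))\<^sup>2 + s k * (cmod (u p))\<^sup>2)"
    proof (rule integral_mono)
      fix p
      let ?x = "cmod (f k p - u p)" and ?y = "cmod (u p)"
      have tri: "cmod (f k p) \<le> ?x + ?y" "?y \<le> ?x + cmod (f k p)"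
        using norm_triangle_ineq[of "f k p - u p" "u p"] norm_triangle_ineq[of "u p - f k p" "f k p"]
        by (auto simp: norm_minus_commute)
      have "0 \<le> (?x / sqrt (s k) - sqrt (s k) * ?y)\<^sup>2" by simp
      also have "\<dots> = ?x\<^sup>2 / s k - 2 * ?x * ?y + s k * ?y\<^sup>2"
        using s0[of k] by (simp add: power2_diff power_divide power_mult_distrib)
      finally have am: "2 * ?x * ?y \<le> ?x\<^sup>2 / s k + s k * ?y\<^sup>2" by simp
      have "\<bar>cmod (f k p) - ?y\<bar> \<le> ?x" using tri by linarith
      moreover have "cmod (f k p) + ?y \<le> ?x + 2 * ?y" using tri by linarith
      ultimately have "\<bar>cmod (f k p) - ?y\<bar> * (cmod (f k p) + ?y) \<le> ?x * (?x + 2 * ?y)"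
        by (intro mult_mono) auto
      moreover have "\<bar>(cmod (f k p))\<^sup>2 - ?y\<^sup>2\<bar> = \<bar>cmod (f k p) - ?y\<bar> * (cmod (f k p) + ?y)"
        using abs_mult[of "cmod (f k p) - ?y" "cmod (f k p) + ?y"] by (simp add: power2_eq_square algebra_simps)
      ultimately show "\<bar>(cmod (f k p))\<^sup>2 - ?y\<^sup>2\<bar> \<le> (1 + 1 / s k) * ?x\<^sup>2 + s k * ?y\<^sup>2"
        using am by (simp add: power2_eq_square algebra_simps)
    qed (use i in auto)
    also have "\<dots> = (1 + 1 / s k) * e k + s k * U"
      unfolding e_def U_def using i by simp
    also have "\<dots> \<le> e k + sqrt (e k) + s k * U"
    proof -
      have "sqrt (e k) \<le> s k" by (simp add: s_def)
      hence "sqrt (e k) * sqrt (e k) \<le> sqrt (e k) * s k" using e0 by (intro mult_left_mono) auto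
      hence "e k / s k \<le> sqrt (e k)" using e0 s0[of k] by (simp add: divide_le_eq)
      thus ?thesis by (simp add: algebra_simps)
    qed
    finally show ?thesis .
  qed
  have "(\<lambda>k. e k + sqrt (e k) + s k * U) \<longlonglongrightarrow> 0"
    using tendsto_add[OF tendsto_add[OF lim_e tendsto_real_sqrt[OF lim_e]] tendsto_mult_right[OF lim_s, of U]] by simp
  hence "(\<lambda>k. (LINT p|M. (cmod (f k p))\<^sup>2) - U) \<longlonglongrightarrow> 0"
    by (rule Lim_null_comparison[OF always_eventually, rotated]) (use bound in auto)
  thus ?thesis unfolding U_def[symmetric] by (rule LIM_zero_cancel)
qed

context magnetic_function
begin

lemma matrix_inv_sym:
  assumes "c \<in> A" "p \<in> fst c"
  shows "u \<bullet> (matrix_inv (g c p) *v v) = (matrix_inv (g c p) *v u) \<bullet> v"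
proof -
  let ?G = "matrix_inv (g c p)"
  have "u \<bullet> (?G *v v) = (g c p *v (?G *v u)) \<bullet> (?G *v v)" using metric_inv[OF assms] by simp
  also have "\<dots> = (?G *v u) \<bullet> (g c p *v (?G *v v))" using metric_swap[OF assms] by simp
  also have "\<dots> = (?G *v u) \<bullet> v" using metric_inv[OF assms] by simp
  finally show ?thesis .
qed

text \<open>The weak equation is complex valued, so the imaginary part has to be seen to vanish; it
  does by the symmetry of the inverse metric.\<close>

lemma form_inner_Df: "form_inner A g Df Df p = complex_of_real ((D_norm p)\<^sup>2)"
proof -
  let ?c = "chart_at A p"
  have c: "?c \<in> A" "p \<in> fst ?c" by (rule chart_at_in)+
  let ?G = "matrix_inv (g ?c p)" and ?x = "Re_vec (Df ?c p)" and ?y = "Im_vec (Df ?c p)"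
  have "Im (complex_of_real r * z * cnj z') = Im z * (r * Re z') - Re z * (r * Im z')" for r z z'
    by (simp add: algebra_simps)
  hence "Im (form_inner A g Df Df p) = ?y \<bullet> (?G *v ?x) - ?x \<bullet> (?G *v ?y)"
    by (simp add: form_inner_def Let_def Re_vec_def Im_vec_def matrix_vector_mult_def
        inner_vec_def sum_distrib_left sum_subtractf) (simp add: mult_ac)
  also have "\<dots> = 0" using matrix_inv_sym[OF c, of ?y ?x] by (simp add: inner_commute)
  finally have "Im (form_inner A g Df Df p) = 0" .
  moreover have "Re (form_inner A g Df Df p) = (D_norm p)\<^sup>2"
    unfolding Re_form_inner norms_chart(3)[OF c] using q_nonneg[OF c] by simp
  ultimately show ?thesis by (simp add: complex_eq_iff)
qed

lemma square_integrable_f: "square_integrable (vol A g) f"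
  unfolding square_integrable_def
  using borel_measurable_vol_continuous[OF f_continuous] integrable_continuous[OF continuous_norm_sq]
  unfolding norm_sq_def by auto

text \<open>Testing the adjoint relation with \<open>f\<close> itself gives the energy as the inner
  product of \<open>f\<close> and \<open>h\<close>. Polarization turns its real part into norms, to
  which \<open>L2_tendsto_norm\<close> applies.\<close>

lemma energy_identity:
  assumes h: "(f, h) \<in> magnetic_laplacian A g \<alpha>"
  shows "(LINT p|vol A g. (D_norm p)\<^sup>2) =
    ((LINT p|vol A g. (cmod (f p + h p))\<^sup>2) - (LINT p|vol A g. (cmod (f p - h p))\<^sup>2)) / 4"
proof -
  have sm: "smooth_fun A h" and eq: "(LINT p|vol A g. form_inner A g Df Df p) = (LINT p|vol A g. f p * cnj (h p))"
    using h smooth_f unfolding magnetic_laplacian_def magnetic_D_adjoint_def by auto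
  interpret h: magnetic_function A g \<alpha> h using smooth_form sm by unfold_locales
  note f = f_continuous and hc = h.f_continuous
  have i: "integrable (vol A g) (\<lambda>p. f p * cnj (h p))"
    using f hc by (intro integrable_continuous continuous_intros)
  have "complex_of_real (LINT p|vol A g. (D_norm p)\<^sup>2) = (LINT p|vol A g. f p * cnj (h p))"
    unfolding eq[symmetric] form_inner_Df by (rule integral_complex_of_real[symmetric])
  hence "(LINT p|vol A g. (D_norm p)\<^sup>2) = Re (LINT p|vol A g. f p * cnj (h p))" by (metis Re_complex_of_real)
  also have "\<dots> = (LINT p|vol A g. Re (f p * cnj (h p)))" by (rule integral_Re[OF i, symmetric])
  also have "\<dots> = (LINT p|vol A g. ((cmod (f p + h p))\<^sup>2 - (cmod (f p - h p))\<^sup>2) / 4)"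
    unfolding cmod_power2
    by (intro Bochner_Integration.integral_cong refl) (simp add: power2_eq_square algebra_simps)
  also have "\<dots> = ((LINT p|vol A g. (cmod (f p + h p))\<^sup>2) - (LINT p|vol A g. (cmod (f p - h p))\<^sup>2)) / 4"
  proof -
    have "integrable (vol A g) (\<lambda>p. (cmod (f p + h p))\<^sup>2)" "integrable (vol A g) (\<lambda>p. (cmod (f p - h p))\<^sup>2)"
      using f hc by (auto intro!: integrable_continuous continuous_intros)
    thus ?thesis by simp
  qed
  finally show ?thesis .
qed

end

text \<open>Smooth approximants \<open>f k\<close> of the eigenfunction have squared norms tending
  to U > 0 and energies tending to \<mu> U, so the Rayleigh bound for \<open>f k\<close> survives in
  the limit.\<close>

lemma (in riemannian_manifold) cheeger_eigenvalue:
  assumes \<alpha>: "smooth_one_form A \<alpha>" and ev: "magnetic_eigenvalue A g \<alpha> \<mu>"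
  shows "\<mu> \<ge> 0" "cheeger_constant A g \<alpha> \<le> ennreal (sqrt (5 * \<mu>))"
proof -
  let ?V = "vol A g" and ?C = "cheeger_constant A g \<alpha>"
  obtain u f h where u: "square_integrable ?V u" "\<not> (AE p in ?V. u p = 0)"
    and fh: "\<And>k. (f k, h k) \<in> magnetic_laplacian A g \<alpha>"
    and lim: "L2_tendsto ?V f u" "L2_tendsto ?V h (\<lambda>p. complex_of_real \<mu> * u p)"
    using ev unfolding magnetic_eigenvalue_def magnetic_laplacian_closure_def by auto
  have sm: "smooth_fun A (f k)" "smooth_fun A (h k)" for k
    using fh[of k] unfolding magnetic_laplacian_def magnetic_D_adjoint_def by auto
  have mf: "magnetic_function A g \<alpha> (f k)" and mh: "magnetic_function A g \<alpha> (h k)" for k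
    using \<alpha> sm by unfold_locales
  have si: "square_integrable ?V (f k)" "square_integrable ?V (h k)" for k
    using magnetic_function.square_integrable_f[OF mf] magnetic_function.square_integrable_f[OF mh] .
  define w where "w p = complex_of_real \<mu> * u p" for p
  have w: "square_integrable ?V w" unfolding w_def by (rule square_integrable_scale[OF u(1)])
  have limw: "L2_tendsto ?V h w" using lim(2) by (simp add: w_def[abs_def])
  define U where "U = (LINT p|?V. (cmod (u p))\<^sup>2)"
  define X where "X k = (LINT p|?V. (cmod (f k p))\<^sup>2)" for k
  define Y where "Y k = (LINT p|?V. (magnetic_function.D_norm A g \<alpha> (f k) p)\<^sup>2)" for k
  have X: "X \<longlonglongrightarrow> U" unfolding X_def[abs_def] U_def by (rule L2_tendsto_norm[OF si(1) u(1) lim(1)])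
  have "(\<lambda>k. LINT p|?V. (cmod (f k p + h k p))\<^sup>2) \<longlonglongrightarrow> (LINT p|?V. (cmod (u p + w p))\<^sup>2)"
    by (rule L2_tendsto_norm[OF square_integrable_add[OF si] square_integrable_add[OF u(1) w] L2_tendsto_add[OF si(1) u(1) si(2) w lim(1) limw]])
  moreover have "(LINT p|?V. (cmod (u p + w p))\<^sup>2) = (1 + \<mu>)\<^sup>2 * U"
  proof -
    have "(cmod (u p + w p))\<^sup>2 = (1 + \<mu>)\<^sup>2 * (cmod (u p))\<^sup>2" for p
      unfolding w_def cmod_power2 by (simp add: power2_eq_square algebra_simps)
    thus ?thesis by (simp add: U_def)
  qed
  moreover have "(\<lambda>k. LINT p|?V. (cmod (f k p - h k p))\<^sup>2) \<longlonglongrightarrow> (LINT p|?V. (cmod (u p - w p))\<^sup>2)"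
  proof -
    have n: "square_integrable ?V (\<lambda>p. - h k p)" "square_integrable ?V (\<lambda>p. - w p)" for k
      using square_integrable_scale[OF si(2), of "-1"] square_integrable_scale[OF w, of "-1"] by auto
    have "(\<lambda>k. LINT p|?V. (cmod (f k p + - h k p))\<^sup>2) \<longlonglongrightarrow> (LINT p|?V. (cmod (u p + - w p))\<^sup>2)"
      by (rule L2_tendsto_norm[OF square_integrable_add[OF si(1) n(1)] square_integrable_add[OF u(1) n(2)]
          L2_tendsto_add[OF si(1) u(1) n lim(1) L2_tendsto_minus[OF limw]]])
    thus ?thesis by simp
  qed
  moreover have "(LINT p|?V. (cmod (u p - w p))\<^sup>2) = (1 - \<mu>)\<^sup>2 * U"
  proof -
    have "(cmod (u p - w p))\<^sup>2 = (1 - \<mu>)\<^sup>2 * (cmod (u p))\<^sup>2" for p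
      unfolding w_def cmod_power2 by (simp add: power2_eq_square algebra_simps)
    thus ?thesis by (simp add: U_def)
  qed
  \<comment> \<open>Since w = \<mu> u, the two norms in the polarized energy tend to
    \<open>(1 + \<mu>)\<^sup>2 U\<close> and \<open>(1 - \<mu>)\<^sup>2 U\<close>, and a quarter of
    their difference is \<mu> U.\<close>
  ultimately have "Y \<longlonglongrightarrow> ((1 + \<mu>)\<^sup>2 * U - (1 - \<mu>)\<^sup>2 * U) / 4"
    unfolding Y_def magnetic_function.energy_identity[OF mf fh]
    by (intro tendsto_divide tendsto_diff tendsto_const) auto
  moreover have "((1 + \<mu>)\<^sup>2 * U - (1 - \<mu>)\<^sup>2 * U) / 4 = \<mu> * U" by (simp add: power2_eq_square algebra_simps)
  ultimately have Y: "Y \<longlonglongrightarrow> \<mu> * U" by simp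
  have int_u: "integrable ?V (\<lambda>p. (cmod (u p))\<^sup>2)" using u(1) by (simp add: square_integrable_def)
  have "U \<noteq> 0"
  proof
    assume "U = 0"
    hence "AE p in ?V. (cmod (u p))\<^sup>2 = 0"
      unfolding U_def using integral_nonneg_eq_0_iff_AE[OF int_u] by simp
    thus False using u(2) by simp
  qed
  moreover have "U \<ge> 0" unfolding U_def by (simp add: integral_nonneg_AE)
  ultimately have U: "U > 0" by simp
  have Y0: "Y k \<ge> 0" for k unfolding Y_def by (simp add: integral_nonneg_AE)
  have "\<mu> * U \<ge> 0" using Y by (rule LIMSEQ_le_const) (use Y0 in auto)
  thus \<mu>: "\<mu> \<ge> 0" using U by (simp add: zero_le_mult_iff)
  have ray: "?C * ennreal (X k) \<le> ennreal (sqrt 5 * (sqrt (X k) * sqrt (Y k)))" for k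
    using magnetic_function.cheeger_rayleigh[OF mf, of k] unfolding magnetic_function.norm_sq_def[OF mf] X_def Y_def .
  \<comment> \<open>A single approximant of positive norm shows that the Cheeger constant is finite,
    so the limit can be taken in the reals.\<close>
  obtain k0 where k0: "X k0 > 0"
    using order_tendstoD(1)[OF X U] by (auto simp: eventually_sequentially)
  have "?C \<noteq> top"
  proof
    assume "?C = top"
    hence "?C * ennreal (X k0) = top" using k0 by (simp add: ennreal_top_mult)
    thus False using ray[of k0] by (simp add: top_unique)
  qed
  then obtain c where c: "c \<ge> 0" "?C = ennreal c" by (cases ?C) auto
  have "c * X k \<le> sqrt 5 * (sqrt (X k) * sqrt (Y k))" for k
  proof -
    have "0 \<le> X k" unfolding X_def by (simp add: integral_nonneg_AE)
    thus ?thesis using ray[of k] Y0[of k] c by (simp flip: ennreal_mult)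
  qed
  moreover have r: "(\<lambda>k. sqrt 5 * (sqrt (X k) * sqrt (Y k))) \<longlonglongrightarrow> sqrt 5 * (sqrt U * sqrt (\<mu> * U))"
    using X Y by (intro tendsto_intros)
  moreover have l: "(\<lambda>k. c * X k) \<longlonglongrightarrow> c * U" using X by (intro tendsto_intros)
  ultimately have "c * U \<le> sqrt 5 * (sqrt U * sqrt (\<mu> * U))" 
    by (intro LIMSEQ_le[OF l r]) auto
  also have "\<dots> = sqrt (5 * \<mu>) * U" using U by (simp add: real_sqrt_mult)
  finally have "c \<le> sqrt (5 * \<mu>)" using U by simp
  thus "?C \<le> ennreal (sqrt (5 * \<mu>))" unfolding c(2) by (rule ennreal_leI)
qed

theorem theorem7p4:
  fixes A :: "('m::{t2_space, second_countable_topology}, 'n::finite) chart set"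
    and g :: "('m, 'n) chart \<Rightarrow> 'm \<Rightarrow> real ^ 'n ^ 'n"
    and \<alpha> :: "('m, 'n) chart \<Rightarrow> 'm \<Rightarrow> real ^ 'n"
    and lambda1 :: real
  assumes "closed_connected_riemannian_manifold A g"
    and "smooth_one_form A \<alpha>"
    and "is_first_eigenvalue A g \<alpha> lambda1"
  shows "cheeger_constant A g \<alpha> \<le> ennreal (2 * sqrt (2 * lambda1))"
proof -
  interpret riemannian_manifold A g using assms(1) by unfold_locales
  have ev: "magnetic_eigenvalue A g \<alpha> lambda1" using assms(3) by (simp add: is_first_eigenvalue_def)
  note bound = cheeger_eigenvalue[OF assms(2) ev]
  \<comment> \<open>Replacing 5 by 8 uses that the eigenvalue is nonnegative, being a limit of
    energies divided by \<open>U\<close>.\<close>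
  have "sqrt (5 * lambda1) \<le> sqrt (4 * (2 * lambda1))" using bound(1) by (intro real_sqrt_le_mono) simp
  also have "\<dots> = 2 * sqrt (2 * lambda1)" by (simp only: real_sqrt_mult[of 4] real_sqrt_four)
  finally show ?thesis using bound(2) by (meson ennreal_leI order_trans)
qed

end
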